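(* Let $F$ be a smooth compact manifold. Assume that $D \in C^\infty(F\times F,\mathbb{R})$ is symmetric, $D(x,y)=D(y,x)$ for all $x,y\in F$, and equal to one on the diagonal, $D(x,x)=1$ for all $x\in F$. Furthermore, assume that for every $x \in F$ and $y \in K(x)$ there is a smooth curve $c$ joining the points $x$ and $y$, parametrized such that $c(0)=x$, along which $D(\cdot,y)$ has a non-zero derivative at $x$, i.e. $$\frac{d}{dt} D\big(c(t),y\big)\Big|_{t=0} \neq 0 .$$ Then the following statements are true: (A) If $F$ and $D$ are real analytic, then a minimizing measure $\rho$ is either generically timelike or the interior of $\operatorname{supp}\rho$ is empty. (B) If $D$ is smooth and if there is a differential operator $\Delta$ (of any finite order) on $C^\infty(F)$ which vanishes on the constant functions such that $$\Delta_x D(x,y) < 0 \qquad \text{for all } y \in I(x)$$ (for every $x\in F$, where $\Delta_x$ means that $\Delta$ acts on the variable $x$), then the interior of $\operatorname{supp}\rho$ is empty for every minimizing measure $\rho$.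
   Context: Set $L=\max(0,D)$. Let $\mathfrak{M}$ be the set of all normalized (total mass one) positive regular Borel measures on $F$, and for $\rho\in\mathfrak{M}$ let $S[\rho]=\iint_{F\times F}L(x,y)\,d\rho(x)\,d\rho(y)$. A minimizing measure (minimizer) is a $\rho\in\mathfrak{M}$ with $S[\rho]=\inf_{\tilde\rho\in\mathfrak{M}}S[\tilde\rho]$. For $x\in F$: $I(x)=\{y\in F: D(x,y)>0\}$, $J(x)=\{y\in F: D(x,y)\ge 0\}$, and $K(x)=\partial I(x)\cap\partial(F\setminus J(x))$ ($\partial$ = topological boundary in $F$). Thus $y\in K(x)$ if and only if $D(x,\cdot)$ changes sign in every neighborhood of $y$. The support is $\operatorname{supp}\rho=\{x\in F:\rho(U)\neq0 \text{ for every open neighborhood } U \text{ of } x\}$; its interior is taken in $F$. A minimizing measure $\rho$ is called generically timelike if (i) $D(x,y)\ge0$ for all $x,y\in\operatorname{supp}\rho$, and (ii) the function $d(x)=\int_F D(x,y)\,d\rho(y)$ is constant on $F$.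
   Formalization: In part (A) the manifold F is additionally assumed connected; for disconnected F the claim fails, e.g. for two disjoint circles with D = 1 within each circle and D = -1 across. *)

theory Defs
  imports "HOL-Probability.Probability"
begin

section \<open>Smooth and real analytic maps between Euclidean spaces\<close>

text \<open>These notions are meant for open domains \<open>S\<close>. Requiring all directional
  derivatives to be \<open>C\<^sup>k\<close> avoids a change of the codomain in the recursion.\<close>

primrec Ck_on :: "nat \<Rightarrow> ('e::euclidean_space \<Rightarrow> 'b::real_normed_vector) \<Rightarrow> 'e set \<Rightarrow> bool" where
  "Ck_on 0 f S \<longleftrightarrow> continuous_on S f"
| "Ck_on (Suc k) f S \<longleftrightarrow> (\<forall>x\<in>S. f differentiable (at x)) \<and>
     (\<forall>v. Ck_on k (\<lambda>x. frechet_derivative f (at x) v) S)"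

definition smooth_on :: "('e::euclidean_space \<Rightarrow> 'b::real_normed_vector) \<Rightarrow> 'e set \<Rightarrow> bool" where
  "smooth_on f S \<longleftrightarrow> (\<forall>k. Ck_on k f S)"

text \<open>The sum runs over the multi-indices \<open>\<alpha>\<close> supported on the coordinate directions,
  and \<open>has_sum\<close> means unconditional (absolute) convergence of the multivariate power series.\<close>

definition real_analytic_on ::
    "('e::euclidean_space \<Rightarrow> 'b::real_normed_vector) \<Rightarrow> 'e set \<Rightarrow> bool" where
  "real_analytic_on f S \<longleftrightarrow>
     (\<forall>x\<in>S. \<exists>r>0. \<exists>a :: ('e \<Rightarrow> nat) \<Rightarrow> 'b. \<forall>y\<in>ball x r.
        ((\<lambda>\<alpha>. (\<Prod>b\<in>Basis. ((y - x) \<bullet> b) ^ \<alpha> b) *\<^sub>R a \<alpha>) has_sum f y)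
          {\<alpha>. \<forall>b. b \<notin> Basis \<longrightarrow> \<alpha> b = 0})"

text \<open>\<open>iter_deriv [v\<^sub>1, \<dots>, v\<^sub>n] f = \<partial>\<^bsub>v\<^sub>1\<^esub> \<dots> \<partial>\<^bsub>v\<^sub>n\<^esub> f\<close>\<close>

primrec iter_deriv :: "'e::euclidean_space list \<Rightarrow> ('e \<Rightarrow> real) \<Rightarrow> 'e \<Rightarrow> real" where
  "iter_deriv [] f = f"
| "iter_deriv (v # vs) f = (\<lambda>x. frechet_derivative (iter_deriv vs f) (at x) v)"


section \<open>Manifolds\<close>

text \<open>The manifold is an entire type \<open>'a\<close> with its class topology; the smooth or analytic
  structure is given by a (not necessarily maximal) atlas of charts \<open>(U, \<phi>)\<close>, where only the
  values of \<open>\<phi>\<close> on \<open>U\<close> matter. The model space is a Euclidean space, so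
  the dimension is positive. Connectedness is not part of the definition; it is
  an explicit hypothesis for real analytic manifolds, where it is needed for the identity theorem
  (for \<open>F\<close> two disjoint circles and \<open>D = 1\<close> within, \<open>D = -1\<close> across the circles, the measure
  with uniform mass \<open>1/2\<close> on each circle is minimizing with full support, but not generically
  timelike).\<close>

type_synonym ('a, 'e) chart = "'a set \<times> ('a \<Rightarrow> 'e)"

definition is_chart :: "('a::topological_space, 'e::euclidean_space) chart \<Rightarrow> bool" where
  "is_chart = (\<lambda>(U, \<phi>). open U \<and> open (\<phi> ` U) \<and> homeomorphism U (\<phi> ` U) \<phi> (inv_into U \<phi>))"

definition smooth_atlas :: "('a::topological_space, 'e::euclidean_space) chart set \<Rightarrow> bool" where
  "smooth_atlas A \<longleftrightarrow> (\<forall>c\<in>A. is_chart c) \<and> (\<Union>c\<in>A. fst c) = UNIV \<and>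
     (\<forall>(U, \<phi>)\<in>A. \<forall>(V, \<psi>)\<in>A. smooth_on (\<psi> \<circ> inv_into U \<phi>) (\<phi> ` (U \<inter> V)))"

definition analytic_atlas :: "('a::topological_space, 'e::euclidean_space) chart set \<Rightarrow> bool" where
  "analytic_atlas A \<longleftrightarrow> (\<forall>c\<in>A. is_chart c) \<and> (\<Union>c\<in>A. fst c) = UNIV \<and>
     (\<forall>(U, \<phi>)\<in>A. \<forall>(V, \<psi>)\<in>A. real_analytic_on (\<psi> \<circ> inv_into U \<phi>) (\<phi> ` (U \<inter> V)))"

definition prod_atlas ::
    "('a, 'e) chart set \<Rightarrow> ('b, 'f) chart set \<Rightarrow> ('a \<times> 'b, 'e \<times> 'f) chart set" where
  "prod_atlas A B = {(U \<times> V, map_prod \<phi> \<psi>) |U \<phi> V \<psi>. (U, \<phi>) \<in> A \<and> (V, \<psi>) \<in> B}"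

definition smooth_function ::
    "('a::topological_space, 'e::euclidean_space) chart set \<Rightarrow> ('a \<Rightarrow> real) \<Rightarrow> bool" where
  "smooth_function A f \<longleftrightarrow> (\<forall>(U, \<phi>)\<in>A. smooth_on (f \<circ> inv_into U \<phi>) (\<phi> ` U))"

definition analytic_function ::
    "('a::topological_space, 'e::euclidean_space) chart set \<Rightarrow> ('a \<Rightarrow> real) \<Rightarrow> bool" where
  "analytic_function A f \<longleftrightarrow> (\<forall>(U, \<phi>)\<in>A. real_analytic_on (f \<circ> inv_into U \<phi>) (\<phi> ` U))"

text \<open>A smooth curve on \<open>[0,1]\<close> is one that is smooth on an open neighbourhood \<open>T\<close> of \<open>[0,1]\<close>.\<close>

definition smooth_curve ::
    "('a::topological_space, 'e::euclidean_space) chart set \<Rightarrow> (real \<Rightarrow> 'a) \<Rightarrow> bool" where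
  "smooth_curve A c \<longleftrightarrow> (\<exists>T. open T \<and> {0..1} \<subseteq> T \<and> continuous_on T c \<and>
     (\<forall>(U, \<phi>)\<in>A. smooth_on (\<phi> \<circ> c) (T \<inter> c -` U)))"

text \<open>Differential operators of finite order on \<open>C\<^sup>\<infinity>(F)\<close>: in every chart a combination of
  partial derivatives of order at most \<open>k\<close> with smooth coefficients. Partial derivatives are
  indexed by lists of coordinate directions, so mixed ones occur once for every ordering, which
  does not change the class of operators. Nothing is said about \<open>\<Delta> f\<close> for non-smooth \<open>f\<close>.\<close>

definition differential_operator ::
    "('a::topological_space, 'e::euclidean_space) chart set \<Rightarrow>
     (('a \<Rightarrow> real) \<Rightarrow> ('a \<Rightarrow> real)) \<Rightarrow> bool" where
  "differential_operator A \<Delta> \<longleftrightarrow> (\<exists>k. \<forall>(U, \<phi>)\<in>A. \<exists>a :: 'e list \<Rightarrow> 'e \<Rightarrow> real.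
     (\<forall>vs. set vs \<subseteq> Basis \<and> length vs \<le> k \<longrightarrow> smooth_on (a vs) (\<phi> ` U)) \<and>
     (\<forall>f. smooth_function A f \<longrightarrow> (\<forall>x\<in>U.
        \<Delta> f x = (\<Sum>vs | set vs \<subseteq> Basis \<and> length vs \<le> k.
                    a vs (\<phi> x) * iter_deriv vs (f \<circ> inv_into U \<phi>) (\<phi> x)))))"


section \<open>Causal variational principles\<close>

definition lagrangian :: "('a \<Rightarrow> 'a \<Rightarrow> real) \<Rightarrow> 'a \<Rightarrow> 'a \<Rightarrow> real" where
  "lagrangian D x y = max 0 (D x y)"

definition I_set :: "('a \<Rightarrow> 'a \<Rightarrow> real) \<Rightarrow> 'a \<Rightarrow> 'a set" where
  "I_set D x = {y. D x y > 0}"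

definition J_set :: "('a \<Rightarrow> 'a \<Rightarrow> real) \<Rightarrow> 'a \<Rightarrow> 'a set" where
  "J_set D x = {y. D x y \<ge> 0}"

definition K_set :: "('a::topological_space \<Rightarrow> 'a \<Rightarrow> real) \<Rightarrow> 'a \<Rightarrow> 'a set" where
  "K_set D x = frontier (I_set D x) \<inter> frontier (UNIV - J_set D x)"

definition regular_borel_measure :: "'a::topological_space measure \<Rightarrow> bool" where
  "regular_borel_measure \<rho> \<longleftrightarrow> sets \<rho> = sets borel \<and>
     (\<forall>B\<in>sets borel.
        emeasure \<rho> B = (INF U\<in>{U. open U \<and> B \<subseteq> U}. emeasure \<rho> U) \<and>
        emeasure \<rho> B = (SUP C\<in>{C. compact C \<and> C \<subseteq> B}. emeasure \<rho> C))"

definition normalized_measures :: "'a::topological_space measure set" where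
  "normalized_measures = {\<rho>. regular_borel_measure \<rho> \<and> prob_space \<rho>}"

definition action :: "('a::topological_space \<Rightarrow> 'a \<Rightarrow> real) \<Rightarrow> 'a measure \<Rightarrow> real" where
  "action D \<rho> = (\<integral>y. (\<integral>x. lagrangian D x y \<partial>\<rho>) \<partial>\<rho>)"

definition minimizing_measure ::
    "('a::topological_space \<Rightarrow> 'a \<Rightarrow> real) \<Rightarrow> 'a measure \<Rightarrow> bool" where
  "minimizing_measure D \<rho> \<longleftrightarrow>
     \<rho> \<in> normalized_measures \<and> action D \<rho> = (INF \<rho>'\<in>normalized_measures. action D \<rho>')"

definition measure_support :: "'a::topological_space measure \<Rightarrow> 'a set" where
  "measure_support \<rho> = {x. \<forall>U. open U \<and> x \<in> U \<longrightarrow> emeasure \<rho> U \<noteq> 0}"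

definition generically_timelike ::
    "('a::topological_space \<Rightarrow> 'a \<Rightarrow> real) \<Rightarrow> 'a measure \<Rightarrow> bool" where
  "generically_timelike D \<rho> \<longleftrightarrow> minimizing_measure D \<rho> \<and>
     (\<forall>x\<in>measure_support \<rho>. \<forall>y\<in>measure_support \<rho>. D x y \<ge> 0) \<and>
     (\<exists>d. \<forall>x. (\<integral>y. D x y \<partial>\<rho>) = d)"

end

theory Submission
  imports Defs "HOL-Complex_Analysis.Cauchy_Integral_Formula"
begin

text \<open>
  Write \<open>L = max 0 D\<close> and \<open>l x = \<integral> L x y d\<rho>(y)\<close>. Perturbing a minimizer \<open>\<rho>\<close> by bounded densities shows
  that \<open>l\<close> equals the action on the support and that the matrices \<open>(L x\<^sub>i x\<^sub>j)\<close> with points \<open>x\<^sub>i\<close> of the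
  support are positive semidefinite.

  Let \<open>x\<close> be interior to the support, \<open>y\<close> in the support, \<open>D x y = 0\<close>, and suppose that \<open>D \<cdot> y\<close> has a
  nonzero derivative at \<open>x\<close> in the direction \<open>w\<close>. Test positivity at \<open>x + t w\<close>, \<open>x\<close>, \<open>x - t w\<close> and \<open>y\<close>: the second
  difference of \<open>L \<cdot> y\<close> at its kink is of order \<open>t\<close>, whereas \<open>D = 1\<close> on the diagonal makes the double
  second difference of \<open>L\<close> near \<open>(x, x)\<close> an \<open>o(t\<^sup>2)\<close>, which is a contradiction. So \<open>y\<close> is not in \<open>K x\<close>. The
  curve hypothesis for \<open>x\<close> in \<open>K y\<close> produces a sign change of \<open>D x \<cdot>\<close> at \<open>y\<close>, so \<open>x\<close> is not in \<open>K y\<close> either,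
  and \<open>L \<cdot> y\<close> coincides near \<open>x\<close> with \<open>D \<cdot> y\<close> or with \<open>0\<close>.

  For (B), \<open>L\<close> is therefore smooth in its first argument there, and \<open>\<Delta>\<close> may be applied to the locally constant
  function \<open>l\<close> under the integral, where it gives something negative. For (A), the points \<open>y\<close> of the support
  split according to the sign of \<open>D \<cdot> y\<close> on a small connected set \<open>V\<close>; if \<open>P\<close> is the nonnegative part, then
  \<open>h x = \<integral>\<^sub>P D x y d\<rho>(y)\<close> is analytic and constant on \<open>V\<close>, hence constant. Since \<open>l\<close> and \<open>h\<close> agree on the support and
  \<open>L\<close> dominates the integrand of \<open>h\<close>, the two integrands agree there, which forces \<open>P\<close> to be the whole support.
\<close>

section \<open>Minimizing measures\<close>

text \<open>An open or compact set that approximates \<open>B\<close> for \<rho> up to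
  \<open>e / (C + 1)\<close> approximates it for \<nu> up to \<open>e\<close>, because \<nu> charges
  the difference set at most \<open>C\<close> times as much. This makes bounded densities admissible
  competitors in the variational problem.\<close>

lemma regular_borel_measure_bounded_by:
  fixes \<rho> \<nu> :: "'a::t2_space measure"
  assumes reg: "regular_borel_measure \<rho>" and fin: "finite_measure \<rho>"
    and sets: "sets \<nu> = sets borel" and C: "C \<ge> 0"
    and le: "\<And>B. B \<in> sets borel \<Longrightarrow> emeasure \<nu> B \<le> ennreal C * emeasure \<rho> B"
  shows "regular_borel_measure \<nu>"
proof -
  interpret finite_measure \<rho> by (rule fin)
  have sr: "sets \<rho> = sets borel"
    using reg by (simp add: regular_borel_measure_def)
  \<comment> \<open>Both halves of regularity use this estimate: the larger set is the open superset
    in the outer half, and the smaller one is the compact subset in the inner half. Dividing by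
    \<open>C + 1\<close> keeps the tolerance meaningful for \<open>C = 0\<close>.\<close>
  have diff: "emeasure \<nu> V \<le> emeasure \<nu> B + ennreal e"
    if "B \<in> sets borel" "V \<in> sets borel" "B \<subseteq> V" "e > 0"
      and lt: "emeasure \<rho> V \<le> emeasure \<rho> B + ennreal (e / (C + 1))" for B V e
  proof -
    have "emeasure \<rho> (V - B) \<le> ennreal (e / (C + 1))"
      using that C sr lt finite_measure_mono[of B V]
      by (simp add: emeasure_eq_measure ennreal_plus[symmetric] finite_measure_Diff
        del: ennreal_plus)
    then have "ennreal C * emeasure \<rho> (V - B) \<le> ennreal C * ennreal (e / (C + 1))"
      by (rule mult_left_mono) simp
    also have "\<dots> \<le> ennreal e"
      using C \<open>e > 0\<close> by (simp add: ennreal_mult[symmetric] ennreal_leI field_simps)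
    finally have "emeasure \<nu> (V - B) \<le> ennreal e"
      using le[of "V - B"] that by (meson order_trans sets.Diff)
    moreover have "emeasure \<nu> V \<le> emeasure \<nu> B + emeasure \<nu> (V - B)"
      using emeasure_subadditive[of B \<nu> "V - B"] that sets by (simp add: Un_absorb1)
    ultimately show ?thesis
      by (meson add_left_mono order_trans)
  qed
  have outer: "emeasure \<nu> B = (INF U\<in>{U. open U \<and> B \<subseteq> U}. emeasure \<nu> U)"
    if B: "B \<in> sets borel" for B
  proof (rule antisym)
    show "emeasure \<nu> B \<le> (INF U\<in>{U. open U \<and> B \<subseteq> U}. emeasure \<nu> U)"
      by (rule INF_greatest) (auto intro!: emeasure_mono simp: sets)
    show "(INF U\<in>{U. open U \<and> B \<subseteq> U}. emeasure \<nu> U) \<le> emeasure \<nu> B"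
    proof (rule ennreal_le_epsilon)
      fix e :: real assume "e > 0"
      with C have "e / (C + 1) > 0" by simp
      moreover have "emeasure \<rho> B = (INF U\<in>{U. open U \<and> B \<subseteq> U}. emeasure \<rho> U)"
        using reg B unfolding regular_borel_measure_def by blast
      moreover have "emeasure \<rho> B \<noteq> \<infinity>"
        by simp
      ultimately obtain U where U: "open U" "B \<subseteq> U"
          "emeasure \<rho> U < emeasure \<rho> B + ennreal (e / (C + 1))"
        using INF_approx_ennreal by (metis (mono_tags, lifting) mem_Collect_eq)
      have "(INF U\<in>{U. open U \<and> B \<subseteq> U}. emeasure \<nu> U) \<le> emeasure \<nu> U"
        using U by (intro INF_lower) auto
      also have "\<dots> \<le> emeasure \<nu> B + ennreal e"
        using U B \<open>e > 0\<close> by (intro diff) auto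
      finally show "(INF U\<in>{U. open U \<and> B \<subseteq> U}. emeasure \<nu> U) \<le> emeasure \<nu> B + ennreal e" .
    qed
  qed
  have inner: "emeasure \<nu> B = (SUP K\<in>{K. compact K \<and> K \<subseteq> B}. emeasure \<nu> K)"
    if B: "B \<in> sets borel" for B
  proof (rule antisym)
    show "(SUP K\<in>{K. compact K \<and> K \<subseteq> B}. emeasure \<nu> K) \<le> emeasure \<nu> B"
      by (rule SUP_least) (auto intro!: emeasure_mono simp: sets B)
    show "emeasure \<nu> B \<le> (SUP K\<in>{K. compact K \<and> K \<subseteq> B}. emeasure \<nu> K)"
    proof (rule ennreal_le_epsilon)
      fix e :: real assume "e > 0"
      with C have "e / (C + 1) > 0" by simp
      moreover have "emeasure \<rho> B = (SUP K\<in>{K. compact K \<and> K \<subseteq> B}. emeasure \<rho> K)"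
        using reg B unfolding regular_borel_measure_def by blast
      moreover have "{K. compact K \<and> K \<subseteq> B} \<noteq> {}"
        using compact_empty by blast
      moreover have "emeasure \<rho> B \<noteq> \<infinity>"
        by simp
      ultimately obtain K where K: "compact K" "K \<subseteq> B"
          "emeasure \<rho> B < emeasure \<rho> K + ennreal (e / (C + 1))"
        using SUP_approx_ennreal by (metis (mono_tags, lifting) mem_Collect_eq)
      have "emeasure \<nu> B \<le> emeasure \<nu> K + ennreal e"
        using K B \<open>e > 0\<close> by (intro diff) (auto intro: borel_closed compact_imp_closed)
      also have "\<dots> \<le> (SUP K\<in>{K. compact K \<and> K \<subseteq> B}. emeasure \<nu> K) + ennreal e"
        using K by (intro add_right_mono SUP_upper) auto
      finally show "emeasure \<nu> B \<le> (SUP K\<in>{K. compact K \<and> K \<subseteq> B}. emeasure \<nu> K) + ennreal e" .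
    qed
  qed
  show ?thesis
    unfolding regular_borel_measure_def using sets outer inner by blast
qed

text \<open>The complement of the support is the union of all open null sets. By the Lindelof
  property countably many of them have the same union, so this union is itself a null set.\<close>

lemma emeasure_measure_support_compl:
  fixes \<rho> :: "'a::second_countable_topology measure"
  assumes "sets \<rho> = sets borel"
  shows "emeasure \<rho> (- measure_support \<rho>) = 0" "open (- measure_support \<rho>)"
proof -
  define \<F> where "\<F> = {U. open U \<and> emeasure \<rho> U = 0}"
  have eq: "- measure_support \<rho> = \<Union>\<F>"
    by (auto simp: measure_support_def \<F>_def)
  obtain \<G> where \<G>: "\<G> \<subseteq> \<F>" "countable \<G>" "\<Union>\<G> = \<Union>\<F>"
    using Lindelof[of \<F>] by (auto simp: \<F>_def)
  have "(\<Union>U\<in>\<G>. U) \<in> null_sets \<rho>"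
    using \<G> assms by (intro null_sets_UN') (auto simp: \<F>_def null_sets_def)
  then show "emeasure \<rho> (- measure_support \<rho>) = 0"
    using \<G>(3) eq by (simp add: null_sets_def)
  show "open (- measure_support \<rho>)"
    unfolding eq by (rule open_Union) (auto simp: \<F>_def)
qed

lemma closed_measure_support:
  fixes \<rho> :: "'a::second_countable_topology measure"
  assumes "sets \<rho> = sets borel"
  shows "closed (measure_support \<rho>)"
  using emeasure_measure_support_compl(2)[OF assms] by (simp add: closed_def)

lemma AE_measure_support:
  fixes \<rho> :: "'a::second_countable_topology measure"
  assumes "sets \<rho> = sets borel"
  shows "AE x in \<rho>. x \<in> measure_support \<rho>"
proof (rule AE_I')
  show "- measure_support \<rho> \<in> null_sets \<rho>"
    using emeasure_measure_support_compl[OF assms] assms by (auto simp: null_sets_def)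
qed auto

text \<open>The exceptional set is open and null, so by definition it cannot contain a point of the
  support. This turns almost sure closed conditions into pointwise ones.\<close>

lemma AE_imp_on_measure_support:
  fixes \<rho> :: "'a::second_countable_topology measure" and P :: "'a \<Rightarrow> bool"
  assumes sets: "sets \<rho> = sets borel" and ae: "AE x in \<rho>. P x"
    and "open {x. \<not> P x}" and x: "x \<in> measure_support \<rho>"
  shows "P x"
proof (rule ccontr)
  assume "\<not> P x"
  then have "emeasure \<rho> {x. \<not> P x} \<noteq> 0"
    using x assms(3) by (auto simp: measure_support_def)
  moreover have "space \<rho> = UNIV"
    using sets_eq_imp_space_eq[OF sets] by simp
  then have "emeasure \<rho> {x. \<not> P x} = 0"
    using ae assms(3) by (subst (asm) AE_iff_measurable[OF _ refl]) (auto simp: sets)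
  ultimately show False by simp
qed


section \<open>Bounded test densities and continuous kernels on a compact space\<close>

locale minimizer =
  fixes D :: "'a::{t2_space, second_countable_topology} \<Rightarrow> 'a \<Rightarrow> real" and \<rho> :: "'a measure"
  assumes comp: "compact (UNIV :: 'a set)"
    and contD: "continuous_on UNIV (\<lambda>z. D (fst z) (snd z))"
    and symD: "D x y = D y x"
    and diagD: "D x x = 1"
    and minimizing: "minimizing_measure D \<rho>"
begin

lemma regular: "regular_borel_measure \<rho>"
  using minimizing by (simp add: minimizing_measure_def normalized_measures_def)

lemma sets_eq [measurable_cong]: "sets \<rho> = sets borel"
  using regular by (simp add: regular_borel_measure_def)

lemma space_eq: "space \<rho> = UNIV"
  using sets_eq_imp_space_eq[OF sets_eq] by simp

sublocale prob_space \<rho>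
  using minimizing by (simp add: minimizing_measure_def normalized_measures_def)

sublocale pair: pair_prob_space \<rho> \<rho> ..

abbreviation "L \<equiv> lagrangian D"

text \<open>These are the densities used to perturb \<rho>: a function algebra that contains
  indicators and continuous functions and whose members are all integrable, since \<rho> is
  finite.\<close>

definition bounded_borel :: "('a \<Rightarrow> real) \<Rightarrow> bool" where
  "bounded_borel f \<longleftrightarrow> f \<in> borel_measurable borel \<and> (\<exists>C. \<forall>x. \<bar>f x\<bar> \<le> C)"

lemma bounded_borel_measurable [measurable_dest]: "bounded_borel f \<Longrightarrow> f \<in> borel_measurable borel"
  by (simp add: bounded_borel_def)

lemma bounded_borel_const [simp, intro]: "bounded_borel (\<lambda>x. c)"
  by (auto simp: bounded_borel_def)

lemma bounded_borel_indicator [simp, intro]: "S \<in> sets borel \<Longrightarrow> bounded_borel (indicator S)"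
  by (auto simp: bounded_borel_def indicator_def intro!: exI[of _ 1])

lemma bounded_borel_mult [intro]:
  assumes "bounded_borel f" "bounded_borel g" shows "bounded_borel (\<lambda>x. f x * g x)"
proof -
  obtain C C' where "\<And>x. \<bar>f x\<bar> \<le> C" "\<And>x. \<bar>g x\<bar> \<le> C'"
    using assms by (auto simp: bounded_borel_def)
  then have "\<bar>f x * g x\<bar> \<le> C * C'" for x
    unfolding abs_mult by (intro mult_mono) (auto intro: order_trans[OF abs_ge_zero])
  then show ?thesis
    using assms unfolding bounded_borel_def by (auto intro: borel_measurable_times)
qed

lemma bounded_borel_add [intro]:
  assumes "bounded_borel f" "bounded_borel g" shows "bounded_borel (\<lambda>x. f x + g x)"
proof -
  obtain C C' where "\<And>x. \<bar>f x\<bar> \<le> C" "\<And>x. \<bar>g x\<bar> \<le> C'"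
    using assms by (auto simp: bounded_borel_def)
  then have "\<bar>f x + g x\<bar> \<le> C + C'" for x
    by (meson abs_triangle_ineq add_mono order_trans)
  then show ?thesis
    using assms unfolding bounded_borel_def by (auto intro: borel_measurable_add)
qed

lemma bounded_borel_diff [intro]: "bounded_borel f \<Longrightarrow> bounded_borel g \<Longrightarrow> bounded_borel (\<lambda>x. f x - g x)"
  using bounded_borel_add[of f "\<lambda>x. -1 * g x"] bounded_borel_mult[of "\<lambda>x. -1" g] by simp

lemma bounded_borel_sum [intro]: "(\<And>i. i \<in> S \<Longrightarrow> bounded_borel (f i)) \<Longrightarrow> bounded_borel (\<lambda>x. \<Sum>i\<in>S. f i x)"
  by (induction S rule: infinite_finite_induct) auto

lemma bounded_borel_integrable [simp, intro]:
  assumes "bounded_borel f" shows "integrable \<rho> f"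
proof -
  obtain C where "\<And>x. \<bar>f x\<bar> \<le> C"
    using assms by (auto simp: bounded_borel_def)
  then show ?thesis
    using assms by (intro integrable_const_bound[of _ C]) (auto dest: bounded_borel_measurable)
qed

lemma bounded_kernel:
  assumes "continuous_on UNIV (\<lambda>z::'a \<times> 'a. G (fst z) (snd z) :: real)"
  obtains M where "M \<ge> 0" "\<And>x y. \<bar>G x y\<bar> \<le> M"
proof -
  have "compact (UNIV :: ('a \<times> 'a) set)"
    using compact_Times[OF comp comp] by simp
  then have "bounded ((\<lambda>z. G (fst z) (snd z)) ` UNIV)"
    by (intro compact_imp_bounded compact_continuous_image assms)
  then obtain M where "\<And>z. \<bar>G (fst z) (snd z)\<bar> \<le> M"
    by (auto simp: bounded_iff)
  then have "\<bar>G x y\<bar> \<le> max M 0" for x y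
    by (metis fst_conv snd_conv max.coboundedI1)
  then show ?thesis
    by (intro that[of "max M 0"]) auto
qed

lemma contL: "continuous_on UNIV (\<lambda>z. L (fst z) (snd z))"
  unfolding lagrangian_def by (intro continuous_intros contD)

lemma symL: "L x y = L y x"
  by (simp add: lagrangian_def symD[of x y])

lemma L_nonneg [simp]: "0 \<le> L x y" and L_ge: "D x y \<le> L x y"
  and diagL [simp]: "L x x = 1"
  by (auto simp: lagrangian_def diagD)

lemma measurable_kernel:
  assumes "continuous_on UNIV (\<lambda>z::'a \<times> 'a. G (fst z) (snd z) :: real)"
  shows "(\<lambda>z. G (fst z) (snd z)) \<in> borel_measurable (borel \<Otimes>\<^sub>M borel)"
  using borel_measurable_continuous_onI[OF assms] by (simp add: borel_prod)

lemma continuous_kernel_slice: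
  assumes "continuous_on UNIV (\<lambda>z::'a \<times> 'a. G (fst z) (snd z) :: real)"
  shows "continuous_on UNIV (\<lambda>x. G x y)" "continuous_on UNIV (G x)"
  by (rule continuous_on_compose2[OF assms, of _ "\<lambda>x. (x, y)", simplified],
      auto intro!: continuous_intros)
     (rule continuous_on_compose2[OF assms, of _ "\<lambda>y. (x, y)", simplified],
      auto intro!: continuous_intros)

lemma bounded_borel_kernel:
  assumes "continuous_on UNIV (\<lambda>z::'a \<times> 'a. G (fst z) (snd z) :: real)"
  shows "bounded_borel (\<lambda>x. G x y)" "bounded_borel (G x)"
proof -
  obtain M where "\<And>x y. \<bar>G x y\<bar> \<le> M"
    using bounded_kernel[OF assms] by blast
  then show "bounded_borel (\<lambda>x. G x y)" "bounded_borel (G x)"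
    using continuous_kernel_slice[OF assms, THEN borel_measurable_continuous_onI]
    by (auto simp: bounded_borel_def)
qed

text \<open>By compactness of the second factor, \<open>G x' y\<close> is close to
  \<open>G x y\<close> uniformly in \<open>y\<close> when \<open>x'\<close> is near
  \<open>x\<close>. The bound on \<open>w\<close> carries this closeness over to the
  integrals.\<close>

lemma continuous_kernel_integral:
  assumes G: "continuous_on UNIV (\<lambda>z::'a \<times> 'a. G (fst z) (snd z) :: real)" and w: "bounded_borel w"
  shows "continuous_on UNIV (\<lambda>x. \<integral>y. w y * G x y \<partial>\<rho>)"
proof -
  obtain C where C: "\<And>x. \<bar>w x\<bar> \<le> C"
    using w by (auto simp: bounded_borel_def)
  have "C \<ge> 0"
    using C[of undefined] by linarith
  have int: "integrable \<rho> (\<lambda>y. w y * G x y)" for x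
    by (intro bounded_borel_integrable bounded_borel_mult w bounded_borel_kernel G)
  have "((\<lambda>x. \<integral>y. w y * G x y \<partial>\<rho>) \<longlongrightarrow> (\<integral>y. w y * G x y \<partial>\<rho>)) (at x)" for x
  proof (rule tendstoI)
    fix e :: real assume "e > 0"
    \<comment> \<open>The summand 1 covers \<open>C = 0\<close>, and the factor 2 leaves room for
      the strict inequality in the end.\<close>
    then have "e / (C + 1) / 2 > 0" using \<open>C \<ge> 0\<close> by simp
    then obtain X0 where X0: "x \<in> X0" "open X0"
        "\<forall>x'\<in>X0 \<inter> UNIV. \<forall>y\<in>UNIV. dist (G x' y) (G x y) \<le> e / (C + 1) / 2"
      using continuous_on_prod_compactE[OF G[folded UNIV_Times_UNIV] comp, of x] by auto
    have "dist (\<integral>y. w y * G x' y \<partial>\<rho>) (\<integral>y. w y * G x y \<partial>\<rho>) < e" if "x' \<in> X0" for x'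
    proof -
      have "\<bar>w y * G x' y - w y * G x y\<bar> \<le> e / 2" for y
      proof -
        have "\<bar>w y * G x' y - w y * G x y\<bar> = \<bar>w y\<bar> * \<bar>G x' y - G x y\<bar>"
          by (simp add: abs_mult[symmetric] right_diff_distrib)
        also have "\<dots> \<le> C * (e / (C + 1) / 2)"
          using C[of y] X0(3) that \<open>C \<ge> 0\<close> by (intro mult_mono) (auto simp: dist_real_def)
        also have "\<dots> \<le> e / 2"
          using \<open>C \<ge> 0\<close> \<open>e > 0\<close> by (simp add: field_simps)
        finally show ?thesis .
      qed
      then have "(\<integral>y. \<bar>w y * G x' y - w y * G x y\<bar> \<partial>\<rho>) \<le> (\<integral>y. e / 2 \<partial>\<rho>)"
        by (intro integral_mono integrable_abs Bochner_Integration.integrable_diff int) auto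
      moreover have "\<bar>\<integral>y. w y * G x' y - w y * G x y \<partial>\<rho>\<bar> \<le> (\<integral>y. \<bar>w y * G x' y - w y * G x y\<bar> \<partial>\<rho>)"
        by (rule integral_abs_bound)
      ultimately show ?thesis
        using \<open>e > 0\<close> int
        by (simp add: dist_real_def Bochner_Integration.integral_diff prob_space)
    qed
    then show "\<forall>\<^sub>F x' in at x. dist (\<integral>y. w y * G x' y \<partial>\<rho>) (\<integral>y. w y * G x y \<partial>\<rho>) < e"
      using X0 unfolding eventually_at_topological by blast
  qed
  then show ?thesis
    by (auto simp: continuous_on_def)
qed

section \<open>The bilinear energy form of the Lagrangian\<close>

definition weighted_potential :: "('a \<Rightarrow> real) \<Rightarrow> 'a \<Rightarrow> real" where
  "weighted_potential f y = (\<integral>x. f x * L x y \<partial>\<rho>)"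

lemma weighted_potential_commute: "weighted_potential f y = (\<integral>x. f x * L y x \<partial>\<rho>)"
  unfolding weighted_potential_def by (intro Bochner_Integration.integral_cong) (simp_all add: symL)

lemma continuous_weighted_potential: "bounded_borel f \<Longrightarrow> continuous_on UNIV (weighted_potential f)"
  using continuous_kernel_integral[OF contL, of f] by (simp add: weighted_potential_commute[abs_def])

lemma bounded_borel_continuous:
  assumes "continuous_on UNIV f" shows "bounded_borel f"
proof -
  have "bounded (f ` UNIV)"
    by (intro compact_imp_bounded compact_continuous_image assms comp)
  then show ?thesis
    using borel_measurable_continuous_onI[OF assms] by (auto simp: bounded_borel_def bounded_iff)
qed

lemma bounded_borel_weighted_potential [intro]: "bounded_borel f \<Longrightarrow> bounded_borel (weighted_potential f)"
  by (rule bounded_borel_continuous[OF continuous_weighted_potential])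

lemma bounded_borel_L [intro]: "bounded_borel (\<lambda>x. L x y)" "bounded_borel (L x)"
  by (intro bounded_borel_kernel contL)+

text \<open>This is the polarization of the action: for a nonnegative density \<open>f\<close>, the
  value \<open>energy f f\<close> is the action of the measure with density \<open>f\<close> with
  respect to \<rho>.\<close>

definition energy :: "('a \<Rightarrow> real) \<Rightarrow> ('a \<Rightarrow> real) \<Rightarrow> real" where
  "energy f g = (\<integral>y. g y * weighted_potential f y \<partial>\<rho>)"

lemma weighted_potential_add: "bounded_borel f \<Longrightarrow> bounded_borel g \<Longrightarrow> weighted_potential (\<lambda>x. f x + g x) y = weighted_potential f y + weighted_potential g y"
  by (auto simp: weighted_potential_def distrib_right intro!: Bochner_Integration.integral_add bounded_borel_integrable)

lemma weighted_potential_cmult: "weighted_potential (\<lambda>x. c * f x) y = c * weighted_potential f y"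
  by (simp add: weighted_potential_def mult.assoc)

lemma weighted_potential_sum: "(\<And>i. i \<in> S \<Longrightarrow> bounded_borel (f i)) \<Longrightarrow> weighted_potential (\<lambda>x. \<Sum>i\<in>S. f i x) y = (\<Sum>i\<in>S. weighted_potential (f i) y)"
  by (auto simp: weighted_potential_def sum_distrib_right intro!: Bochner_Integration.integral_sum bounded_borel_integrable)

lemma energy_add_left: "bounded_borel f \<Longrightarrow> bounded_borel f' \<Longrightarrow> bounded_borel g \<Longrightarrow> energy (\<lambda>x. f x + f' x) g = energy f g + energy f' g"
  by (auto simp: energy_def weighted_potential_add distrib_left intro!: Bochner_Integration.integral_add bounded_borel_integrable)

lemma energy_cmult_left: "energy (\<lambda>x. c * f x) g = c * energy f g"
  by (simp add: energy_def weighted_potential_cmult mult.left_commute[of _ c])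

text \<open>Fubini exchanges the two integrals, and symmetry of \<open>L\<close> identifies the
  result. Boundedness of \<open>f\<close>, \<open>g\<close> and \<open>L\<close> gives integrability
  on the product.\<close>

lemma energy_commute:
  assumes f: "bounded_borel f" and g: "bounded_borel g" shows "energy f g = energy g f"
proof -
  obtain C C' M where b: "\<And>x. \<bar>f x\<bar> \<le> C" "\<And>x. \<bar>g x\<bar> \<le> C'" "\<And>x y. \<bar>L x y\<bar> \<le> M"
    using f g bounded_kernel[OF contL] unfolding bounded_borel_def by metis
  have [measurable]: "f \<in> borel_measurable borel" "g \<in> borel_measurable borel"
      "(\<lambda>z. L (fst z) (snd z)) \<in> borel_measurable (borel \<Otimes>\<^sub>M borel)"
    using f g measurable_kernel[OF contL] by (auto dest: bounded_borel_measurable)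
  have "integrable (\<rho> \<Otimes>\<^sub>M \<rho>) (case_prod (\<lambda>x y. g y * (f x * L x y)))"
  proof (rule pair.P.integrable_const_bound[of _ "C' * (C * M)"])
    show "case_prod (\<lambda>x y. g y * (f x * L x y)) \<in> borel_measurable (\<rho> \<Otimes>\<^sub>M \<rho>)"
      unfolding case_prod_unfold by measurable
    have "\<bar>g y * (f x * L x y)\<bar> \<le> C' * (C * M)" for x y
      unfolding abs_mult using b order_trans[OF abs_ge_zero b(1)]
        order_trans[OF abs_ge_zero b(2)] order_trans[OF abs_ge_zero b(3)]
      by (intro mult_mono) auto
    then show "AE z in \<rho> \<Otimes>\<^sub>M \<rho>. norm (case z of (x, y) \<Rightarrow> g y * (f x * L x y)) \<le> C' * (C * M)"
      by auto
  qed
  from pair.Fubini_integral[OF this] have "energy f g = (\<integral>x. (\<integral>y. g y * (f x * L x y) \<partial>\<rho>) \<partial>\<rho>)"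
    by (simp add: energy_def weighted_potential_def)
  also have "(\<lambda>x. \<integral>y. g y * (f x * L x y) \<partial>\<rho>) = (\<lambda>x. f x * (\<integral>y. g y * L x y \<partial>\<rho>))"
  proof
    fix x
    have "(\<lambda>y. g y * (f x * L x y)) = (\<lambda>y. f x * (g y * L x y))"
      by (simp add: fun_eq_iff mult.left_commute)
    then show "(\<integral>y. g y * (f x * L x y) \<partial>\<rho>) = f x * (\<integral>y. g y * L x y \<partial>\<rho>)"
      by simp
  qed
  also have "(\<integral>x. f x * (\<integral>y. g y * L x y \<partial>\<rho>) \<partial>\<rho>) = energy g f"
    by (simp add: energy_def weighted_potential_commute)
  finally show ?thesis .
qed

lemma energy_add_right: "bounded_borel f \<Longrightarrow> bounded_borel g \<Longrightarrow> bounded_borel g' \<Longrightarrow> energy f (\<lambda>x. g x + g' x) = energy f g + energy f g'"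
  using energy_commute[of f] energy_add_left[of g g' f] by (simp only: bounded_borel_add)

lemma energy_cmult_right: "energy f (\<lambda>x. c * g x) = c * energy f g"
  by (simp add: energy_def mult.assoc)

lemma action_eq: "action D \<rho> = energy (\<lambda>_. 1) (\<lambda>_. 1)"
  by (simp add: action_def energy_def weighted_potential_def)

lemma action_nonneg: "0 \<le> action D \<nu>"
  unfolding action_def by (intro integral_nonneg_AE AE_I2) auto

section \<open>First and second variation of the action\<close>

text \<open>The infimum is taken in the reals, so it is a lower bound only because the action is
  bounded below, here by 0.\<close>

lemma action_le: "\<nu> \<in> normalized_measures \<Longrightarrow> action D \<rho> \<le> action D \<nu>"
  using minimizing action_nonneg unfolding minimizing_measure_def
  by (auto intro!: cINF_lower bdd_belowI2[of _ 0])

text \<open>The measure with density \<open>f\<close> is a competitor: it has total mass one by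
  \<open>int\<close>, and it is regular because it is dominated by a multiple of \<rho>.\<close>

lemma energy_ge_action:
  assumes f: "bounded_borel f" and nonneg: "\<And>x. 0 \<le> f x" and int: "(\<integral>x. f x \<partial>\<rho>) = 1"
  shows "action D \<rho> \<le> energy f f"
proof -
  define \<nu> where "\<nu> = density \<rho> (\<lambda>x. ennreal (f x))"
  obtain C where C: "\<And>x. \<bar>f x\<bar> \<le> C"
    using f by (auto simp: bounded_borel_def)
  have "C \<ge> 0"
    using C[of undefined] by linarith
  have [measurable]: "f \<in> borel_measurable borel"
    using f by (rule bounded_borel_measurable)
  have "prob_space \<nu>"
  proof (rule prob_spaceI)
    have "emeasure \<nu> (space \<nu>) = (\<integral>\<^sup>+x. ennreal (f x) \<partial>\<rho>)"
      by (simp add: \<nu>_def emeasure_density space_eq)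
    also have "\<dots> = ennreal (\<integral>x. f x \<partial>\<rho>)"
      using nonneg f by (intro nn_integral_eq_integral) auto
    finally show "emeasure \<nu> (space \<nu>) = 1"
      by (simp add: int)
  qed
  moreover have "regular_borel_measure \<nu>"
  proof (rule regular_borel_measure_bounded_by[OF regular])
    show "finite_measure \<rho>" by unfold_locales
    show "emeasure \<nu> S \<le> ennreal C * emeasure \<rho> S" if "S \<in> sets borel" for S
    proof -
      have "emeasure \<nu> S = (\<integral>\<^sup>+x. ennreal (f x) * indicator S x \<partial>\<rho>)"
        using that by (simp add: \<nu>_def emeasure_density sets_eq)
      also have "\<dots> \<le> (\<integral>\<^sup>+x. ennreal C * indicator S x \<partial>\<rho>)"
        using C by (intro nn_integral_mono mult_right_mono ennreal_leI) (auto simp: abs_le_iff)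
      also have "\<dots> = ennreal C * emeasure \<rho> S"
        using that by (simp add: nn_integral_cmult_indicator sets_eq)
      finally show ?thesis .
    qed
  qed (use \<open>C \<ge> 0\<close> in \<open>auto simp: \<nu>_def sets_eq\<close>)
  ultimately have "action D \<rho> \<le> action D \<nu>"
    by (intro action_le) (simp add: normalized_measures_def)
  also have "action D \<nu> = (\<integral>y. weighted_potential f y \<partial>\<nu>)"
  proof -
    have "(\<integral>x. L x y \<partial>\<nu>) = weighted_potential f y" for y
      unfolding \<nu>_def weighted_potential_def using nonneg bounded_borel_measurable[OF bounded_borel_L(1)[of y]]
      by (subst integral_density) auto
    then show ?thesis by (simp add: action_def)
  qed
  also have "\<dots> = energy f f"
    unfolding \<nu>_def energy_def using nonneg bounded_borel_measurable[OF bounded_borel_weighted_potential[OF f]]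
    by (subst integral_density) auto
  finally show ?thesis .
qed

text \<open>The density \<open>1 + t * f\<close> keeps total mass one because \<open>f\<close> has
  mean zero, and it is nonnegative for small \<open>t\<close> because \<open>f\<close> is bounded.
  Expanding its energy, the constant term cancels against the action of \<rho>.\<close>

lemma quadratic_perturbation:
  assumes f: "bounded_borel f" and int: "(\<integral>x. f x \<partial>\<rho>) = 0"
  obtains \<delta> where "\<delta> > 0" "\<And>t. \<bar>t\<bar> < \<delta> \<Longrightarrow> 0 \<le> 2 * t * energy (\<lambda>_. 1) f + t\<^sup>2 * energy f f"
proof -
  obtain C where C: "\<And>x. \<bar>f x\<bar> \<le> C"
    using f by (auto simp: bounded_borel_def)
  have C0: "C \<ge> 0"
    using C[of undefined] by linarith
  show ?thesis
  proof
    show "1 / (C + 1) > 0" using C0 by simp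
    fix t :: real assume t: "\<bar>t\<bar> < 1 / (C + 1)"
    have "0 \<le> 1 + t * f x" for x
    proof -
      have "\<bar>t * f x\<bar> \<le> 1 / (C + 1) * C"
        unfolding abs_mult using C[of x] t C0 by (intro mult_mono) auto
      also have "\<dots> \<le> 1" using C0 by simp
      finally show ?thesis by linarith
    qed
    moreover have "(\<integral>x. 1 + t * f x \<partial>\<rho>) = 1"
      using f int by (subst Bochner_Integration.integral_add) (auto simp: prob_space)
    moreover have tf: "bounded_borel (\<lambda>x. t * f x)" and "bounded_borel (\<lambda>x. 1 + t * f x)"
      using f by (auto intro!: bounded_borel_add bounded_borel_mult)
    ultimately have "action D \<rho> \<le> energy (\<lambda>x. 1 + t * f x) (\<lambda>x. 1 + t * f x)"
      by (intro energy_ge_action)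
    also have "\<dots> = energy (\<lambda>_. 1) (\<lambda>x. 1 + t * f x) + t * energy f (\<lambda>x. 1 + t * f x)"
      using \<open>bounded_borel (\<lambda>x. 1 + t * f x)\<close> by (simp add: energy_add_left[OF bounded_borel_const tf] energy_cmult_left)
    also have "\<dots> = energy (\<lambda>_. 1) (\<lambda>_. 1) + 2 * t * energy (\<lambda>_. 1) f + t\<^sup>2 * energy f f"
      using energy_commute[OF bounded_borel_const f, of 1]
      by (simp add: energy_add_right[OF _ bounded_borel_const tf] f energy_cmult_right power2_eq_square algebra_simps)
    finally show "0 \<le> 2 * t * energy (\<lambda>_. 1) f + t\<^sup>2 * energy f f"
      by (simp add: action_eq)
  qed
qed

text \<open>Dividing the quadratic inequality by \<open>t\<close> and letting \<open>t\<close> tend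
  to 0 from the right and from the left bounds the linear coefficient from below and from above by
  0. What remains is the sign of the quadratic coefficient.\<close>

lemma first_variation:
  assumes f: "bounded_borel f" and int: "(\<integral>x. f x \<partial>\<rho>) = 0"
  shows "energy (\<lambda>_. 1) f = 0" "energy f f \<ge> 0"
proof -
  obtain \<delta> where \<delta>: "\<delta> > 0" "\<And>t. \<bar>t\<bar> < \<delta> \<Longrightarrow> 0 \<le> 2 * t * energy (\<lambda>_. 1) f + t\<^sup>2 * energy f f"
    using quadratic_perturbation[OF assms] by blast
  define b where "b = energy (\<lambda>_. 1) f"
  define q where "q = energy f f"
  have lim: "((\<lambda>t. 2 * b + t * q) \<longlongrightarrow> 2 * b) (at 0 within S)" for S
    by (auto intro!: tendsto_eq_intros)
  have "0 \<le> 2 * b"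
  proof (rule tendsto_lowerbound[OF lim[of "{0<..}"]])
    show "\<forall>\<^sub>F t in at_right 0. 0 \<le> 2 * b + t * q"
      using eventually_at_right_real[OF \<delta>(1)]
    proof eventually_elim
      case (elim t)
      with \<delta>(2)[of t] have "0 \<le> t * (2 * b + t * q)"
        by (simp add: b_def q_def power2_eq_square algebra_simps)
      with elim show ?case by (simp add: zero_le_mult_iff)
    qed
  qed auto
  moreover have "2 * b \<le> 0"
  proof (rule tendsto_upperbound[OF lim[of "{..<0}"]])
    show "\<forall>\<^sub>F t in at_left 0. 2 * b + t * q \<le> 0"
      using eventually_at_left_real[of "-\<delta>" 0, simplified, OF \<delta>(1)]
    proof eventually_elim
      case (elim t)
      with \<delta>(2)[of t] have "0 \<le> t * (2 * b + t * q)"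
        by (simp add: b_def q_def power2_eq_square algebra_simps)
      with elim show ?case by (simp add: zero_le_mult_iff)
    qed
  qed auto
  ultimately have "b = 0" by simp
  then show "energy (\<lambda>_. 1) f = 0" by (simp add: b_def)
  show "energy f f \<ge> 0"
    using \<delta>(2)[of "\<delta> / 2"] \<delta>(1) \<open>b = 0\<close> by (simp add: b_def zero_le_mult_iff)
qed

definition potential :: "'a \<Rightarrow> real" where
  "potential x = (\<integral>y. L x y \<partial>\<rho>)"

lemma potential_eq: "potential = weighted_potential (\<lambda>_. 1)"
  by (simp add: fun_eq_iff potential_def weighted_potential_def symL)

lemma continuous_potential: "continuous_on UNIV potential"
  unfolding potential_eq by (intro continuous_weighted_potential) auto

text \<open>The test density is the deviation of the potential from its mean, which is the action.
  Vanishing of the first variation then says that the integral of its square is zero. Continuity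
  extends the almost sure equality to the whole support.\<close>

lemma potential_constant:
  assumes x: "x \<in> measure_support \<rho>"
  shows "potential x = action D \<rho>"
proof -
  define f where "f x = potential x - action D \<rho>" for x
  have cf: "continuous_on UNIV f"
    unfolding f_def by (intro continuous_intros continuous_potential)
  then have f: "bounded_borel f" by (rule bounded_borel_continuous)
  have S: "action D \<rho> = (\<integral>x. potential x \<partial>\<rho>)"
    by (simp add: action_eq energy_def potential_eq)
  have int: "(\<integral>x. f x \<partial>\<rho>) = 0"
    unfolding f_def using bounded_borel_continuous[OF continuous_potential]
    by (subst Bochner_Integration.integral_diff) (auto simp: S prob_space)
  \<comment> \<open>Subtracting a multiple of the mean of \<open>f\<close>, which is zero, completes
    the first variation to the integral of \<open>f * f\<close>.\<close>
  have "0 = (\<integral>x. f x * potential x \<partial>\<rho>) - action D \<rho> * (\<integral>x. f x \<partial>\<rho>)"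
    using first_variation(1)[OF f int] int by (simp add: energy_def potential_eq)
  also have "\<dots> = (\<integral>x. f x * potential x - action D \<rho> * f x \<partial>\<rho>)"
    using f bounded_borel_continuous[OF continuous_potential]
    by (subst Bochner_Integration.integral_diff) auto
  also have "\<dots> = (\<integral>x. f x * f x \<partial>\<rho>)"
    by (simp add: f_def algebra_simps)
  finally have "AE x in \<rho>. f x * f x = 0"
    using f by (subst (asm) eq_commute, subst (asm) integral_nonneg_eq_0_iff_AE) auto
  then have "f x * f x = 0"
  proof (rule AE_imp_on_measure_support[OF sets_eq _ _ x])
    have "open (f -` (- {0}))"
      using cf by (intro open_vimage) auto
    then show "open {x. f x * f x \<noteq> 0}"
      by (simp add: vimage_def)
  qed
  then show ?thesis by (simp add: f_def)
qed

text \<open>The function splits into its mean \<open>m\<close> and a part \<open>g\<close> of mean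
  zero. The mixed terms vanish by the first variation, \<open>g\<close> contributes a nonnegative
  second variation, and the constant contributes \<open>m\<close> squared times the action.\<close>

lemma energy_nonneg:
  assumes f: "bounded_borel f" shows "0 \<le> energy f f"
proof -
  define m where "m = (\<integral>x. f x \<partial>\<rho>)"
  define g where "g x = f x - m" for x
  have g: "bounded_borel g" unfolding g_def using f by auto
  have "(\<integral>x. g x \<partial>\<rho>) = 0"
    unfolding g_def using f
    by (subst Bochner_Integration.integral_diff) (auto simp: m_def prob_space)
  note fv = first_variation[OF g this]
  have m1: "bounded_borel (\<lambda>x. m * 1)" by auto
  \<comment> \<open>The constant is written \<open>m * 1\<close> so that the homogeneity rules for
    \<open>energy\<close> apply to it in either argument.\<close>
  have f_eq: "f = (\<lambda>x. m * 1 + g x)" by (auto simp: g_def)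
  have "energy f f = energy (\<lambda>x. m * 1) f + energy g f"
    using energy_add_left[OF m1 g f] by (simp only: f_eq[symmetric])
  also have "energy (\<lambda>x. m * 1) f = m * (energy (\<lambda>x. 1) (\<lambda>x. m * 1) + energy (\<lambda>x. 1) g)"
    using energy_add_right[OF bounded_borel_const m1 g, of 1] energy_cmult_left[of m "\<lambda>x. 1" f]
    by (simp only: f_eq[symmetric])
  also have "energy g f = energy g (\<lambda>x. m * 1) + energy g g"
    using energy_add_right[OF g m1 g] by (simp only: f_eq[symmetric])
  finally have "energy f f = m\<^sup>2 * energy (\<lambda>_. 1) (\<lambda>_. 1) + energy g g"
    using fv(1) energy_commute[OF bounded_borel_const g, of 1]
    by (simp only: energy_cmult_right) (simp add: power2_eq_square)
  then show ?thesis
    using fv(2) action_nonneg[of \<rho>] by (simp add: action_eq)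
qed

section \<open>Positive semidefinite Gram matrices on the support\<close>

lemma energy_sum_left:
  "(\<And>i. i \<in> S \<Longrightarrow> bounded_borel (f i)) \<Longrightarrow> bounded_borel g \<Longrightarrow> energy (\<lambda>x. \<Sum>i\<in>S. f i x) g = (\<Sum>i\<in>S. energy (f i) g)"
  by (auto simp: energy_def weighted_potential_sum sum_distrib_left intro!: Bochner_Integration.integral_sum bounded_borel_integrable)

lemma energy_sum_right:
  "(\<And>i. i \<in> S \<Longrightarrow> bounded_borel (f i)) \<Longrightarrow> bounded_borel g \<Longrightarrow> energy g (\<lambda>x. \<Sum>i\<in>S. f i x) = (\<Sum>i\<in>S. energy g (f i))"
  using energy_sum_left[of S f g] energy_commute[of g] by (auto simp: bounded_borel_sum)

text \<open>The pointwise error \<open>e\<close> is integrated twice, first over \<open>U\<close>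
  for fixed \<open>y\<close> in \<open>V\<close>, then over \<open>V\<close>.\<close>

lemma abs_energy_indicator_diff:
  assumes [simp]: "U \<in> sets borel" "V \<in> sets borel"
    and le: "\<And>x y. x \<in> U \<Longrightarrow> y \<in> V \<Longrightarrow> \<bar>L x y - l\<bar> \<le> e"
  shows "\<bar>energy (indicator U) (indicator V) - l * (prob U * prob V)\<bar> \<le> e * (prob U * prob V)"
proof -
  have U: "(\<integral>x. indicator U x \<partial>\<rho>) = prob U" "(\<integral>x. indicator V x \<partial>\<rho>) = prob V"
    by (simp_all add: sets_eq space_eq)
  have *: "\<bar>weighted_potential (indicator U) y - l * prob U\<bar> \<le> e * prob U" if "y \<in> V" for y
  proof -
    have "weighted_potential (indicator U) y - l * prob U = (\<integral>x. indicator U x * L x y - l * indicator U x \<partial>\<rho>)"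
      unfolding weighted_potential_def U(1)[symmetric]
      by (subst Bochner_Integration.integral_diff) (auto intro!: bounded_borel_integrable bounded_borel_mult bounded_borel_diff)
    also have "\<bar>\<dots>\<bar> \<le> (\<integral>x. \<bar>indicator U x * L x y - l * indicator U x\<bar> \<partial>\<rho>)"
      by (rule integral_abs_bound)
    also have "\<dots> \<le> (\<integral>x. e * indicator U x \<partial>\<rho>)"
      using le[OF _ that]
      by (intro integral_mono integrable_abs bounded_borel_integrable bounded_borel_diff bounded_borel_mult)
         (auto split: split_indicator)
    finally show ?thesis by (simp add: U space_eq)
  qed
  have "energy (indicator U) (indicator V) - l * (prob U * prob V) =
      (\<integral>y. indicator V y * weighted_potential (indicator U) y - l * prob U * indicator V y \<partial>\<rho>)"
    unfolding energy_def U(2)[symmetric]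
    by (subst Bochner_Integration.integral_diff) (auto intro!: bounded_borel_integrable bounded_borel_mult bounded_borel_weighted_potential bounded_borel_indicator)
  also have "\<bar>\<dots>\<bar> \<le> (\<integral>y. \<bar>indicator V y * weighted_potential (indicator U) y - l * prob U * indicator V y\<bar> \<partial>\<rho>)"
    by (rule integral_abs_bound)
  also have "\<dots> \<le> (\<integral>y. e * prob U * indicator V y \<partial>\<rho>)"
    using * by (intro integral_mono integrable_abs bounded_borel_integrable bounded_borel_diff bounded_borel_mult bounded_borel_weighted_potential)
               (auto split: split_indicator)
  finally show ?thesis by (simp add: U space_eq)
qed

text \<open>The point masses at the \<open>p i\<close> are approximated by normalized indicators of
  small neighbourhoods, which is possible because these have positive measure. Nonnegativity of
  \<open>energy\<close> for the resulting combination passes to the matrix in the limit.\<close>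

lemma gram_nonneg:
  assumes I: "finite I" and p: "\<And>i. i \<in> I \<Longrightarrow> p i \<in> measure_support \<rho>"
  shows "0 \<le> (\<Sum>i\<in>I. \<Sum>j\<in>I. c i * c j * L (p i) (p j))"
proof (rule field_le_epsilon)
  fix e :: real assume "e > 0"
  define K where "K = (\<Sum>i\<in>I. \<Sum>j\<in>I. \<bar>c i * c j\<bar>)"
  have "K \<ge> 0" unfolding K_def by (intro sum_nonneg) auto
  \<comment> \<open>Summed over all pairs of indices, the tolerance \<open>e'\<close> produces a
    total error of \<open>e' * K\<close>, which is at most \<open>e\<close>.\<close>
  define e' where "e' = e / (K + 1)"
  have "e' > 0" using \<open>K \<ge> 0\<close> \<open>e > 0\<close> by (simp add: e'_def)
  have "\<exists>U V. open U \<and> open V \<and> p i \<in> U \<and> p j \<in> V \<and>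
      (\<forall>x\<in>U. \<forall>y\<in>V. \<bar>L x y - L (p i) (p j)\<bar> \<le> e')" for i j
  proof -
    have "open ((\<lambda>z. L (fst z) (snd z)) -` ball (L (p i) (p j)) e')"
      by (intro open_vimage contL) simp
    moreover have "(p i, p j) \<in> (\<lambda>z. L (fst z) (snd z)) -` ball (L (p i) (p j)) e'"
      using \<open>e' > 0\<close> by simp
    ultimately obtain U V where "open U" "open V" "(p i, p j) \<in> U \<times> V"
        "U \<times> V \<subseteq> (\<lambda>z. L (fst z) (snd z)) -` ball (L (p i) (p j)) e'"
      by (rule open_prod_elim)
    then show ?thesis
      by (intro exI[of _ U] exI[of _ V]) (fastforce simp: dist_real_def abs_minus_commute)
  qed
  then obtain U V where UV: "\<And>i j. open (U i j)" "\<And>i j. open (V i j)" "\<And>i j. p i \<in> U i j"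
      "\<And>i j. p j \<in> V i j"
      "\<And>i j x y. x \<in> U i j \<Longrightarrow> y \<in> V i j \<Longrightarrow> \<bar>L x y - L (p i) (p j)\<bar> \<le> e'"
    by metis
  \<comment> \<open>A single neighbourhood of \<open>p i\<close> must work against every
    \<open>j\<close>, both when \<open>p i\<close> stands in the first argument of \<open>L\<close>
    and when it stands in the second.\<close>
  define W where "W i = (\<Inter>j\<in>I. U i j \<inter> V j i)" for i
  have W: "open (W i)" "p i \<in> W i" for i
    unfolding W_def using UV I by (auto intro!: open_INT)
  have Wb [simp]: "W i \<in> sets borel" for i
    using W by simp
  have pos: "prob (W i) > 0" if "i \<in> I" for i
    using p[OF that] W[of i]
    by (auto simp: measure_support_def emeasure_eq_measure zero_less_measure_iff)
  have est: "\<bar>energy (indicator (W i)) (indicator (W j)) - L (p i) (p j) * (prob (W i) * prob (W j))\<bar>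
      \<le> e' * (prob (W i) * prob (W j))" if "i \<in> I" "j \<in> I" for i j
  proof (rule abs_energy_indicator_diff[OF Wb Wb])
    show "\<bar>L x y - L (p i) (p j)\<bar> \<le> e'" if "x \<in> W i" "y \<in> W j" for x y
      using that \<open>i \<in> I\<close> \<open>j \<in> I\<close> by (intro UV(5)) (auto simp: W_def)
  qed
  define \<psi> where "\<psi> = (\<lambda>x. \<Sum>i\<in>I. c i / prob (W i) * indicator (W i) x)"
  have "bounded_borel \<psi>" unfolding \<psi>_def by (intro bounded_borel_sum bounded_borel_mult bounded_borel_const bounded_borel_indicator Wb)
  then have "0 \<le> energy \<psi> \<psi>" by (rule energy_nonneg)
  also have "energy \<psi> \<psi> = (\<Sum>i\<in>I. energy (\<lambda>x. c i / prob (W i) * indicator (W i) x) \<psi>)"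
    unfolding \<psi>_def by (intro energy_sum_left bounded_borel_sum bounded_borel_mult bounded_borel_const bounded_borel_indicator Wb)
  also have "\<dots> = (\<Sum>i\<in>I. \<Sum>j\<in>I. energy (\<lambda>x. c i / prob (W i) * indicator (W i) x)
      (\<lambda>x. c j / prob (W j) * indicator (W j) x))"
    unfolding \<psi>_def by (intro sum.cong refl energy_sum_right bounded_borel_mult bounded_borel_const bounded_borel_indicator Wb)
  also have "\<dots> \<le> (\<Sum>i\<in>I. \<Sum>j\<in>I. c i * c j * L (p i) (p j) + e' * \<bar>c i * c j\<bar>)"
  proof (intro sum_mono)
    fix i j assume ij: "i \<in> I" "j \<in> I"
    define m where "m = prob (W i) * prob (W j)"
    define b where "b = energy (indicator (W i)) (indicator (W j))"
    have m: "m > 0" using pos ij by (simp add: m_def)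
    have "energy (\<lambda>x. c i / prob (W i) * indicator (W i) x) (\<lambda>x. c j / prob (W j) * indicator (W j) x)
        = c i * c j * L (p i) (p j) + c i * c j * (b - L (p i) (p j) * m) / m"
      using m pos[OF ij(1)] pos[OF ij(2)]
    proof -
      have "x / u * (z / v * b) = x * z * l + x * z * (b - l * (u * v)) / (u * v)"
        if "u > 0" "v > 0" for x z u v l :: real
        using that by (simp add: field_simps)
      from this[OF pos[OF ij(1)] pos[OF ij(2)]] show ?thesis
        unfolding energy_cmult_left energy_cmult_right b_def[symmetric] m_def .
    qed
    also have "c i * c j * (b - L (p i) (p j) * m) / m \<le> \<bar>c i * c j\<bar> * (e' * m) / m"
    proof (intro divide_right_mono)
      have "c i * c j * (b - L (p i) (p j) * m) \<le> \<bar>c i * c j\<bar> * \<bar>b - L (p i) (p j) * m\<bar>"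
        using abs_mult abs_ge_self by metis
      also have "\<dots> \<le> \<bar>c i * c j\<bar> * (e' * m)"
        using est[OF ij] by (intro mult_left_mono) (auto simp: b_def m_def)
      finally show "c i * c j * (b - L (p i) (p j) * m) \<le> \<bar>c i * c j\<bar> * (e' * m)" .
    qed (use m in simp)
    finally show "energy (\<lambda>x. c i / prob (W i) * indicator (W i) x) (\<lambda>x. c j / prob (W j) * indicator (W j) x)
        \<le> c i * c j * L (p i) (p j) + e' * \<bar>c i * c j\<bar>"
      using m by (simp add: mult.commute)
  qed
  also have "\<dots> = (\<Sum>i\<in>I. \<Sum>j\<in>I. c i * c j * L (p i) (p j)) + e' * K"
    by (simp add: K_def sum.distrib sum_distrib_left)
  also have "e' * K \<le> e"
    using \<open>K \<ge> 0\<close> \<open>e > 0\<close> by (simp add: e'_def field_simps)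
  finally show "0 \<le> (\<Sum>i\<in>I. \<Sum>j\<in>I. c i * c j * L (p i) (p j)) + e" by simp
qed

end

section \<open>Smooth functions and second differences\<close>

text \<open>\<open>frechet_derivative\<close> is a choice from the set of derivatives. The two sets
  are shown to be equal, so the choices agree, also at points without a derivative.\<close>

lemma frechet_derivative_cong_open:
  fixes f g :: "'e::real_normed_vector \<Rightarrow> 'b::real_normed_vector"
  assumes "open S" "x \<in> S" "\<And>x. x \<in> S \<Longrightarrow> f x = g x"
  shows "frechet_derivative f (at x) = frechet_derivative g (at x)"
proof -
  have "(f has_derivative F) (at x) \<longleftrightarrow> (g has_derivative F) (at x)" for F
  proof
    assume "(f has_derivative F) (at x)"
    then show "(g has_derivative F) (at x)"
      by (rule has_derivative_transform_within_open[OF _ assms(1,2)]) (rule assms(3))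
  next
    assume "(g has_derivative F) (at x)"
    then show "(f has_derivative F) (at x)"
      by (rule has_derivative_transform_within_open[OF _ assms(1,2)]) (rule assms(3)[symmetric])
  qed
  then have "(\<lambda>F. (f has_derivative F) (at x)) = (\<lambda>F. (g has_derivative F) (at x))"
    by (rule ext)
  then show ?thesis
    unfolding frechet_derivative_def by (rule arg_cong)
qed

lemma Ck_on_cong:
  assumes "open S" "\<And>x. x \<in> S \<Longrightarrow> f x = g x" "Ck_on k f S"
  shows "Ck_on k g S"
  using assms(2,3)
proof (induction k arbitrary: f g)
  case 0
  then show ?case by (auto intro: continuous_on_eq)
next
  case (Suc k)
  have "g differentiable (at x)" if "x \<in> S" for x
  proof -
    have "f differentiable (at x)"
      using Suc.prems(2) that by simp
    then obtain F where "(f has_derivative F) (at x)"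
      unfolding differentiable_def by (rule exE)
    then have "(g has_derivative F) (at x)"
      by (rule has_derivative_transform_within_open[OF _ \<open>open S\<close> that]) (rule Suc.prems(1))
    then show ?thesis by (auto simp: differentiable_def)
  qed
  moreover have "Ck_on k (\<lambda>x. frechet_derivative g (at x) v) S" for v
  proof (rule Suc.IH)
    show "frechet_derivative f (at x) v = frechet_derivative g (at x) v" if "x \<in> S" for x
      using frechet_derivative_cong_open[OF \<open>open S\<close> that Suc.prems(1)] by (rule arg_cong)
    show "Ck_on k (\<lambda>x. frechet_derivative f (at x) v) S"
      using Suc.prems(2) by simp
  qed
  ultimately show ?case by simp
qed

lemma smooth_on_cong:
  "open S \<Longrightarrow> (\<And>x. x \<in> S \<Longrightarrow> f x = g x) \<Longrightarrow> smooth_on f S \<Longrightarrow> smooth_on g S"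
  unfolding smooth_on_def by (auto intro: Ck_on_cong)

lemma smooth_on_imp_continuous_on: "smooth_on f S \<Longrightarrow> continuous_on S f"
  unfolding smooth_on_def by (drule spec[of _ 0]) simp

lemma smooth_on_imp_differentiable: "smooth_on f S \<Longrightarrow> x \<in> S \<Longrightarrow> f differentiable (at x)"
  unfolding smooth_on_def by (drule spec[of _ "Suc 0"]) simp

lemma smooth_on_frechet_derivative:
  "smooth_on f S \<Longrightarrow> smooth_on (\<lambda>x. frechet_derivative f (at x) v) S"
  unfolding smooth_on_def
proof
  fix k
  assume "\<forall>k. Ck_on k f S"
  then have "Ck_on (Suc k) f S" by blast
  then show "Ck_on k (\<lambda>x. frechet_derivative f (at x) v) S" by simp
qed

lemma Ck_on_subset: "Ck_on k f S \<Longrightarrow> T \<subseteq> S \<Longrightarrow> Ck_on k f T"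
  by (induction k arbitrary: f) (auto intro: continuous_on_subset)

lemma smooth_on_subset: "smooth_on f S \<Longrightarrow> T \<subseteq> S \<Longrightarrow> smooth_on f T"
  unfolding smooth_on_def using Ck_on_subset by blast

lemma frechet_derivative_slice:
  fixes f :: "'e::real_normed_vector \<times> 'c::real_normed_vector \<Rightarrow> 'b::real_normed_vector"
  assumes "f differentiable (at (x, y))"
  shows "(\<lambda>x. f (x, y)) differentiable (at x)"
    and "frechet_derivative (\<lambda>x. f (x, y)) (at x) v = frechet_derivative f (at (x, y)) (v, 0)"
proof -
  have "(f has_derivative frechet_derivative f (at (x, y))) (at (x, y))"
    using assms by (simp add: frechet_derivative_works)
  moreover have "((\<lambda>x. (x, y)) has_derivative (\<lambda>v. (v, 0))) (at x)"
    by (auto intro!: derivative_eq_intros)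
  ultimately have *: "((\<lambda>x. f (x, y)) has_derivative (\<lambda>v. frechet_derivative f (at (x, y)) (v, 0))) (at x)"
    using has_derivative_compose[of "\<lambda>x. (x, y)" "\<lambda>v. (v, 0)" x UNIV f] by simp
  then show "(\<lambda>x. f (x, y)) differentiable (at x)"
    by (auto simp: differentiable_def)
  show "frechet_derivative (\<lambda>x. f (x, y)) (at x) v = frechet_derivative f (at (x, y)) (v, 0)"
    using frechet_derivative_at[OF *] by metis
qed

lemma Ck_on_slice:
  fixes f :: "'e::euclidean_space \<times> 'c::euclidean_space \<Rightarrow> 'b::real_normed_vector"
  assumes S: "open S" and y: "y \<in> T" and f: "Ck_on k f (S \<times> T)"
  shows "Ck_on k (\<lambda>x. f (x, y)) S"
  using f
proof (induction k arbitrary: f)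
  case 0
  then show ?case
    using y by (auto intro!: continuous_on_compose2[of "S \<times> T" f] continuous_intros)
next
  case (Suc k)
  then have d: "f differentiable (at (x, y))" if "x \<in> S" for x
    using that y by auto
  have "Ck_on k (\<lambda>x. frechet_derivative f (at (x, y)) (v, 0)) S" for v
    using Suc.prems Suc.IH[of "\<lambda>z. frechet_derivative f (at z) (v, 0)"] by simp
  then have "Ck_on k (\<lambda>x. frechet_derivative (\<lambda>x. f (x, y)) (at x) v) S" for v
    by (rule Ck_on_cong[OF S, rotated]) (simp add: frechet_derivative_slice(2) d)
  then show ?case
    using frechet_derivative_slice(1)[OF d] by simp
qed

lemma smooth_on_slice:
  fixes f :: "'e::euclidean_space \<times> 'c::euclidean_space \<Rightarrow> 'b::real_normed_vector"
  shows "open S \<Longrightarrow> y \<in> T \<Longrightarrow> smooth_on f (S \<times> T) \<Longrightarrow> smooth_on (\<lambda>x. f (x, y)) S"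
  unfolding smooth_on_def using Ck_on_slice by blast

lemma iter_deriv_cong:
  assumes "open S" "\<And>x. x \<in> S \<Longrightarrow> f x = g x" "x \<in> S"
  shows "iter_deriv vs f x = iter_deriv vs g x"
  using assms(3)
proof (induction vs arbitrary: x)
  case (Cons v vs)
  then show ?case
    using frechet_derivative_cong_open[OF \<open>open S\<close> Cons.prems Cons.IH] by simp
qed (use assms in simp)

lemma smooth_on_iter_deriv: "smooth_on f S \<Longrightarrow> smooth_on (iter_deriv vs f) S"
  by (induction vs) (auto intro: smooth_on_frechet_derivative)

text \<open>Differentiating in the first variable only is differentiating jointly in the directions
  \<open>(v, 0)\<close>. In this form the partial derivatives are visibly continuous in both
  variables.\<close>

lemma iter_deriv_slice:
  fixes f :: "'e::euclidean_space \<times> 'c::euclidean_space \<Rightarrow> real"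
  assumes S: "open S" and y: "y \<in> T" and f: "smooth_on f (S \<times> T)" and "x \<in> S"
  shows "iter_deriv vs (\<lambda>x. f (x, y)) x = iter_deriv (map (\<lambda>v. (v, 0)) vs) f (x, y)"
  using assms(4)
proof (induction vs arbitrary: x)
  case (Cons v vs)
  let ?f = "iter_deriv (map (\<lambda>v. (v, 0)) vs) f"
  have "iter_deriv (v # vs) (\<lambda>x. f (x, y)) x = frechet_derivative (\<lambda>x. ?f (x, y)) (at x) v"
    using frechet_derivative_cong_open[OF S Cons.prems Cons.IH] by simp
  also have "\<dots> = frechet_derivative ?f (at (x, y)) (v, 0)"
    using Cons.prems y smooth_on_iter_deriv[OF f]
    by (intro frechet_derivative_slice smooth_on_imp_differentiable[of _ "S \<times> T"]) auto
  finally show ?case by simp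
qed simp

lemma iter_deriv_const: "iter_deriv vs (\<lambda>_. c) x = (if vs = [] then c else 0)"
proof (induction vs arbitrary: x)
  case (Cons v vs)
  have *: "frechet_derivative (\<lambda>_::'a. d::real) (at x) v = 0" for d
    using frechet_derivative_at[of "\<lambda>_. d" "\<lambda>_. 0" x] by (metis has_derivative_const)
  have "iter_deriv vs (\<lambda>_. c) = (\<lambda>_. if vs = [] then c else 0)"
    using Cons.IH by blast
  then show ?case using * by simp
qed simp

lemma smooth_on_const: "smooth_on (\<lambda>_. c) S"
proof -
  have "Ck_on k (\<lambda>_. c) S" for k and c :: 'b
  proof (induction k arbitrary: c)
    case (Suc k)
    have "frechet_derivative (\<lambda>_::'a. c) (at x) v = 0" for x v
      using frechet_derivative_at[of "\<lambda>_. c" "\<lambda>_. 0" x] by (metis has_derivative_const)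
    then show ?case using Suc[of 0] by simp
  qed simp
  then show ?thesis by (simp add: smooth_on_def)
qed

section \<open>Second differences and second derivatives\<close>

lemma has_real_derivative_along_line:
  fixes f :: "'e::real_normed_vector \<Rightarrow> real"
  assumes "f differentiable (at (p + t *\<^sub>R v))"
  shows "((\<lambda>t. f (p + t *\<^sub>R v)) has_real_derivative frechet_derivative f (at (p + t *\<^sub>R v)) v) (at t)"
proof -
  have "(f has_derivative frechet_derivative f (at (p + t *\<^sub>R v))) (at (p + t *\<^sub>R v))"
    using assms by (simp add: frechet_derivative_works)
  moreover have "((\<lambda>t. p + t *\<^sub>R v) has_derivative (\<lambda>h. h *\<^sub>R v)) (at t)"
    by (auto intro!: derivative_eq_intros)
  ultimately have "((\<lambda>t. f (p + t *\<^sub>R v)) has_derivative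
      (\<lambda>h. frechet_derivative f (at (p + t *\<^sub>R v)) (h *\<^sub>R v))) (at t)"
    using has_derivative_compose[of "\<lambda>t. p + t *\<^sub>R v" "\<lambda>h. h *\<^sub>R v" t UNIV f] by simp
  moreover have "linear (frechet_derivative f (at (p + t *\<^sub>R v)))"
    using assms by (rule linear_frechet_derivative)
  ultimately show ?thesis
    unfolding has_field_derivative_def by (simp add: linear_cmul mult.commute[of _ "frechet_derivative _ _ _"])
qed

text \<open>One application of l'Hospital's rule leaves \<open>(f' t - f' (- t)) / (2 * t)\<close>.
  This is the mean of two difference quotients of \<open>f'\<close> at 0, so differentiability of
  \<open>f'\<close> at that one point suffices.\<close>

lemma second_difference_limit:
  fixes f :: "real \<Rightarrow> real"
  assumes r: "r > 0" and f: "\<And>t. \<bar>t\<bar> < r \<Longrightarrow> (f has_real_derivative f' t) (at t)"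
    and f': "(f' has_real_derivative q) (at 0)"
  shows "((\<lambda>t. (f t + f (- t) - 2 * f 0) / t\<^sup>2) \<longlongrightarrow> q) (at 0)"
proof (rule lhopital[where f' = "\<lambda>t. f' t - f' (- t)" and g' = "\<lambda>t. 2 * t"])
  have near: "\<forall>\<^sub>F t in at (0::real). \<bar>t\<bar> < r"
    using r by (auto simp: eventually_at dist_real_def)
  have c: "isCont f 0"
    using f[of 0] r by (intro DERIV_isCont) auto
  then have "(f \<longlongrightarrow> f 0) (at 0)" by (simp add: isCont_def)
  moreover have "((\<lambda>t. f (- t)) \<longlongrightarrow> f 0) (at 0)"
    using isCont_tendsto_compose[of 0 f uminus "at 0"] c tendsto_minus[OF tendsto_ident_at, of 0 UNIV]
    by simp
  ultimately show "((\<lambda>t. f t + f (- t) - 2 * f 0) \<longlongrightarrow> 0) (at 0)"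
    by (auto intro!: tendsto_eq_intros)
  show "((\<lambda>t::real. t\<^sup>2) \<longlongrightarrow> 0) (at 0)"
    by (auto intro!: tendsto_eq_intros)
  show "\<forall>\<^sub>F t in at (0::real). t\<^sup>2 \<noteq> 0" "\<forall>\<^sub>F t in at (0::real). 2 * t \<noteq> 0"
    by (auto simp: eventually_at_filter)
  show "\<forall>\<^sub>F t in at 0. ((\<lambda>t. f t + f (- t) - 2 * f 0) has_real_derivative f' t - f' (- t)) (at t)"
    using near
  proof eventually_elim
    case (elim t)
    have "((\<lambda>t. f (- t)) has_real_derivative f' (- t) * (- 1)) (at t)"
      by (rule DERIV_chain2[OF f]) (use elim in \<open>auto intro!: derivative_eq_intros\<close>)
    then show ?case
      using f[of t] elim by (auto intro!: derivative_eq_intros)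
  qed
  show "\<forall>\<^sub>F t in at 0. ((\<lambda>t::real. t\<^sup>2) has_real_derivative 2 * t) (at t)"
    by (intro always_eventually) (auto intro!: derivative_eq_intros)
  have l: "((\<lambda>t. (f' t - f' 0) / t) \<longlongrightarrow> q) (at 0)"
    using f' by (simp add: has_field_derivative_iff)
  moreover have "((\<lambda>t. (f' (- t) - f' 0) / (- t)) \<longlongrightarrow> q) (at 0)"
  proof (rule filterlim_compose[OF l, of uminus "at 0"])
    show "filterlim uminus (at (0::real)) (at 0)"
      by (auto simp: filterlim_at eventually_at_filter intro!: tendsto_eq_intros)
  qed
  ultimately have "((\<lambda>t. ((f' t - f' 0) / t + (f' (- t) - f' 0) / (- t)) / 2) \<longlongrightarrow> (q + q) / 2) (at 0)"
    by (intro tendsto_intros) auto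
  moreover have "(\<lambda>t. ((f' t - f' 0) / t + (f' (- t) - f' 0) / (- t)) / 2) = (\<lambda>t. (f' t - f' (- t)) / (2 * t))"
    by (simp add: fun_eq_iff diff_divide_distrib)
  moreover have "(q + q) / 2 = q" by simp
  ultimately show "((\<lambda>t. (f' t - f' (- t)) / (2 * t)) \<longlongrightarrow> q) (at 0)"
    by (simp only:)
qed

lemma second_directional_difference:
  fixes H :: "'e::euclidean_space \<Rightarrow> real"
  assumes "open S" "p \<in> S" "smooth_on H S"
  shows "((\<lambda>t. (H (p + t *\<^sub>R u) + H (p - t *\<^sub>R u) - 2 * H p) / t\<^sup>2) \<longlongrightarrow>
    frechet_derivative (\<lambda>z. frechet_derivative H (at z) u) (at p) u) (at 0)"
proof -
  obtain e where e: "e > 0" "ball p e \<subseteq> S"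
    using assms by (meson open_contains_ball)
  \<comment> \<open>The radius keeps \<open>p + t *\<^sub>R u\<close> inside the ball; the summand 1
    covers \<open>u = 0\<close>.\<close>
  define r where "r = e / (norm u + 1)"
  have "r > 0" using e by (simp add: r_def add_nonneg_pos)
  have S: "p + t *\<^sub>R u \<in> S" if "\<bar>t\<bar> < r" for t
  proof -
    have "\<bar>t\<bar> * norm u \<le> \<bar>t\<bar> * (norm u + 1)" by (intro mult_left_mono) auto
    also have "\<dots> < e" using that by (simp add: r_def pos_less_divide_eq add_nonneg_pos)
    finally show ?thesis using e by (auto simp: dist_norm subset_iff)
  qed
  have "((\<lambda>t. (H (p + t *\<^sub>R u) + H (p + (- t) *\<^sub>R u) - 2 * H (p + 0 *\<^sub>R u)) / t\<^sup>2) \<longlongrightarrow>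
    frechet_derivative (\<lambda>z. frechet_derivative H (at z) u) (at (p + 0 *\<^sub>R u)) u) (at 0)"
    using \<open>r > 0\<close>
  proof (rule second_difference_limit)
    show "((\<lambda>t. H (p + t *\<^sub>R u)) has_real_derivative frechet_derivative H (at (p + t *\<^sub>R u)) u) (at t)"
      if "\<bar>t\<bar> < r" for t
      using S[OF that] assms
      by (intro has_real_derivative_along_line smooth_on_imp_differentiable[of _ S])
    show "((\<lambda>t. frechet_derivative H (at (p + t *\<^sub>R u)) u) has_real_derivative
        frechet_derivative (\<lambda>z. frechet_derivative H (at z) u) (at (p + 0 *\<^sub>R u)) u) (at 0)"
      using assms by (intro has_real_derivative_along_line smooth_on_imp_differentiable[of _ S]
          smooth_on_frechet_derivative) auto
  qed
  then show ?thesis by simp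
qed

text \<open>\<open>Q u\<close> is the diagonal value \<open>b u u\<close> of a bilinear map.
  Linearity of \<open>b\<close> in the first slot comes from linearity of the first derivative at
  all points near \<open>p\<close>, linearity in the second from that of the derivative at
  \<open>p\<close>.\<close>

lemma second_derivative_parallelogram:
  fixes H :: "'e::euclidean_space \<Rightarrow> real"
  assumes "open S" "p \<in> S" "smooth_on H S"
  defines "Q \<equiv> \<lambda>u. frechet_derivative (\<lambda>z. frechet_derivative H (at z) u) (at p) u"
  shows "Q (u + v) + Q (u - v) = 2 * Q u + 2 * Q v"
proof -
  define b where "b u = frechet_derivative (\<lambda>z. frechet_derivative H (at z) u) (at p)" for u
  have d: "((\<lambda>z. frechet_derivative H (at z) u) has_derivative b u) (at p)" for u
    unfolding b_def frechet_derivative_works[symmetric]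
    by (rule smooth_on_imp_differentiable[OF smooth_on_frechet_derivative[OF assms(3)] assms(2)])
  have lin: "linear (frechet_derivative H (at z))" if "z \<in> S" for z
    by (rule linear_frechet_derivative[OF smooth_on_imp_differentiable[OF assms(3) that]])
  have "((\<lambda>z. frechet_derivative H (at z) (u + v)) has_derivative (\<lambda>h. b u h + b v h)) (at p)"
    by (rule has_derivative_transform_within_open[OF has_derivative_add[OF d d] assms(1,2)])
       (simp add: linear_add[OF lin])
  then have plus: "b (u + v) = (\<lambda>h. b u h + b v h)"
    using d has_derivative_unique by blast
  have "((\<lambda>z. frechet_derivative H (at z) (u - v)) has_derivative (\<lambda>h. b u h - b v h)) (at p)"
    by (rule has_derivative_transform_within_open[OF has_derivative_diff[OF d d] assms(1,2)])
       (simp add: linear_diff[OF lin])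
  then have minus: "b (u - v) = (\<lambda>h. b u h - b v h)"
    using d has_derivative_unique by blast
  have blin: "linear (b u)" for u
    using d has_derivative_linear by blast
  have "Q = (\<lambda>u. b u u)" by (simp add: Q_def b_def)
  then show ?thesis
    by (simp add: plus minus linear_add[OF blin] linear_diff[OF blin])
qed

text \<open>The numerator is the quadratic form of \<open>H\<close> with weights 1, -2, 1 at the
  points \<open>p + t *\<^sub>R w\<close>, \<open>p\<close>, \<open>p - t *\<^sub>R w\<close>. Its
  limit is \<open>Q (w, - w) - 4 * Q (w, 0)\<close>. The diagonal condition gives
  \<open>Q (w, w) = 0\<close>, symmetry gives \<open>Q (0, w) = Q (w, 0)\<close>, and the
  parallelogram law then makes the limit vanish.\<close>

lemma symmetric_kernel_fourth_difference:
  fixes H :: "'e::euclidean_space \<times> 'e \<Rightarrow> real"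
  assumes S: "open S" "p \<in> S" and H: "smooth_on H (S \<times> S)"
    and sym: "\<And>x y. x \<in> S \<Longrightarrow> y \<in> S \<Longrightarrow> H (x, y) = H (y, x)"
    and diag: "\<And>x. x \<in> S \<Longrightarrow> H (x, x) = 1"
  shows "((\<lambda>t. (6 - 4 * H (p + t *\<^sub>R w, p) - 4 * H (p - t *\<^sub>R w, p)
            + 2 * H (p + t *\<^sub>R w, p - t *\<^sub>R w)) / t\<^sup>2) \<longlongrightarrow> 0) (at 0)"
proof -
  define Q where "Q u = frechet_derivative (\<lambda>z. frechet_derivative H (at z) u) (at (p, p)) u" for u
  have op: "open (S \<times> S)" "(p, p) \<in> S \<times> S"
    using S by (auto intro: open_Times)
  have lim: "((\<lambda>t. (H (p + t *\<^sub>R a, p + t *\<^sub>R b) + H (p - t *\<^sub>R a, p - t *\<^sub>R b) - 2) / t\<^sup>2) \<longlongrightarrow> Q (a, b)) (at 0)"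
    for a b
    using second_directional_difference[OF op H, of "(a, b)"] diag[OF S(2)] by (simp add: Q_def)
  have "((\<lambda>t. p + t *\<^sub>R w) \<longlongrightarrow> p + 0 *\<^sub>R w) (at 0)" "((\<lambda>t. p - t *\<^sub>R w) \<longlongrightarrow> p - 0 *\<^sub>R w) (at 0)"
    by (intro tendsto_intros)+
  then have "((\<lambda>t. p + t *\<^sub>R w) \<longlongrightarrow> p) (at 0)" "((\<lambda>t. p - t *\<^sub>R w) \<longlongrightarrow> p) (at 0)"
    by simp_all
  then have near: "\<forall>\<^sub>F t in at 0. p + t *\<^sub>R w \<in> S" "\<forall>\<^sub>F t in at 0. p - t *\<^sub>R w \<in> S"
    using S topological_tendstoD by blast+
  have "((\<lambda>t. (H (p + t *\<^sub>R w, p + t *\<^sub>R w) + H (p - t *\<^sub>R w, p - t *\<^sub>R w) - 2) / t\<^sup>2) \<longlongrightarrow> 0) (at 0)"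
    by (rule tendsto_eventually, use near in eventually_elim) (simp add: diag)
  then have "Q (w, w) = 0"
    using lim[of w w] LIM_unique by blast
  moreover have "((\<lambda>t. (H (p + t *\<^sub>R 0, p + t *\<^sub>R w) + H (p - t *\<^sub>R 0, p - t *\<^sub>R w) - 2) / t\<^sup>2)
      \<longlongrightarrow> Q (w, 0)) (at 0)"
    by (rule Lim_transform_eventually[OF lim[of w 0]], use near in eventually_elim)
       (simp add: sym[OF S(2)])
  then have "Q (0, w) = Q (w, 0)"
    using lim[of 0 w] LIM_unique by blast
  moreover have "Q (w, w) + Q (w, - w) = 2 * Q (w, 0) + 2 * Q (0, w)"
    using second_derivative_parallelogram[OF op H, of "(w, 0)" "(0, w)"] by (simp add: Q_def)
  ultimately have "Q (w, - w) - 4 * Q (w, 0) = 0" by simp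
  moreover have "((\<lambda>t. (H (p + t *\<^sub>R w, p + t *\<^sub>R - w) + H (p - t *\<^sub>R w, p - t *\<^sub>R - w) - 2) / t\<^sup>2
      - 4 * ((H (p + t *\<^sub>R w, p + t *\<^sub>R 0) + H (p - t *\<^sub>R w, p - t *\<^sub>R 0) - 2) / t\<^sup>2))
      \<longlongrightarrow> Q (w, - w) - 4 * Q (w, 0)) (at 0)"
    by (rule tendsto_diff[OF lim tendsto_mult[OF tendsto_const lim]])
  ultimately have lim0: "((\<lambda>t. (H (p + t *\<^sub>R w, p + t *\<^sub>R - w) + H (p - t *\<^sub>R w, p - t *\<^sub>R - w) - 2) / t\<^sup>2
      - 4 * ((H (p + t *\<^sub>R w, p + t *\<^sub>R 0) + H (p - t *\<^sub>R w, p - t *\<^sub>R 0) - 2) / t\<^sup>2))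
      \<longlongrightarrow> 0) (at 0)"
    by (simp only:)
  show ?thesis
  proof (rule Lim_transform_eventually[OF lim0])
    show "\<forall>\<^sub>F t in at 0. (H (p + t *\<^sub>R w, p + t *\<^sub>R - w) + H (p - t *\<^sub>R w, p - t *\<^sub>R - w) - 2) / t\<^sup>2
      - 4 * ((H (p + t *\<^sub>R w, p + t *\<^sub>R 0) + H (p - t *\<^sub>R w, p - t *\<^sub>R 0) - 2) / t\<^sup>2)
      = (6 - 4 * H (p + t *\<^sub>R w, p) - 4 * H (p - t *\<^sub>R w, p)
            + 2 * H (p + t *\<^sub>R w, p - t *\<^sub>R w)) / t\<^sup>2"
      using near
    proof eventually_elim
      \<comment> \<open>By symmetry of \<open>H\<close> the two antidiagonal values coincide, which
        collects them into the term with coefficient 2.\<close>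
      case (elim t)
      have "H (p - t *\<^sub>R w, p + t *\<^sub>R w) = H (p + t *\<^sub>R w, p - t *\<^sub>R w)"
        by (rule sym[OF elim(2,1)])
      moreover have "(a + a - 2) / r - 4 * ((b + c - 2) / r) = (6 - 4 * b - 4 * c + 2 * a) / r"
        for a b c r :: real
        by (simp add: diff_divide_distrib add_divide_distrib)
      ultimately show ?case by (simp only: scaleR_minus_right scaleR_zero_right add_0_right diff_0_right
            add_uminus_conv_diff diff_minus_eq_add)
    qed
  qed
qed

section \<open>Minimizers on smooth manifolds\<close>

lemma is_chartD:
  assumes "is_chart (U, \<phi>)"
  shows "open U" "open (\<phi> ` U)" "continuous_on U \<phi>" "continuous_on (\<phi> ` U) (inv_into U \<phi>)"
    "inj_on \<phi> U"
  using assms by (auto simp: is_chart_def homeomorphism_def intro: inj_on_inverseI)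

lemma open_inv_into_chart:
  assumes "is_chart (U, \<phi>)" "open W"
  shows "open {p \<in> \<phi> ` U. inv_into U \<phi> p \<in> W}"
  using continuous_open_preimage[OF is_chartD(4)[OF assms(1)] is_chartD(2)[OF assms(1)] assms(2)]
  by (simp add: vimage_def Int_def)

lemma smooth_atlasD:
  assumes "smooth_atlas A"
  shows "c \<in> A \<Longrightarrow> is_chart c" and "\<exists>U \<phi>. (U, \<phi>) \<in> A \<and> x \<in> U"
proof -
  show "c \<in> A \<Longrightarrow> is_chart c" using assms by (simp add: smooth_atlas_def)
  have "x \<in> (\<Union>c\<in>A. fst c)" using assms by (simp add: smooth_atlas_def)
  then show "\<exists>U \<phi>. (U, \<phi>) \<in> A \<and> x \<in> U" by force
qed

lemma inv_into_map_prod: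
  assumes "inj_on f S" "inj_on g T" "p \<in> f ` S" "q \<in> g ` T"
  shows "inv_into (S \<times> T) (map_prod f g) (p, q) = (inv_into S f p, inv_into T g q)"
  using assms
  by (intro inv_into_f_eq map_prod_inj_on) (auto simp: inv_into_into f_inv_into_f)

locale smooth_kernel =
  fixes A :: "('a::t2_space, 'e::euclidean_space) chart set" and D :: "'a \<Rightarrow> 'a \<Rightarrow> real"
  assumes atlas: "smooth_atlas A"
    and compact_UNIV: "compact (UNIV :: 'a set)"
    and smooth: "smooth_function (prod_atlas A A) (\<lambda>(x, y). D x y)"
begin

lemmas is_chart = smooth_atlasD(1)[OF atlas]
lemmas chartD = is_chartD[OF is_chart]

lemma smooth_on_charts:
  assumes U: "(U, \<phi>) \<in> A" and V: "(V, \<psi>) \<in> A"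
  shows "smooth_on (\<lambda>z. D (inv_into U \<phi> (fst z)) (inv_into V \<psi> (snd z))) (\<phi> ` U \<times> \<psi> ` V)"
proof (rule smooth_on_cong)
  show "open (\<phi> ` U \<times> \<psi> ` V)"
    using chartD[OF U] chartD[OF V] by (intro open_Times)
  have "(U \<times> V, map_prod \<phi> \<psi>) \<in> prod_atlas A A"
    using U V by (auto simp: prod_atlas_def)
  then show "smooth_on ((\<lambda>(x, y). D x y) \<circ> inv_into (U \<times> V) (map_prod \<phi> \<psi>)) (\<phi> ` U \<times> \<psi> ` V)"
    using smooth unfolding smooth_function_def by (fastforce simp: map_prod_surj_on)
qed (auto simp: inv_into_map_prod[OF chartD(5)[OF U] chartD(5)[OF V]])

lemma smooth_slice:
  assumes U: "(U, \<phi>) \<in> A"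
  shows "smooth_on (\<lambda>p. D (inv_into U \<phi> p) y) (\<phi> ` U)"
proof -
  obtain V \<psi> where V: "(V, \<psi>) \<in> A" "y \<in> V"
    using smooth_atlasD(2)[OF atlas] by metis
  then have "inv_into V \<psi> (\<psi> y) = y"
    using chartD(5)[OF V(1)] by simp
  then show ?thesis
    using smooth_on_slice[OF chartD(2)[OF U] imageI[OF V(2)] smooth_on_charts[OF U V(1)]] by simp
qed

lemma smooth_function_slice: "smooth_function A (\<lambda>x. D x y)"
  using smooth_slice by (auto simp: smooth_function_def comp_def)

text \<open>Near each second point a chart turns the kernel into a smooth function of two Euclidean
  variables, where the slice derivatives are joint derivatives. With compactness of the manifold
  this yields bounds that are uniform in the second point.\<close>

lemma continuous_iter_deriv:
  assumes U: "(U, \<phi>) \<in> A"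
  shows "continuous_on (\<phi> ` U \<times> UNIV) (\<lambda>z. iter_deriv vs (\<lambda>p. D (inv_into U \<phi> p) (snd z)) (fst z))"
proof -
  have *: "continuous_on (\<phi> ` U \<times> V) (\<lambda>z. iter_deriv vs (\<lambda>p. D (inv_into U \<phi> p) (snd z)) (fst z))"
    if V: "(V, \<psi>) \<in> A" for V \<psi>
  proof -
    let ?F = "iter_deriv (map (\<lambda>v. (v, 0)) vs)
        (\<lambda>z. D (inv_into U \<phi> (fst z)) (inv_into V \<psi> (snd z)))"
    have "continuous_on (\<phi> ` U \<times> \<psi> ` V) ?F"
      by (intro smooth_on_imp_continuous_on smooth_on_iter_deriv smooth_on_charts U V)
    then have "continuous_on (\<phi> ` U \<times> V) (\<lambda>z. ?F (fst z, \<psi> (snd z)))"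
      by (rule continuous_on_compose2)
         (auto intro!: continuous_intros continuous_on_compose2[OF chartD(3)[OF V]])
    then show ?thesis
    proof (rule continuous_on_eq)
      fix z assume z: "z \<in> \<phi> ` U \<times> V"
      then have "inv_into V \<psi> (\<psi> (snd z)) = snd z"
        using chartD(5)[OF V] by auto
      moreover have "\<psi> (snd z) \<in> \<psi> ` V" "fst z \<in> \<phi> ` U" using z by auto
      ultimately show "?F (fst z, \<psi> (snd z)) = iter_deriv vs (\<lambda>p. D (inv_into U \<phi> p) (snd z)) (fst z)"
        using iter_deriv_slice[OF chartD(2)[OF U] _ smooth_on_charts[OF U V], of "\<psi> (snd z)" "fst z" vs]
        by simp
    qed
  qed
  have "isCont (\<lambda>z. iter_deriv vs (\<lambda>p. D (inv_into U \<phi> p) (snd z)) (fst z)) z"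
    if z: "z \<in> \<phi> ` U \<times> UNIV" for z
  proof -
    obtain V \<psi> where V: "(V, \<psi>) \<in> A" "snd z \<in> V"
      using smooth_atlasD(2)[OF atlas] by metis
    then have "z \<in> \<phi> ` U \<times> V" using z by auto
    moreover have "open (\<phi> ` U \<times> V)"
      using chartD(2)[OF U] chartD(1)[OF V(1)] by (rule open_Times)
    ultimately show ?thesis
      using *[OF V(1)] continuous_on_eq_continuous_at by blast
  qed
  then show ?thesis by (auto intro: continuous_at_imp_continuous_on)
qed

text \<open>This is the empty list of directions in \<open>continuous_iter_deriv\<close>,
  transported back through the chart.\<close>

lemma continuous_kernel: "continuous_on UNIV (\<lambda>z. D (fst z) (snd z))"
proof (rule continuous_at_imp_continuous_on, rule ballI)
  fix z :: "'a \<times> 'a"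
  obtain U \<phi> where U: "(U, \<phi>) \<in> A" "fst z \<in> U"
    using smooth_atlasD(2)[OF atlas] by metis
  have "continuous_on (U \<times> UNIV) (\<lambda>z. iter_deriv [] (\<lambda>p. D (inv_into U \<phi> p)
      (snd (\<phi> (fst z), snd z))) (fst (\<phi> (fst z), snd z)))"
    by (rule continuous_on_compose2[OF continuous_iter_deriv[OF U(1)]])
       (auto intro!: continuous_intros continuous_on_compose2[OF chartD(3)[OF U(1)]])
  then have "continuous_on (U \<times> UNIV) (\<lambda>z. D (fst z) (snd z))"
    by (rule continuous_on_eq) (use chartD(5)[OF U(1)] in auto)
  moreover have "open (U \<times> (UNIV :: 'a set))" "z \<in> U \<times> UNIV"
    using U chartD(1)[OF U(1)] by (auto intro: open_Times simp: mem_Times_iff)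
  ultimately show "isCont (\<lambda>z. D (fst z) (snd z)) z"
    using continuous_on_eq_continuous_at by blast
qed

text \<open>By the chain rule only the velocity \<open>g 1\<close> of the curve in the chart
  matters. The curve can therefore be replaced by a straight line, which can be reflected at its
  starting point to form symmetric second differences.\<close>

lemma derivative_along_curve:
  assumes c: "smooth_curve A c" and U: "(U, \<phi>) \<in> A" "c 0 \<in> U"
    and m: "((\<lambda>t. D (c t) y) has_real_derivative m) (at 0)"
  obtains w where "((\<lambda>t. D (inv_into U \<phi> (\<phi> (c 0) + t *\<^sub>R w)) y) has_real_derivative m) (at 0)"
proof -
  let ?f = "\<lambda>p. D (inv_into U \<phi> p) y"
  obtain T where T: "open T" "{0..1} \<subseteq> T" "continuous_on T c"
      and sm: "smooth_on (\<phi> \<circ> c) (T \<inter> c -` U)"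
    using c U(1) unfolding smooth_curve_def by fast
  have op: "open (T \<inter> c -` U)"
    using continuous_open_preimage[OF T(3,1) chartD(1)[OF U(1)]] by simp
  have 0: "0 \<in> T \<inter> c -` U" using T U by auto
  obtain g where g: "((\<phi> \<circ> c) has_derivative g) (at 0)"
    using smooth_on_imp_differentiable[OF sm 0] by (auto simp: differentiable_def)
  have diff: "?f differentiable (at (\<phi> (c 0)))"
    using smooth_slice[OF U(1)] U by (intro smooth_on_imp_differentiable) auto
  then obtain f' where f': "(?f has_derivative f') (at (\<phi> (c 0)))"
    by (auto simp: differentiable_def)
  have "((\<lambda>t. ?f ((\<phi> \<circ> c) t)) has_derivative (\<lambda>h. f' (g h))) (at 0)"
    using has_derivative_compose[OF g, of ?f f'] f' by simp
  then have "((\<lambda>t. D (c t) y) has_derivative (\<lambda>h. f' (g h))) (at 0)"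
    by (rule has_derivative_transform_within_open[OF _ op 0]) (use chartD(5)[OF U(1)] in simp)
  with m have "(\<lambda>h. f' (g h)) = (*) m"
    unfolding has_field_derivative_def by (rule has_derivative_unique[symmetric])
  then have "f' (g 1) = m" by (metis mult.right_neutral)
  moreover have "f' = frechet_derivative ?f (at (\<phi> (c 0)))"
    using frechet_derivative_at[OF f'] .
  ultimately have "((\<lambda>t. ?f (\<phi> (c 0) + t *\<^sub>R g 1)) has_real_derivative m) (at 0)"
    using has_real_derivative_along_line[of ?f "\<phi> (c 0)" 0 "g 1"] diff by simp
  then show ?thesis by (rule that)
qed

end

section \<open>Absence of kinks and of sign changes on the support\<close>

locale causal = smooth_kernel A D + minimizer D \<rho>
  for A :: "('a::{t2_space, second_countable_topology}, 'e::euclidean_space) chart set"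
    and D :: "'a \<Rightarrow> 'a \<Rightarrow> real" and \<rho> +
  assumes curves: "y \<in> K_set D x \<Longrightarrow>
           \<exists>c m. smooth_curve A c \<and> c 0 = x \<and> c 1 = y \<and>
             ((\<lambda>t. D (c t) y) has_real_derivative m) (at 0) \<and> m \<noteq> 0"
begin

lemma gram_second_difference:
  assumes "a \<in> measure_support \<rho>" "b \<in> measure_support \<rho>" "x \<in> measure_support \<rho>" "y \<in> measure_support \<rho>"
  defines "s \<equiv> L a y - 2 * L x y + L b y"
  shows "s\<^sup>2 \<le> 6 - 4 * L a x - 4 * L b x + 2 * L a b"
proof -
  define q where "q = (\<lambda>i::nat. [a, x, b, y] ! i)"
  \<comment> \<open>Since \<open>L y y = 1\<close>, the form with last weight \<open>u\<close>
    equals the form of the first three points plus \<open>2 * u * s + u\<^sup>2\<close>. The choice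
    \<open>u = - s\<close> minimizes it.\<close>
  define c where "c = (\<lambda>i::nat. [1, - 2, 1, - s] ! i)"
  have I: "{..<4::nat} = {0, 1, 2, 3}" by auto
  have "0 \<le> (\<Sum>i<4. \<Sum>j<4. c i * c j * L (q i) (q j))"
    by (rule gram_nonneg) (use assms in \<open>auto simp: I q_def\<close>)
  also have "\<dots> = 6 - 4 * L a x - 4 * L b x + 2 * L a b - s\<^sup>2"
    using symL[of x a] symL[of b x] symL[of b a] symL[of y a] symL[of y b] symL[of y x] diagL
    by (simp add: I q_def c_def s_def power2_eq_square algebra_simps)
  finally show ?thesis by simp
qed

text \<open>Along the line through \<open>x\<close>, the values of \<open>D\<close> at
  \<open>a\<close> and \<open>b\<close> against \<open>y\<close> are close to \<open>m * t\<close>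
  and \<open>- m * t\<close>. One of them is positive, so \<open>L a y + L b y\<close> is at least
  of order \<open>t\<close>, whereas the square of this sum is bounded by an expression of smaller
  order than the square of \<open>t\<close>.\<close>

lemma no_kink:
  assumes x: "x \<in> interior (measure_support \<rho>)" and y: "y \<in> measure_support \<rho>" and Dxy: "D x y = 0"
    and c: "smooth_curve A c" "c 0 = x" "((\<lambda>t. D (c t) y) has_real_derivative m) (at 0)"
  shows "m = 0"
proof (rule ccontr)
  assume "m \<noteq> 0"
  obtain U \<phi> where U: "(U, \<phi>) \<in> A" "x \<in> U"
    using smooth_atlasD(2)[OF atlas] by metis
  let ?i = "inv_into U \<phi>"
  define p where "p = \<phi> x"
  have ip: "?i p = x" using U chartD(5)[OF U(1)] by (simp add: p_def)
  obtain w where w: "((\<lambda>t. D (?i (p + t *\<^sub>R w)) y) has_real_derivative m) (at 0)"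
    using derivative_along_curve[OF c(1) U(1) _ c(3)] c(2) U(2) unfolding p_def by metis
  \<comment> \<open>On a neighbourhood of \<open>(x, x)\<close> the kernel is positive, so
    \<open>L\<close> coincides with the smooth \<open>D\<close> there.\<close>
  have "open ((\<lambda>z. D (fst z) (snd z)) -` {0<..})"
    by (intro open_vimage contD) simp
  moreover have "(x, x) \<in> (\<lambda>z. D (fst z) (snd z)) -` {0<..}"
    by (simp add: diagD)
  ultimately obtain V V' where V: "open V" "open V'" "(x, x) \<in> V \<times> V'"
      "V \<times> V' \<subseteq> (\<lambda>z. D (fst z) (snd z)) -` {0<..}"
    by (rule open_prod_elim)
  define W where "W = interior (measure_support \<rho>) \<inter> V \<inter> V'"
  define S where "S = {p \<in> \<phi> ` U. ?i p \<in> W}"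
  have "open S"
    unfolding S_def using V by (intro open_inv_into_chart is_chart[OF U(1)]) (auto simp: W_def)
  have "p \<in> S" using U V x ip by (auto simp: S_def W_def p_def)
  have pos: "D (?i q) (?i q') > 0" if "q \<in> S" "q' \<in> S" for q q'
    using that V(4) by (auto simp: S_def W_def)
  have supp: "?i q \<in> measure_support \<rho>" if "q \<in> S" for q
    using that interior_subset by (auto simp: S_def W_def)
  define N where "N t = 6 - 4 * D (?i (p + t *\<^sub>R w)) x - 4 * D (?i (p - t *\<^sub>R w)) x
      + 2 * D (?i (p + t *\<^sub>R w)) (?i (p - t *\<^sub>R w))" for t
  have "smooth_on (\<lambda>z. D (?i (fst z)) (?i (snd z))) (S \<times> S)"
    by (rule smooth_on_subset[OF smooth_on_charts[OF U(1) U(1)]]) (auto simp: S_def)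
  from symmetric_kernel_fourth_difference[OF \<open>open S\<close> \<open>p \<in> S\<close> this, of w]
  have N: "((\<lambda>t. N t / t\<^sup>2) \<longlongrightarrow> 0) (at 0)"
    using symD diagD by (simp add: N_def ip)
  have lim: "((\<lambda>t. D (?i (p + t *\<^sub>R w)) y / t) \<longlongrightarrow> m) (at 0)"
    using w by (simp add: has_field_derivative_iff ip Dxy)
  have uminus: "filterlim uminus (at (0::real)) (at 0)"
    by (auto simp: filterlim_at eventually_at_filter intro!: tendsto_eq_intros)
  have lim': "((\<lambda>t. D (?i (p - t *\<^sub>R w)) y / - t) \<longlongrightarrow> m) (at 0)"
    using filterlim_compose[OF lim uminus] by simp
  have "((\<lambda>t. p + t *\<^sub>R w) \<longlongrightarrow> p + 0 *\<^sub>R w) (at 0)" "((\<lambda>t. p - t *\<^sub>R w) \<longlongrightarrow> p - 0 *\<^sub>R w) (at 0)"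
    by (intro tendsto_intros)+
  then have near: "\<forall>\<^sub>F t in at 0. p + t *\<^sub>R w \<in> S" "\<forall>\<^sub>F t in at 0. p - t *\<^sub>R w \<in> S"
    using \<open>open S\<close> \<open>p \<in> S\<close> by (simp_all add: topological_tendstoD)
  \<comment> \<open>The tolerance \<open>\<bar>m\<bar> / 2\<close> for the difference quotients
    leaves a lower bound of \<open>\<bar>m * t\<bar> / 2\<close>; its square is the value that
    \<open>N t\<close> must stay below.\<close>
  have "m\<^sup>2 / 4 > 0" "\<bar>m\<bar> / 2 > 0" using \<open>m \<noteq> 0\<close> by simp_all
  have "\<forall>\<^sub>F t in at (0::real). False"
    using near tendstoD[OF N \<open>m\<^sup>2 / 4 > 0\<close>] tendstoD[OF lim \<open>\<bar>m\<bar> / 2 > 0\<close>]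
      tendstoD[OF lim' \<open>\<bar>m\<bar> / 2 > 0\<close>] eventually_neq_at_within[of 0 0 UNIV]
  proof eventually_elim
    case (elim t)
    define a where "a = ?i (p + t *\<^sub>R w)"
    define b where "b = ?i (p - t *\<^sub>R w)"
    have S: "a \<in> measure_support \<rho>" "b \<in> measure_support \<rho>" "x \<in> measure_support \<rho>"
      using supp elim \<open>p \<in> S\<close> x interior_subset by (auto simp: a_def b_def)
    have "D a x > 0" "D b x > 0" "D a b > 0"
      using pos[OF elim(1) \<open>p \<in> S\<close>] pos[OF elim(2) \<open>p \<in> S\<close>] pos[OF elim(1,2)] ip
      by (simp_all add: a_def b_def)
    then have "L a x = D a x" "L b x = D b x" "L a b = D a b"
      by (simp_all add: lagrangian_def)
    moreover have "L x y = 0" by (simp add: lagrangian_def Dxy)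
    ultimately have le: "(L a y + L b y)\<^sup>2 \<le> N t"
      using gram_second_difference[OF S y] by (simp add: N_def a_def b_def)
    have "\<bar>D a y / t - m\<bar> < \<bar>m\<bar> / 2" "\<bar>D b y / - t - m\<bar> < \<bar>m\<bar> / 2"
      using elim by (simp_all add: a_def b_def dist_real_def)
    moreover have "\<bar>u - m * s\<bar> < \<bar>m * s\<bar> / 2" if "\<bar>u / s - m\<bar> < \<bar>m\<bar> / 2" "s \<noteq> 0" for u s
    proof -
      have "\<bar>u - m * s\<bar> = \<bar>u / s - m\<bar> * \<bar>s\<bar>"
        using that by (simp add: abs_mult[symmetric] left_diff_distrib)
      also have "\<dots> < \<bar>m\<bar> / 2 * \<bar>s\<bar>"
        using that by (intro mult_strict_right_mono) auto
      finally show ?thesis by (simp add: abs_mult)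
    qed
    ultimately have "\<bar>D a y - m * t\<bar> < \<bar>m * t\<bar> / 2" "\<bar>D b y - m * - t\<bar> < \<bar>m * - t\<bar> / 2"
      using \<open>t \<noteq> 0\<close> by fastforce+
    then have "\<bar>D a y - m * t\<bar> < \<bar>m * t\<bar> / 2" "\<bar>D b y + m * t\<bar> < \<bar>m * t\<bar> / 2"
      by simp_all
    then have "\<bar>m * t\<bar> / 2 \<le> D a y \<or> \<bar>m * t\<bar> / 2 \<le> D b y"
      by linarith
    then have "\<bar>m * t\<bar> / 2 \<le> L a y + L b y"
      using L_ge[of a y] L_ge[of b y] L_nonneg[of a y] L_nonneg[of b y] by linarith
    then have "(\<bar>m * t\<bar> / 2)\<^sup>2 \<le> N t"
      using le by (meson abs_ge_zero divide_nonneg_nonneg order_trans power_mono zero_le_numeral)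
    then have "m\<^sup>2 / 4 \<le> N t / t\<^sup>2"
      using \<open>t \<noteq> 0\<close> by (simp add: power_divide power_mult_distrib field_simps)
    moreover have "\<bar>N t / t\<^sup>2\<bar> < m\<^sup>2 / 4"
      using elim(3) by (simp only: dist_real_def diff_0_right)
    ultimately show ?case by linarith
  qed
  then show False by simp
qed

text \<open>Both sets in the definition of \<open>K_set\<close> have an open set as their base by
  continuity, and an open set is disjoint from its frontier. So \<open>D x y\<close> is neither
  positive nor negative.\<close>

lemma K_set_imp:
  assumes "y \<in> K_set D x"
  shows "D x y = 0"
proof -
  have cont: "continuous_on UNIV (D x)"
    by (rule continuous_kernel_slice[OF contD])
  have "open (I_set D x)"
    unfolding I_set_def using open_vimage[OF _ cont, of "{0<..}"] by (simp add: vimage_def)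
  moreover have "open (UNIV - J_set D x)"
    unfolding J_set_def using open_vimage[OF _ cont, of "{..<0}"] 
    by (simp add: vimage_def Compl_eq_Diff_UNIV[symmetric] Collect_neg_eq[symmetric] not_le)
  ultimately have "y \<notin> I_set D x" "y \<notin> UNIV - J_set D x"
    using assms by (auto simp: K_set_def frontier_def interior_open)
  then show ?thesis by (simp add: I_set_def J_set_def)
qed

lemma in_K_setI:
  assumes "\<And>V. open V \<Longrightarrow> y \<in> V \<Longrightarrow> \<exists>v\<in>V. D x v > 0" "\<And>V. open V \<Longrightarrow> y \<in> V \<Longrightarrow> \<exists>v\<in>V. D x v < 0"
    and "D x y = 0"
  shows "y \<in> K_set D x"
proof -
  have "y \<in> closure (I_set D x)" "y \<in> closure (UNIV - J_set D x)"
    using assms(1,2) by (force simp: closure_iff_nhds_not_empty I_set_def J_set_def not_le)+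
  moreover have "y \<notin> interior (I_set D x)" "y \<notin> interior (UNIV - J_set D x)"
    using assms(3) interior_subset[of "I_set D x"] interior_subset[of "UNIV - J_set D x"]
    by (auto simp: I_set_def J_set_def)
  ultimately show ?thesis by (simp add: K_set_def frontier_def)
qed

lemma not_in_K_set:
  assumes x: "x \<in> interior (measure_support \<rho>)" and y: "y \<in> measure_support \<rho>"
  shows "y \<notin> K_set D x"
  using curves[of y x] no_kink[OF x y] K_set_imp[of y x] by metis

text \<open>The curve for \<open>x\<close> in \<open>K_set D y\<close> starts at \<open>y\<close>,
  and \<open>D\<close> against \<open>x\<close> passes through 0 along it with nonzero speed. So
  both signs of \<open>D x\<close> occur at points of the curve arbitrarily close to
  \<open>y\<close>.\<close>

lemma K_set_commute:
  assumes "x \<in> K_set D y"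
  shows "y \<in> K_set D x"
proof -
  have Dxy: "D x y = 0" using K_set_imp[OF assms] symD by metis
  obtain c m where c: "smooth_curve A c" "c 0 = y" "((\<lambda>t. D (c t) x) has_real_derivative m) (at 0)" "m \<noteq> 0"
    using curves[OF assms] by blast
  \<comment> \<open>The set \<open>T\<close> is an open neighbourhood of 0, so the curve may also be
    followed for negative \<open>t\<close>. This supplies the second sign.\<close>
  obtain T where T: "open T" "{0..1} \<subseteq> T" "continuous_on T c"
    using c(1) by (auto simp: smooth_curve_def)
  moreover have "0 \<in> T" using T(2) by auto
  ultimately have "isCont c 0"
    using continuous_on_eq_continuous_at by blast
  then have cl: "(c \<longlongrightarrow> y) (at 0)" using c(2) by (simp add: isCont_def)
  have "((\<lambda>t. D (c t) x / t) \<longlongrightarrow> m) (at 0)"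
    using c(2,3) Dxy symD[of y x] by (simp add: has_field_derivative_iff)
  then have "\<forall>\<^sub>F t in at 0. dist (D (c t) x / t) m < \<bar>m\<bar>"
    using c(4) by (intro tendstoD) auto
  then have ev: "\<forall>\<^sub>F t in at 0. D (c t) x * (m * t) > 0"
    using eventually_neq_at_within[of 0 0 UNIV]
  proof eventually_elim
    case (elim t)
    then have d: "\<bar>D (c t) x / t - m\<bar> < \<bar>m\<bar>" by (simp add: dist_real_def)
    have "D (c t) x / t * m > 0"
    proof (cases "m > 0")
      case True
      with d have "D (c t) x / t > 0" by linarith
      then show ?thesis using True by (rule mult_pos_pos)
    next
      case False
      with d have "D (c t) x / t < 0" "m < 0" by linarith+
      then show ?thesis by (rule mult_neg_neg)
    qed
    then have "(D (c t) x / t * m) * t\<^sup>2 > 0"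
      by (rule mult_pos_pos) (use elim in auto)
    then show ?case using elim by (simp add: power2_eq_square mult_ac)
  qed
  have both: "\<exists>v\<in>V. \<sigma> * D x v > 0" if V: "open V" "y \<in> V" and "\<sigma> \<noteq> 0" for V and \<sigma> :: real
  proof -
    have "\<forall>\<^sub>F t in at 0. D (c t) x * (m * t) > 0 \<and> c t \<in> V"
      using ev topological_tendstoD[OF cl V] by eventually_elim simp
    then obtain d where d: "d > 0"
        "\<And>t. t \<noteq> 0 \<Longrightarrow> \<bar>t\<bar> < d \<Longrightarrow> D (c t) x * (m * t) > 0 \<and> c t \<in> V"
      by (auto simp: eventually_at dist_real_def)
    \<comment> \<open>The sign of \<open>t\<close> is chosen to make \<open>m * t * \<sigma>\<close>
      positive, and its size is half the admissible radius.\<close>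
    define t where "t = sgn (m * \<sigma>) * d / 2"
    have "t \<noteq> 0" "\<bar>t\<bar> < d"
      using d(1) c(4) that by (auto simp: t_def abs_mult sgn_0_0)
    note d(2)[OF this]
    moreover have "m * t * \<sigma> > 0"
      using d(1) c(4) that by (auto simp: t_def sgn_mult sgn_if zero_less_mult_iff mult_less_0_iff)
    ultimately have "0 < (D (c t) x * (m * t)) * (m * t * \<sigma>)"
      by (simp only: mult_pos_pos)
    also have "\<dots> = (\<sigma> * D x (c t)) * (m * t)\<^sup>2"
      by (simp add: symD[of x] power2_eq_square)
    finally have "\<sigma> * D x (c t) > 0"
      using zero_less_mult_pos2[of "\<sigma> * D x (c t)" "(m * t)\<^sup>2"] c(4) \<open>t \<noteq> 0\<close> by simp
    then show ?thesis using d(2)[OF \<open>t \<noteq> 0\<close> \<open>\<bar>t\<bar> < d\<close>] by blast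
  qed
  show ?thesis
    using both[of _ 1] both[of _ "-1"] by (intro in_K_setI Dxy) auto
qed

text \<open>If \<open>D x y\<close> is nonzero, continuity suffices. If it is zero, \<open>x\<close>
  lies outside \<open>K_set D y\<close>, so one of the two signs is missing in some neighbourhood.
  This neighbourhood depends on \<open>y\<close>.\<close>

lemma locally_no_sign_change:
  assumes x: "x \<in> interior (measure_support \<rho>)" and y: "y \<in> measure_support \<rho>"
  obtains V where "open V" "x \<in> V" "(\<forall>v\<in>V. D v y \<ge> 0) \<or> (\<forall>v\<in>V. D v y \<le> 0)"
proof -
  have "x \<notin> K_set D y"
    using not_in_K_set[OF x y] K_set_commute by blast
  have cont: "continuous_on UNIV (\<lambda>v. D v y)"
    by (rule continuous_kernel_slice[OF contD])
  consider "D x y > 0" | "D x y < 0" | "D x y = 0" by linarith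
  then show ?thesis
  proof cases
    case 1
    show ?thesis
      by (rule that[of "(\<lambda>v. D v y) -` {0<..}"]) (use 1 cont in \<open>auto intro!: open_vimage\<close>)
  next
    case 2
    show ?thesis
      by (rule that[of "(\<lambda>v. D v y) -` {..<0}"]) (use 2 cont in \<open>auto intro!: open_vimage\<close>)
  next
    case 3
    then obtain V where "open V" "x \<in> V" "(\<forall>v\<in>V. \<not> D y v > 0) \<or> (\<forall>v\<in>V. \<not> D y v < 0)"
      using in_K_setI[of x y] \<open>x \<notin> K_set D y\<close> symD by metis
    then show ?thesis
      by (intro that[of V]) (auto simp: not_less symD[of y])
  qed
qed

section \<open>Differentiation under the integral and the differential operator criterion\<close>

definition chart_interior :: "'a set \<Rightarrow> ('a \<Rightarrow> 'e) \<Rightarrow> 'e set" where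
  "chart_interior U \<phi> = {p \<in> \<phi> ` U. inv_into U \<phi> p \<in> interior (measure_support \<rho>)}"

lemma open_chart_interior: "(U, \<phi>) \<in> A \<Longrightarrow> open (chart_interior U \<phi>)"
  unfolding chart_interior_def by (intro open_inv_into_chart is_chart) auto

lemma lagrangian_local_dichotomy:
  assumes U: "(U, \<phi>) \<in> A" and p: "p \<in> chart_interior U \<phi>" and y: "y \<in> measure_support \<rho>"
  obtains V where "open V" "p \<in> V" "V \<subseteq> \<phi> ` U"
    "(\<forall>q\<in>V. L (inv_into U \<phi> q) y = D (inv_into U \<phi> q) y) \<or> (\<forall>q\<in>V. L (inv_into U \<phi> q) y = 0)"
proof -
  have "inv_into U \<phi> p \<in> interior (measure_support \<rho>)"
    using p by (simp add: chart_interior_def)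
  then obtain W where W: "open W" "inv_into U \<phi> p \<in> W" "(\<forall>v\<in>W. D v y \<ge> 0) \<or> (\<forall>v\<in>W. D v y \<le> 0)"
    using locally_no_sign_change[OF _ y] by metis
  show ?thesis
  proof (rule that)
    show "open {q \<in> \<phi> ` U. inv_into U \<phi> q \<in> W}"
      by (intro open_inv_into_chart is_chart U W)
    show "p \<in> {q \<in> \<phi> ` U. inv_into U \<phi> q \<in> W}"
      using p W by (simp add: chart_interior_def)
    show "(\<forall>q\<in>{q \<in> \<phi> ` U. inv_into U \<phi> q \<in> W}. L (inv_into U \<phi> q) y = D (inv_into U \<phi> q) y) \<or>
        (\<forall>q\<in>{q \<in> \<phi> ` U. inv_into U \<phi> q \<in> W}. L (inv_into U \<phi> q) y = 0)"
      using W(3)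
    proof
      assume "\<forall>v\<in>W. D v y \<ge> 0"
      then show ?thesis by (intro disjI1) (auto simp: lagrangian_def)
    next
      assume "\<forall>v\<in>W. D v y \<le> 0"
      then show ?thesis by (intro disjI2) (auto simp: lagrangian_def)
    qed
  qed auto
qed

text \<open>Near \<open>p\<close> the function agrees with a slice of \<open>D\<close> or with 0.
  The neighbourhood varies with \<open>y\<close>, but the comparison with the derivatives of
  \<open>D\<close> at \<open>p\<close> itself does not involve it, and hence can serve as a bound
  uniform in \<open>y\<close>.\<close>

lemma lagrangian_iter_deriv:
  assumes U: "(U, \<phi>) \<in> A" and p: "p \<in> chart_interior U \<phi>" and y: "y \<in> measure_support \<rho>"
  shows "iter_deriv vs (\<lambda>q. L (inv_into U \<phi> q) y) differentiable (at p)"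
    and "\<bar>iter_deriv vs (\<lambda>q. L (inv_into U \<phi> q) y) p\<bar> \<le> \<bar>iter_deriv vs (\<lambda>q. D (inv_into U \<phi> q) y) p\<bar>"
proof -
  obtain V where V: "open V" "p \<in> V" "V \<subseteq> \<phi> ` U"
    "(\<forall>q\<in>V. L (inv_into U \<phi> q) y = D (inv_into U \<phi> q) y) \<or> (\<forall>q\<in>V. L (inv_into U \<phi> q) y = 0)"
    using lagrangian_local_dichotomy[OF assms] by metis
  from V(4) obtain f where f: "smooth_on f V" "\<And>q. q \<in> V \<Longrightarrow> L (inv_into U \<phi> q) y = f q"
    "f = (\<lambda>q. D (inv_into U \<phi> q) y) \<or> f = (\<lambda>_. 0)"
  proof
    assume "\<forall>q\<in>V. L (inv_into U \<phi> q) y = D (inv_into U \<phi> q) y"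
    then show ?thesis
      using smooth_on_subset[OF smooth_slice[OF U] V(3)] by (intro that) auto
  next
    assume "\<forall>q\<in>V. L (inv_into U \<phi> q) y = 0"
    then show ?thesis
      using smooth_on_const by (intro that[of "\<lambda>_. 0"]) auto
  qed
  have eq: "iter_deriv vs (\<lambda>q. L (inv_into U \<phi> q) y) q = iter_deriv vs f q" if "q \<in> V" for q
    by (rule iter_deriv_cong[OF V(1) f(2) that])
  have "smooth_on (iter_deriv vs (\<lambda>q. L (inv_into U \<phi> q) y)) V"
    by (rule smooth_on_cong[OF V(1) eq[symmetric] smooth_on_iter_deriv[OF f(1)]])
  then show "iter_deriv vs (\<lambda>q. L (inv_into U \<phi> q) y) differentiable (at p)"
    using V(2) by (rule smooth_on_imp_differentiable)
  show "\<bar>iter_deriv vs (\<lambda>q. L (inv_into U \<phi> q) y) p\<bar> \<le> \<bar>iter_deriv vs (\<lambda>q. D (inv_into U \<phi> q) y) p\<bar>"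
    using f(3) eq[OF V(2)] by (auto simp: iter_deriv_const)
qed

text \<open>Induction on the list of directions: the integral is constant on the ball, so the
  integrals of the difference quotients vanish, and dominated convergence carries this to the next
  derivative. Off the support \<open>g\<close> is set to 0, because the derivatives of
  \<open>L\<close> are controlled only for \<open>y\<close> in the support, which has full
  measure.\<close>

lemma integral_lagrangian_iter_deriv:
  assumes U: "(U, \<phi>) \<in> A" and r: "cball p0 r \<subseteq> chart_interior U \<phi>" and p: "p \<in> ball p0 r"
  defines "g \<equiv> \<lambda>vs p y. if y \<in> measure_support \<rho> then iter_deriv vs (\<lambda>q. L (inv_into U \<phi> q) y) p else 0"
  shows "bounded_borel (g vs p)" and "(\<integral>y. g vs p y \<partial>\<rho>) = (if vs = [] then action D \<rho> else 0)"
proof -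
  have supp_borel: "measure_support \<rho> \<in> sets borel"
    using closed_measure_support[OF sets_eq] by simp
  have sub: "cball p0 r \<subseteq> \<phi> ` U"
    using r by (auto simp: chart_interior_def)
  have bound: "\<exists>M\<ge>0. \<forall>q\<in>cball p0 r. \<forall>y. \<bar>g vs q y\<bar> \<le> M" for vs
  proof -
    have "compact (cball p0 r \<times> (UNIV :: 'a set))"
      by (intro compact_Times comp compact_cball)
    moreover have "continuous_on (cball p0 r \<times> UNIV) (\<lambda>z. iter_deriv vs (\<lambda>p. D (inv_into U \<phi> p) (snd z)) (fst z))"
      using sub by (intro continuous_on_subset[OF continuous_iter_deriv[OF U]]) auto
    ultimately have "bounded ((\<lambda>z. iter_deriv vs (\<lambda>p. D (inv_into U \<phi> p) (snd z)) (fst z)) ` (cball p0 r \<times> UNIV))"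
      by (intro compact_imp_bounded compact_continuous_image)
    then obtain M where M: "M > 0"
        "\<And>q y. q \<in> cball p0 r \<Longrightarrow> \<bar>iter_deriv vs (\<lambda>p. D (inv_into U \<phi> p) y) q\<bar> \<le> M"
      unfolding bounded_pos by force
    have "\<bar>g vs q y\<bar> \<le> M" if "q \<in> cball p0 r" for q y
    proof (cases "y \<in> measure_support \<rho>")
      case True
      then show ?thesis
        using lagrangian_iter_deriv(2)[OF U _ True, of q vs] M(2)[OF that, of y] r that
        by (auto simp: g_def)
    qed (use M in \<open>simp add: g_def\<close>)
    then show ?thesis using M(1) by (intro exI[of _ M]) auto
  qed
  have "bounded_borel (g vs p) \<and> (\<integral>y. g vs p y \<partial>\<rho>) = (if vs = [] then action D \<rho> else 0)"
    using p
  proof (induction vs arbitrary: p)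
    case Nil
    have g: "g [] p = (\<lambda>y. indicator (measure_support \<rho>) y * L (inv_into U \<phi> p) y)"
      by (auto simp: g_def)
    have "bounded_borel (g [] p)"
      unfolding g by (intro bounded_borel_mult bounded_borel_indicator supp_borel bounded_borel_L)
    moreover have "(\<integral>y. g [] p y \<partial>\<rho>) = (\<integral>y. L (inv_into U \<phi> p) y \<partial>\<rho>)"
    proof (rule integral_cong_AE)
      show "AE y in \<rho>. g [] p y = L (inv_into U \<phi> p) y"
        using AE_measure_support[OF sets_eq] by eventually_elim (simp add: g)
      show "g [] p \<in> borel_measurable \<rho>"
        using \<open>bounded_borel (g [] p)\<close> by (auto dest: bounded_borel_measurable)
      show "L (inv_into U \<phi> p) \<in> borel_measurable \<rho>"
        using bounded_borel_L(2) by (auto dest: bounded_borel_measurable)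
    qed
    moreover have "inv_into U \<phi> p \<in> measure_support \<rho>"
      using Nil r interior_subset[of "measure_support \<rho>"] ball_subset_cball[of p0 r]
      unfolding chart_interior_def by blast
    ultimately show ?case
      using potential_constant by (simp add: potential_def)
  next
    case (Cons v vs)
    have "open ((\<lambda>t. p + t *\<^sub>R v) -` ball p0 r)"
      by (intro open_vimage continuous_intros) auto
    moreover have "0 \<in> (\<lambda>t. p + t *\<^sub>R v) -` ball p0 r"
      using Cons.prems by simp
    ultimately obtain e where e: "e > 0" "ball 0 e \<subseteq> (\<lambda>t. p + t *\<^sub>R v) -` ball p0 r"
      using open_contains_ball by metis
    \<comment> \<open>This is a sequence of step sizes in the interval from 0 to \<open>e\<close>;
      the halving keeps even its first member strictly below \<open>e\<close>.\<close>
    define s where "s n = e / 2 / real (Suc n)" for n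
    have s: "0 < s n" "s n < e" for n
    proof -
      show "0 < s n" using e by (simp add: s_def)
      have "s n \<le> e / 2" using e by (simp add: s_def divide_le_eq)
      then show "s n < e" using e by simp
    qed
    have s0: "s \<longlonglongrightarrow> 0"
      unfolding s_def by (rule LIMSEQ_Suc[OF lim_const_over_n])
    have line: "p + t *\<^sub>R v \<in> ball p0 r" if "\<bar>t\<bar> < e" for t
      using e(2) that by (auto simp: subset_iff dist_real_def)
    define h where "h n y = (g vs (p + s n *\<^sub>R v) y - g vs p y) / s n" for n y
    obtain M where M: "M \<ge> 0" "\<And>q y. q \<in> cball p0 r \<Longrightarrow> \<bar>g (v # vs) q y\<bar> \<le> M"
      using bound by metis
    have deriv: "((\<lambda>t. g vs (p + t *\<^sub>R v) y) has_real_derivative g (v # vs) (p + t *\<^sub>R v) y) (at t)"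
      if "\<bar>t\<bar> < e" for t y
    proof (cases "y \<in> measure_support \<rho>")
      case True
      have "p + t *\<^sub>R v \<in> chart_interior U \<phi>"
        using line[OF that] r ball_subset_cball by blast
      then show ?thesis
        using has_real_derivative_along_line[OF lagrangian_iter_deriv(1)[OF U _ True, of "p + t *\<^sub>R v" vs]] True
        by (simp add: g_def)
    qed (simp add: g_def)
    have conv: "(\<lambda>n. h n y) \<longlonglongrightarrow> g (v # vs) p y" for y
    proof -
      have "((\<lambda>t. (g vs (p + t *\<^sub>R v) y - g vs p y) / t) \<longlongrightarrow> g (v # vs) p y) (at 0)"
        using deriv[of 0 y] e by (simp add: has_field_derivative_iff)
      moreover have "filterlim s (at 0) sequentially"
        using s0 s(1) by (auto simp: filterlim_at less_imp_neq[THEN not_sym] intro!: always_eventually)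
      ultimately show ?thesis
        unfolding h_def by (rule filterlim_compose)
    qed
    \<comment> \<open>The mean value theorem bounds the difference quotients by the uniform bound on
      the next derivative, which provides the constant dominating function.\<close>
    have le: "\<bar>h n y\<bar> \<le> M" for n y
    proof -
      have "\<exists>t. 0 < t \<and> t < s n \<and> g vs (p + s n *\<^sub>R v) y - g vs (p + 0 *\<^sub>R v) y
          = (s n - 0) * g (v # vs) (p + t *\<^sub>R v) y"
      proof (rule MVT2)
        show "((\<lambda>t. g vs (p + t *\<^sub>R v) y) has_real_derivative g (v # vs) (p + t *\<^sub>R v) y) (at t)"
          if "0 \<le> t" "t \<le> s n" for t
          using that s(2)[of n] by (intro deriv) auto
      qed (rule s)
      then obtain t where t: "0 < t" "t < s n" "h n y = g (v # vs) (p + t *\<^sub>R v) y"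
        using s(1)[of n] by (auto simp: h_def)
      then have "p + t *\<^sub>R v \<in> cball p0 r"
        using line[of t] s(2)[of n] ball_subset_cball[of p0 r] by auto
      then show ?thesis using M(2) t(3) by metis
    qed
    have IH: "bounded_borel (g vs (p + s n *\<^sub>R v))" "bounded_borel (g vs p)"
      "(\<integral>y. g vs (p + s n *\<^sub>R v) y \<partial>\<rho>) = (\<integral>y. g vs p y \<partial>\<rho>)" for n
      using Cons.IH[OF line, of "s n"] Cons.IH[OF Cons.prems] s[of n] by simp_all
    have bmh: "bounded_borel (h n)" for n
      using bounded_borel_mult[OF bounded_borel_const bounded_borel_diff[OF IH(1)[of n] IH(2)], of "1 / s n"]
      by (simp add: h_def[abs_def])
    have int_h: "(\<integral>y. h n y \<partial>\<rho>) = 0" for n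
      using IH(1,3)[of n] IH(2) by (simp add: h_def Bochner_Integration.integral_diff)
    \<comment> \<open>Measurability of the derivative in \<open>y\<close> is inherited from the
      difference quotients as a pointwise limit of a sequence.\<close>
    have meas: "g (v # vs) p \<in> borel_measurable borel"
      by (rule borel_measurable_LIMSEQ_real[OF conv]) (use bmh in \<open>auto dest: bounded_borel_measurable\<close>)
    then have "bounded_borel (g (v # vs) p)"
      using M(2)[of p] Cons.prems by (auto simp: bounded_borel_def)
    moreover have "(\<lambda>n. \<integral>y. h n y \<partial>\<rho>) \<longlonglongrightarrow> (\<integral>y. g (v # vs) p y \<partial>\<rho>)"
      by (rule integral_dominated_convergence[where w = "\<lambda>_. M"])
         (use meas bmh conv le in \<open>auto dest: bounded_borel_measurable\<close>)
    then have "(\<integral>y. g (v # vs) p y \<partial>\<rho>) = 0"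
      unfolding int_h using LIMSEQ_unique tendsto_const by metis
    ultimately show ?case by simp
  qed
  then show "bounded_borel (g vs p)" and "(\<integral>y. g vs p y \<partial>\<rho>) = (if vs = [] then action D \<rho> else 0)"
    by auto
qed

text \<open>At an interior point \<open>x\<close>, the operator acting on \<open>L\<close> under the
  integral gives a function of mean zero that is nonpositive on the support and strictly negative
  wherever \<open>D x y > 0\<close>. Such \<open>y\<close> form an open set containing
  \<open>x\<close> itself, hence of positive measure.\<close>

lemma interior_support_empty_differential_operator:
  assumes \<Delta>: "differential_operator A \<Delta>" and const: "\<And>a x. \<Delta> (\<lambda>_. a) x = 0"
    and neg: "\<And>x y. y \<in> I_set D x \<Longrightarrow> \<Delta> (\<lambda>z. D z y) x < 0"
  shows "interior (measure_support \<rho>) = {}"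
proof (rule ccontr)
  assume "interior (measure_support \<rho>) \<noteq> {}"
  then obtain x where x: "x \<in> interior (measure_support \<rho>)" by blast
  obtain U \<phi> where U: "(U, \<phi>) \<in> A" "x \<in> U"
    using smooth_atlasD(2)[OF atlas] by metis
  let ?i = "inv_into U \<phi>"
  define p where "p = \<phi> x"
  have ip: "?i p = x" and ie: "\<And>z. z \<in> U \<Longrightarrow> ?i (\<phi> z) = z"
    using U chartD(5)[OF U(1)] by (simp_all add: p_def)
  obtain k where "\<forall>(U, \<phi>)\<in>A. \<exists>a :: 'e list \<Rightarrow> 'e \<Rightarrow> real.
     (\<forall>vs. set vs \<subseteq> Basis \<and> length vs \<le> k \<longrightarrow> smooth_on (a vs) (\<phi> ` U)) \<and>
     (\<forall>f. smooth_function A f \<longrightarrow> (\<forall>x\<in>U.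
        \<Delta> f x = (\<Sum>vs | set vs \<subseteq> Basis \<and> length vs \<le> k.
                    a vs (\<phi> x) * iter_deriv vs (f \<circ> inv_into U \<phi>) (\<phi> x))))"
    using \<Delta> unfolding differential_operator_def by blast
  from bspec[OF this U(1)] obtain a :: "'e list \<Rightarrow> 'e \<Rightarrow> real"
    where a: "\<And>vs. set vs \<subseteq> Basis \<Longrightarrow> length vs \<le> k \<Longrightarrow> smooth_on (a vs) (\<phi> ` U)"
      and \<Delta>_eq: "\<And>f z. smooth_function A f \<Longrightarrow> z \<in> U \<Longrightarrow> \<Delta> f z =
        (\<Sum>vs | set vs \<subseteq> Basis \<and> length vs \<le> k. a vs (\<phi> z) * iter_deriv vs (f \<circ> ?i) (\<phi> z))"
    by auto
  define VS where "VS = {vs :: 'e list. set vs \<subseteq> Basis \<and> length vs \<le> k}"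
  have fin: "finite VS"
    unfolding VS_def by (rule finite_lists_length_le) simp
  have p: "p \<in> chart_interior U \<phi>" "p \<in> \<phi> ` U"
    using U x ip by (auto simp: chart_interior_def p_def)
  obtain r where r: "r > 0" "cball p r \<subseteq> chart_interior U \<phi>"
    using open_chart_interior[OF U(1)] p by (meson open_contains_cball)
  define g where "g vs y = (if y \<in> measure_support \<rho> then iter_deriv vs (\<lambda>q. L (?i q) y) p else 0)" for vs y
  have g: "bounded_borel (g vs)" "(\<integral>y. g vs y \<partial>\<rho>) = (if vs = [] then action D \<rho> else 0)" for vs
    using integral_lagrangian_iter_deriv[OF U(1) r(2), of p vs] r(1) by (simp_all add: g_def[abs_def])
  \<comment> \<open>Evaluating the operator on the constant function 1 isolates the coefficient of
    order zero.\<close>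
  have "a [] p = (\<Sum>vs\<in>VS. a vs p * (if vs = [] then 1 else 0))"
    using fin by (simp add: VS_def if_distrib[of "(*) _"] sum.delta cong: if_cong)
  also have "\<dots> = \<Delta> (\<lambda>_. 1) x"
    using \<Delta>_eq[of "\<lambda>_. 1" x] U
    by (auto simp: smooth_function_def smooth_on_const comp_def iter_deriv_const VS_def p_def)
  also have "\<dots> = 0" by (rule const)
  finally have a_Nil: "a [] p = 0" .
  \<comment> \<open>Slices of \<open>L\<close> need not be smooth on the whole manifold, so the
    operator is applied to them through its local formula at \<open>p\<close> only.\<close>
  define E where "E y = (\<Sum>vs\<in>VS. a vs p * g vs y)" for y
  have "bounded_borel E" unfolding E_def by (intro bounded_borel_sum bounded_borel_mult bounded_borel_const g)
  have "(\<integral>y. E y \<partial>\<rho>) = (\<Sum>vs\<in>VS. a vs p * (\<integral>y. g vs y \<partial>\<rho>))"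
    unfolding E_def using g by (subst Bochner_Integration.integral_sum) auto
  \<comment> \<open>Only the empty list has an integral that may be nonzero, and its coefficient
    vanishes.\<close>
  also have "\<dots> = 0"
    by (intro sum.neutral) (auto simp: g a_Nil)
  finally have int_E: "(\<integral>y. E y \<partial>\<rho>) = 0" .
  define F where "F y q = (\<Sum>vs\<in>VS. a vs q * iter_deriv vs (\<lambda>q. D (?i q) y) q)" for y q
  have F: "\<Delta> (\<lambda>z. D z y) (?i q) = F y q" if "q \<in> \<phi> ` U" for y q
    using \<Delta>_eq[OF smooth_function_slice, of "?i q" y] that
    by (simp add: F_def VS_def comp_def inv_into_into f_inv_into_f)
  have contF: "continuous_on (\<phi> ` U) (F y)" for y
    unfolding F_def
    by (intro continuous_intros smooth_on_imp_continuous_on smooth_on_iter_deriv smooth_slice U a)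
       (auto simp: VS_def)
  have E0: "E y = 0" if "y \<in> measure_support \<rho>" "open V" "p \<in> V" "\<And>q. q \<in> V \<Longrightarrow> L (?i q) y = 0" for y V
    using iter_deriv_cong[OF that(2), of "\<lambda>q. L (?i q) y" "\<lambda>_. 0" p] that
    by (auto simp: E_def g_def iter_deriv_const intro!: sum.neutral)
  have E_cases: "E y = F y p \<or> E y = 0 \<and> D x y \<le> 0" if y: "y \<in> measure_support \<rho>" for y
  proof -
    obtain V where V: "open V" "p \<in> V" "V \<subseteq> \<phi> ` U"
      "(\<forall>q\<in>V. L (?i q) y = D (?i q) y) \<or> (\<forall>q\<in>V. L (?i q) y = 0)"
      using lagrangian_local_dichotomy[OF U(1) p(1) y] by metis
    from V(4) show ?thesis
    proof
      assume "\<forall>q\<in>V. L (?i q) y = D (?i q) y"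
      then have "iter_deriv vs (\<lambda>q. L (?i q) y) p = iter_deriv vs (\<lambda>q. D (?i q) y) p" for vs
        using V by (intro iter_deriv_cong[OF V(1)]) auto
      then show ?thesis using y by (simp add: E_def F_def g_def)
    next
      assume *: "\<forall>q\<in>V. L (?i q) y = 0"
      then have "L x y = 0" using V(2) ip by auto
      then show ?thesis using E0[OF y V(1,2)] * L_ge[of x y] by auto
    qed
  qed
  \<comment> \<open>The sign hypothesis gives no direct information at \<open>p\<close> when
    \<open>D x y = 0\<close>. But if \<open>F y p\<close> were positive, it would stay positive on a
    neighbourhood; there \<open>D\<close> against \<open>y\<close> could not be positive, so
    \<open>L\<close> would vanish on it and \<open>E y\<close> would be 0.\<close>
  have E_le: "E y \<le> 0" if y: "y \<in> measure_support \<rho>" for y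
  proof (rule ccontr)
    assume "\<not> E y \<le> 0"
    then have "F y p > 0" using E_cases[OF y] by auto
    define V where "V = {q \<in> \<phi> ` U. F y q \<in> {0<..}}"
    have "open V"
      using continuous_open_preimage[OF contF chartD(2)[OF U(1)], of "{0<..}" y]
      by (simp add: V_def vimage_def Int_def)
    moreover have "p \<in> V" using \<open>F y p > 0\<close> p by (simp add: V_def)
    moreover have "L (?i q) y = 0" if "q \<in> V" for q
      using neg[of y "?i q"] F[of q y] that by (force simp: V_def I_set_def lagrangian_def)
    ultimately have "E y = 0"
      by (rule E0[OF y])
    then show False using \<open>\<not> E y \<le> 0\<close> by simp
  qed
  have "AE y in \<rho>. 0 \<le> - E y"
    using AE_measure_support[OF sets_eq] by eventually_elim (use E_le in auto)
  then have "AE y in \<rho>. - E y = 0"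
    using int_E \<open>bounded_borel E\<close> by (subst integral_nonneg_eq_0_iff_AE[symmetric]) auto
  then have "AE y in \<rho>. \<not> D x y > 0"
    using AE_measure_support[OF sets_eq]
  proof eventually_elim
    case (elim y)
    then show ?case
      using E_cases[of y] neg[of y x] F[OF p(2), of y] ip by (force simp: I_set_def)
  qed
  then have "\<not> D x x > 0"
  proof (rule AE_imp_on_measure_support[OF sets_eq])
    show "open {y. \<not> \<not> D x y > 0}"
      using open_vimage[OF _ continuous_kernel_slice(2)[OF contD], of "{0<..}" x] by (simp add: vimage_def)
    show "x \<in> measure_support \<rho>" using x interior_subset by blast
  qed
  then show False by (simp add: diagD)
qed

end

section \<open>Real analytic kernels\<close>

text \<open>Absolute convergence allows the terms to be collected by the exponent
  \<open>K \<alpha>\<close>, which yields an ordinary power series in \<open>t\<close>. All its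
  coefficients are bounded by the same absolute sum.\<close>

lemma has_sum_group_powers:
  fixes g :: "'i \<Rightarrow> real" and K :: "'i \<Rightarrow> nat"
  assumes abs: "(\<lambda>\<alpha>. \<bar>g \<alpha>\<bar>) summable_on M"
  defines "c \<equiv> \<lambda>k. \<Sum>\<^sub>\<infinity>\<alpha>\<in>{\<alpha>\<in>M. K \<alpha> = k}. g \<alpha>"
  shows "\<bar>c k\<bar> \<le> (\<Sum>\<^sub>\<infinity>\<alpha>\<in>M. \<bar>g \<alpha>\<bar>)"
    and "((\<lambda>\<alpha>. t ^ K \<alpha> * g \<alpha>) has_sum S) M \<Longrightarrow> (\<lambda>k. c k * t ^ k) sums S"
proof -
  have sub: "(\<lambda>\<alpha>. \<bar>g \<alpha>\<bar>) summable_on {\<alpha>\<in>M. K \<alpha> = k}" for k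
    by (rule summable_on_subset_banach[OF abs]) auto
  then have "\<bar>c k\<bar> \<le> (\<Sum>\<^sub>\<infinity>\<alpha>\<in>{\<alpha>\<in>M. K \<alpha> = k}. \<bar>g \<alpha>\<bar>)"
    unfolding c_def using norm_infsum_bound[of g "{\<alpha>\<in>M. K \<alpha> = k}"] by simp
  also have "\<dots> \<le> (\<Sum>\<^sub>\<infinity>\<alpha>\<in>M. \<bar>g \<alpha>\<bar>)"
    by (rule infsum_mono2[OF sub abs]) auto
  finally show "\<bar>c k\<bar> \<le> (\<Sum>\<^sub>\<infinity>\<alpha>\<in>M. \<bar>g \<alpha>\<bar>)" .
  have "g summable_on {\<alpha>\<in>M. K \<alpha> = k}" for k
    using sub[of k] summable_on_iff_abs_summable_on_real[of g] by simp
  then have c: "(g has_sum c k) {\<alpha>\<in>M. K \<alpha> = k}" for k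
    unfolding c_def by (rule has_sum_infsum)
  assume S: "((\<lambda>\<alpha>. t ^ K \<alpha> * g \<alpha>) has_sum S) M"
  have bij: "bij_betw (\<lambda>\<alpha>. (K \<alpha>, \<alpha>)) M (SIGMA k:UNIV. {\<alpha>\<in>M. K \<alpha> = k})"
    by (auto simp: bij_betw_def inj_on_def)
  have "((\<lambda>(k, \<alpha>). t ^ k * g \<alpha>) has_sum S) (SIGMA k:UNIV. {\<alpha>\<in>M. K \<alpha> = k})"
    using has_sum_reindex_bij_betw[OF bij, of "\<lambda>(k, \<alpha>). t ^ k * g \<alpha>" S] S by simp
  then have "((\<lambda>k. t ^ k * c k) has_sum S) UNIV"
  proof (rule has_sum_Sigma')
    show "((\<lambda>\<alpha>. case (k, \<alpha>) of (k, \<alpha>) \<Rightarrow> t ^ k * g \<alpha>) has_sum t ^ k * c k) {\<alpha>\<in>M. K \<alpha> = k}" for k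
      using has_sum_cmult_right[OF c[of k], of "t ^ k"] by simp
  qed
  then show "(\<lambda>k. c k * t ^ k) sums S"
    using has_sum_imp_sums by (simp add: mult.commute)
qed

text \<open>Scaling only the coordinates in \<open>B1\<close> by \<open>t\<close> multiplies each
  monomial by \<open>t\<close> to its degree in \<open>B1\<close>. Grouping by this degree gives the
  series, and comparison with one corner of a cube bounds its coefficients uniformly in
  \<open>w\<close>.\<close>

lemma real_analytic_partial_power_series:
  fixes f :: "'e::euclidean_space \<Rightarrow> real" and B1 :: "'e set"
  assumes f: "real_analytic_on f S" and S: "open S" "x \<in> S" and B1: "B1 \<subseteq> Basis"
  defines "y \<equiv> \<lambda>w t. x + (\<Sum>b\<in>Basis. (if b \<in> B1 then t * (w \<bullet> b) else w \<bullet> b) *\<^sub>R b)"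
  obtains s C where "s > 0" "C \<ge> 0"
    "\<forall>w. (\<forall>b\<in>Basis. \<bar>w \<bullet> b\<bar> \<le> s) \<longrightarrow> (\<exists>c. (\<forall>k. \<bar>c k\<bar> \<le> C) \<and>
        (\<forall>t. \<bar>t\<bar> \<le> 1 \<longrightarrow> y w t \<in> S \<and> (\<lambda>k. c k * t ^ k) sums f (y w t)))"
proof -
  let ?M = "{\<alpha> :: 'e \<Rightarrow> nat. \<forall>b. b \<notin> Basis \<longrightarrow> \<alpha> b = 0}"
  obtain r a where r: "r > 0" and a: "\<And>y. y \<in> ball x r \<Longrightarrow>
      ((\<lambda>\<alpha>. (\<Prod>b\<in>Basis. ((y - x) \<bullet> b) ^ \<alpha> b) *\<^sub>R a \<alpha>) has_sum f y) ?M"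
    using f S(2) unfolding real_analytic_on_def by meson
  obtain e where e: "e > 0" "ball x e \<subseteq> S"
    using S by (meson open_contains_ball)
  define R where "R = min r e"
  \<comment> \<open>A vector with all coordinates at most \<open>s\<close> in absolute value has
    norm at most \<open>DIM('e) * s\<close>, which is less than \<open>R\<close>.\<close>
  define s where "s = R / (real DIM('e) + 1)"
  have "R > 0" using r e by (simp add: R_def)
  then have "s > 0" by (simp add: s_def)
  have in_ball: "x + (\<Sum>b\<in>Basis. u b *\<^sub>R b) \<in> ball x R" if "\<And>b. b \<in> Basis \<Longrightarrow> \<bar>u b\<bar> \<le> s" for u
  proof -
    have "norm (\<Sum>b\<in>Basis. u b *\<^sub>R b) \<le> (\<Sum>b\<in>(Basis :: 'e set). s)"
      by (rule sum_norm_le) (use that in auto)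
    also have "\<dots> < R"
      using \<open>R > 0\<close> by (simp add: s_def field_simps)
    finally show ?thesis by (simp add: dist_norm)
  qed
  \<comment> \<open>At this corner of the cube every coordinate has the maximal size
    \<open>s\<close>, so the terms there dominate those at all other points of the cube.\<close>
  define z where "z = x + (\<Sum>b\<in>Basis. s *\<^sub>R b)"
  have "z \<in> ball x R"
    unfolding z_def using \<open>s > 0\<close> by (intro in_ball[of "\<lambda>_. s"]) auto
  define g0 where "g0 \<alpha> = (\<Prod>b\<in>Basis. s ^ \<alpha> b) * a \<alpha>" for \<alpha> :: "'e \<Rightarrow> nat"
  have "((\<lambda>\<alpha>. (\<Prod>b\<in>Basis. ((z - x) \<bullet> b) ^ \<alpha> b) *\<^sub>R a \<alpha>) has_sum f z) ?M"
    using \<open>z \<in> ball x R\<close> by (intro a) (simp add: R_def)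
  moreover have "(z - x) \<bullet> b = s" if "b \<in> Basis" for b
    using inner_sum_left_Basis[OF that, of "\<lambda>_. s"] by (simp add: z_def)
  then have "(\<lambda>\<alpha>. (\<Prod>b\<in>Basis. ((z - x) \<bullet> b) ^ \<alpha> b) *\<^sub>R a \<alpha>) = g0"
    by (simp add: g0_def fun_eq_iff)
  ultimately have "g0 summable_on ?M"
    unfolding summable_on_def by auto
  then have g0: "(\<lambda>\<alpha>. \<bar>g0 \<alpha>\<bar>) summable_on ?M"
    using summable_on_iff_abs_summable_on_real[of g0 ?M] by simp
  show ?thesis
  proof (rule that; (intro allI impI)?)
    show "s > 0" by fact
    show "(\<Sum>\<^sub>\<infinity>\<alpha>\<in>?M. \<bar>g0 \<alpha>\<bar>) \<ge> 0" by (rule infsum_nonneg) simp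
    fix w :: 'e assume "\<forall>b\<in>Basis. \<bar>w \<bullet> b\<bar> \<le> s"
    then have w: "\<bar>w \<bullet> b\<bar> \<le> s" if "b \<in> Basis" for b :: 'e using that by blast
    define g where "g \<alpha> = (\<Prod>b\<in>Basis. (w \<bullet> b) ^ \<alpha> b) * a \<alpha>" for \<alpha> :: "'e \<Rightarrow> nat"
    have le: "\<bar>g \<alpha>\<bar> \<le> \<bar>g0 \<alpha>\<bar>" for \<alpha>
    proof -
      have "(\<Prod>b\<in>Basis. \<bar>w \<bullet> b\<bar> ^ \<alpha> b) \<le> (\<Prod>b\<in>(Basis :: 'e set). s ^ \<alpha> b)"
        using w by (intro prod_mono) (auto intro: power_mono)
      moreover have "0 \<le> (\<Prod>b\<in>(Basis :: 'e set). s ^ \<alpha> b)"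
        using \<open>s > 0\<close> by (intro prod_nonneg) auto
      ultimately show ?thesis
        using \<open>s > 0\<close> by (simp add: g_def g0_def abs_mult abs_prod power_abs mult_right_mono)
    qed
    have g: "(\<lambda>\<alpha>. \<bar>g \<alpha>\<bar>) summable_on ?M"
      using Infinite_Sum.abs_summable_on_comparison_test[of g0 ?M g] g0 le by simp
    define K where "K \<alpha> = (\<Sum>b\<in>B1. \<alpha> b)" for \<alpha> :: "'e \<Rightarrow> nat"
    define c where "c k = (\<Sum>\<^sub>\<infinity>\<alpha>\<in>{\<alpha>\<in>?M. K \<alpha> = k}. g \<alpha>)" for k
    have "\<bar>c k\<bar> \<le> (\<Sum>\<^sub>\<infinity>\<alpha>\<in>?M. \<bar>g0 \<alpha>\<bar>)" for k
      unfolding c_def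
      by (rule order_trans[OF has_sum_group_powers(1)[OF g]]) (rule infsum_mono[OF g g0 le])
    moreover have "y w t \<in> S \<and> (\<lambda>k. c k * t ^ k) sums f (y w t)" if t: "\<bar>t\<bar> \<le> 1" for t
    proof
      have "\<bar>if b \<in> B1 then t * (w \<bullet> b) else w \<bullet> b\<bar> \<le> s" if "b \<in> Basis" for b
        using w[OF that] mult_mono[OF t, of "\<bar>w \<bullet> b\<bar>" "\<bar>w \<bullet> b\<bar>"] by (simp add: abs_mult)
      then have yb: "y w t \<in> ball x R"
        unfolding y_def by (rule in_ball)
      then show "y w t \<in> S" using e(2) by (auto simp: R_def)
      have "(\<Prod>b\<in>Basis. ((y w t - x) \<bullet> b) ^ \<alpha> b) *\<^sub>R a \<alpha> = t ^ K \<alpha> * g \<alpha>" for \<alpha>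
      proof -
        have "(\<Prod>b\<in>Basis. ((y w t - x) \<bullet> b) ^ \<alpha> b)
            = (\<Prod>b\<in>Basis. (if b \<in> B1 then t ^ \<alpha> b else 1) * (w \<bullet> b) ^ \<alpha> b)"
          by (intro prod.cong refl) (simp add: y_def inner_sum_left_Basis power_mult_distrib)
        also have "\<dots> = (\<Prod>b\<in>Basis. if b \<in> B1 then t ^ \<alpha> b else 1) * (\<Prod>b\<in>Basis. (w \<bullet> b) ^ \<alpha> b)"
          by (rule prod.distrib)
        also have "(\<Prod>b\<in>Basis. if b \<in> B1 then t ^ \<alpha> b else 1) = (\<Prod>b\<in>B1. t ^ \<alpha> b)"
          using B1 by (simp add: prod.If_cases Int_absorb1)
        finally show ?thesis by (simp add: g_def K_def power_sum)
      qed
      then have "((\<lambda>\<alpha>. t ^ K \<alpha> * g \<alpha>) has_sum f (y w t)) ?M"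
        using a[of "y w t"] yb by (simp add: R_def)
      then show "(\<lambda>k. c k * t ^ k) sums f (y w t)"
        unfolding c_def by (rule has_sum_group_powers(2)[OF g])
    qed
    ultimately show "\<exists>c. (\<forall>k. \<bar>c k\<bar> \<le> (\<Sum>\<^sub>\<infinity>\<alpha>\<in>?M. \<bar>g0 \<alpha>\<bar>)) \<and>
        (\<forall>t. \<bar>t\<bar> \<le> 1 \<longrightarrow> y w t \<in> S \<and> (\<lambda>k. c k * t ^ k) sums f (y w t))"
      by blast
  qed
qed

text \<open>Here \<open>B1\<close> consists of the directions of the first factor, so the scaling
  moves along a line through \<open>p\<close> while \<open>q\<close> stays fixed. The point is that
  \<open>r\<close> and \<open>C\<close> do not depend on \<open>q\<close>.\<close>

lemma real_analytic_line_power_series: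
  fixes f :: "'e::euclidean_space \<times> 'c::euclidean_space \<Rightarrow> real"
  assumes f: "real_analytic_on f (S \<times> T)" and S: "open S" "p \<in> S" and T: "open T" "q0 \<in> T"
  obtains r C where "r > 0" "C \<ge> 0"
    "\<forall>q\<in>ball q0 r. \<exists>c. (\<forall>k. \<bar>c k\<bar> \<le> C / r ^ k) \<and>
        (\<forall>t. \<bar>t\<bar> < r \<longrightarrow> p + t *\<^sub>R v \<in> S \<and> q \<in> T \<and> (\<lambda>k. c k * t ^ k) sums f (p + t *\<^sub>R v, q))"
proof -
  define B1 :: "('e \<times> 'c) set" where "B1 = (\<lambda>u. (u, 0)) ` Basis"
  have B1: "B1 \<subseteq> Basis" by (auto simp: B1_def Basis_prod_def)
  have pq: "(p, q0) \<in> S \<times> T" using S T by simp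
  obtain s C where s: "s > 0" and C: "C \<ge> 0" and
    ser: "\<forall>w. (\<forall>b\<in>Basis. \<bar>w \<bullet> b\<bar> \<le> s) \<longrightarrow> (\<exists>c. (\<forall>k. \<bar>c k\<bar> \<le> C) \<and>
        (\<forall>t. \<bar>t\<bar> \<le> 1 \<longrightarrow>
          (p, q0) + (\<Sum>b\<in>Basis. (if b \<in> B1 then t * (w \<bullet> b) else w \<bullet> b) *\<^sub>R b) \<in> S \<times> T \<and>
          (\<lambda>k. c k * t ^ k) sums f ((p, q0) + (\<Sum>b\<in>Basis. (if b \<in> B1 then t * (w \<bullet> b) else w \<bullet> b) *\<^sub>R b))))"
    by (rule real_analytic_partial_power_series[OF f open_Times[OF S(1) T(1)] pq B1])
  define l where "l = s / (norm v + 1)"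
  have "l > 0" using s by (simp add: l_def add_nonneg_pos)
  \<comment> \<open>With \<open>r \<le> l\<close> the coefficients obtained by rescaling with powers
    of \<open>l\<close> satisfy the stated bound, and with \<open>r \<le> s\<close> the offset
    \<open>q - q0\<close> lies in the cube.\<close>
  define r where "r = min l s"
  have r: "r > 0" "r \<le> l" "r \<le> s" using \<open>l > 0\<close> s by (auto simp: r_def)
  show ?thesis
  proof (rule that; (rule ballI)?)
    fix q assume q: "q \<in> ball q0 r"
    define w where "w = (l *\<^sub>R v, q - q0)"
    have "\<bar>w \<bullet> b\<bar> \<le> s" if "b \<in> Basis" for b
    proof -
      have "l * norm v \<le> s"
        using s by (simp add: l_def pos_divide_le_eq add_nonneg_pos mult_left_mono)
      moreover have "\<bar>l *\<^sub>R v \<bullet> u\<bar> \<le> l * norm v" if "u \<in> Basis" for u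
        using Basis_le_norm[OF that, of "l *\<^sub>R v"] \<open>l > 0\<close> by simp
      moreover have "\<bar>(q - q0) \<bullet> u\<bar> \<le> s" if "u \<in> Basis" for u
        using Basis_le_norm[OF that, of "q - q0"] q r by (simp add: dist_norm norm_minus_commute)
      ultimately show ?thesis
        using that unfolding Basis_prod_def w_def by fastforce
    qed
    with ser obtain c where c: "\<And>k. \<bar>c k\<bar> \<le> C"
      "\<And>t. \<bar>t\<bar> \<le> 1 \<Longrightarrow>
          (p, q0) + (\<Sum>b\<in>Basis. (if b \<in> B1 then t * (w \<bullet> b) else w \<bullet> b) *\<^sub>R b) \<in> S \<times> T \<and>
          (\<lambda>k. c k * t ^ k) sums f ((p, q0) + (\<Sum>b\<in>Basis. (if b \<in> B1 then t * (w \<bullet> b) else w \<bullet> b) *\<^sub>R b))"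
      by blast
    have eq: "(p, q0) + (\<Sum>b\<in>Basis. (if b \<in> B1 then t * (w \<bullet> b) else w \<bullet> b) *\<^sub>R b) = (p + (t * l) *\<^sub>R v, q)" for t
    proof -
      have "(\<Sum>b\<in>Basis. (if b \<in> B1 then t * (w \<bullet> b) else w \<bullet> b) *\<^sub>R b) = ((t * l) *\<^sub>R v, q - q0)"
      proof (rule euclidean_eqI)
        fix b :: "'e \<times> 'c" assume b: "b \<in> Basis"
        then have "(if b \<in> B1 then t * (w \<bullet> b) else w \<bullet> b) = ((t * l) *\<^sub>R v, q - q0) \<bullet> b"
          by (auto simp: Basis_prod_def B1_def w_def)
        then show "(\<Sum>b\<in>Basis. (if b \<in> B1 then t * (w \<bullet> b) else w \<bullet> b) *\<^sub>R b) \<bullet> b = ((t * l) *\<^sub>R v, q - q0) \<bullet> b"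
          using b by (simp add: inner_sum_left_Basis)
      qed
      then show ?thesis by simp
    qed
    show "\<exists>c. (\<forall>k. \<bar>c k\<bar> \<le> C / r ^ k) \<and>
        (\<forall>t. \<bar>t\<bar> < r \<longrightarrow> p + t *\<^sub>R v \<in> S \<and> q \<in> T \<and> (\<lambda>k. c k * t ^ k) sums f (p + t *\<^sub>R v, q))"
    proof (intro exI[of _ "\<lambda>k. c k / l ^ k"] conjI allI impI)
      fix k
      have "\<bar>c k / l ^ k\<bar> = \<bar>c k\<bar> / l ^ k" using \<open>l > 0\<close> by simp
      also have "\<dots> \<le> C / r ^ k"
        using c(1)[of k] C r \<open>l > 0\<close> by (intro frac_le power_mono) auto
      finally show "\<bar>c k / l ^ k\<bar> \<le> C / r ^ k" .
    next
      fix t assume "\<bar>t\<bar> < r"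
      then have "\<bar>t / l\<bar> \<le> 1" using r \<open>l > 0\<close> by simp
      from c(2)[OF this] have *: "(p + t *\<^sub>R v, q) \<in> S \<times> T" "(\<lambda>k. c k * (t / l) ^ k) sums f (p + t *\<^sub>R v, q)"
        unfolding eq using \<open>l > 0\<close> by simp_all
      then show "p + t *\<^sub>R v \<in> S" "q \<in> T" by auto
      show "(\<lambda>k. c k / l ^ k * t ^ k) sums f (p + t *\<^sub>R v, q)"
        using *(2) by (simp add: power_divide)
    qed
  qed (use r C in auto)
qed

section \<open>The identity theorem and uniform power series on the manifold\<close>

text \<open>The coefficients \<open>b\<close> belong to \<open>g - c\<close> expanded at
  \<open>t\<close>. Either all of them vanish, or zeros of \<open>g - c\<close> cannot accumulate at
  \<open>t\<close>. The second alternative uses the punctured filter because \<open>g t = c\<close>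
  remains possible.\<close>

lemma power_series_identity_dichotomy:
  fixes g :: "real \<Rightarrow> real"
  assumes r: "r > 0" and g: "\<And>s. \<bar>s\<bar> < r \<Longrightarrow> (\<lambda>k. a k * s ^ k) sums g (t + s)"
  shows "(\<forall>\<^sub>F s in nhds t. g s = c) \<or> (\<forall>\<^sub>F s in at t. g s \<noteq> c)"
proof -
  define b where "b k = (if k = 0 then a 0 - c else a k)" for k
  define f where "f s = g (t + s) - c" for s
  have b: "(\<lambda>k. b k * s ^ k) sums f s" if "\<bar>s\<bar> < r" for s
  proof -
    have "(\<lambda>k. if k = 0 then c else 0) sums c"
      using sums_single[of 0 "\<lambda>_. c"] by simp
    then have "(\<lambda>k. a k * s ^ k - (if k = 0 then c else 0)) sums f s"
      unfolding f_def by (rule sums_diff[OF g[OF that]])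
    also have "(\<lambda>k. a k * s ^ k - (if k = 0 then c else 0)) = (\<lambda>k. b k * s ^ k)"
      by (auto simp: fun_eq_iff b_def)
    finally show ?thesis .
  qed
  show ?thesis
  proof (cases "\<forall>k. b k = 0")
    case True
    then have "f s = 0" if "\<bar>s\<bar> < r" for s
      using sums_unique2[OF b[OF that], of 0] by simp
    from this[of "s - t" for s] have "g s = c" if "\<bar>s - t\<bar> < r" for s
      using that by (simp add: f_def)
    then have "\<forall>\<^sub>F s in nhds t. g s = c"
      using r by (auto simp: eventually_nhds_metric dist_real_def)
    then show ?thesis ..
  next
    case False
    then obtain m where m: "b m \<noteq> 0" by blast
    have "\<forall>\<^sub>F s in at 0. f s \<noteq> 0"
    proof (cases "b 0 = 0")
      case True
      with m have "m > 0" by (cases m) auto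
      have "f 0 = 0" using b[of 0] r True by simp
      obtain s where "0 < s" "\<And>z. z \<in> cball 0 s - {0} \<Longrightarrow> f z \<noteq> 0"
        using powser_0_nonzero[of r 0 b f m] r b \<open>f 0 = 0\<close> m \<open>m > 0\<close> by auto
      then show ?thesis
        unfolding eventually_at by (intro exI[of _ s]) (auto simp: dist_real_def)
    next
      case False
      have "(f \<longlongrightarrow> b 0) (at 0)"
        using powser_limit_0[of r b f] r b by simp
      then show ?thesis using False by (rule tendsto_imp_eventually_ne)
    qed
    then have "\<forall>\<^sub>F s in at t. g s \<noteq> c"
      unfolding at_to_0[of t] eventually_filtermap by (simp add: f_def add.commute)
    then show ?thesis ..
  qed
qed

text \<open>The two alternatives of the dichotomy define disjoint open sets that cover the interval.
  Connectedness leaves only the one that contains 0.\<close>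

lemma power_series_identity_Icc:
  fixes g :: "real \<Rightarrow> real"
  assumes ser: "\<And>t. t \<in> {0..1} \<Longrightarrow> \<exists>r>0. \<exists>a. \<forall>s. \<bar>s\<bar> < r \<longrightarrow> (\<lambda>k. a k * s ^ k) sums g (t + s)"
    and 0: "\<forall>\<^sub>F s in nhds 0. g s = c"
  shows "g 1 = c"
proof -
  define P where "P = {t. \<forall>\<^sub>F s in nhds t. g s = c}"
  define Q where "Q = {t. \<forall>\<^sub>F s in at t. g s \<noteq> c}"
  have "open P"
    unfolding open_subopen[of P]
  proof
    fix t assume "t \<in> P"
    then obtain S where "open S" "t \<in> S" "\<And>s. s \<in> S \<Longrightarrow> g s = c"
      by (auto simp: P_def eventually_nhds)
    then show "\<exists>T. open T \<and> t \<in> T \<and> T \<subseteq> P"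
      unfolding P_def eventually_nhds by blast
  qed
  have "open Q"
    unfolding open_subopen[of Q]
  proof
    fix t assume "t \<in> Q"
    then obtain S where S: "open S" "t \<in> S" "\<And>s. s \<in> S \<Longrightarrow> s \<noteq> t \<Longrightarrow> g s \<noteq> c"
      by (auto simp: Q_def eventually_at_topological)
    have "s \<in> Q" if "s \<in> S" for s
    proof (cases "s = t")
      case False
      have "open (S - {t})" using S(1) by (rule open_Diff) simp
      then show ?thesis
        using S that False unfolding Q_def eventually_at_topological by blast
    qed (use \<open>t \<in> Q\<close> in simp)
    then show "\<exists>T. open T \<and> t \<in> T \<and> T \<subseteq> Q" using S by blast
  qed
  have "P \<inter> Q = {}"
  proof -
    have False if "t \<in> P" "t \<in> Q" for t
    proof -
      have "\<forall>\<^sub>F s in at t. g s = c"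
        using that(1) by (auto simp: P_def eventually_at_filter elim: eventually_mono)
      then have "\<forall>\<^sub>F s in at t. False"
        using that(2) unfolding Q_def mem_Collect_eq by eventually_elim simp
      then show False by simp
    qed
    then show ?thesis by blast
  qed
  moreover have PQ: "{0..1} \<subseteq> P \<union> Q"
  proof
    fix t :: real assume "t \<in> {0..1}"
    then obtain r a where "r > 0" "\<And>s. \<bar>s\<bar> < r \<Longrightarrow> (\<lambda>k. a k * s ^ k) sums g (t + s)"
      using ser by blast
    from power_series_identity_dichotomy[OF this, of c] show "t \<in> P \<union> Q"
      by (simp add: P_def Q_def)
  qed
  moreover have "0 \<in> P \<inter> {0..1}" using 0 by (simp add: P_def)
  ultimately have "Q \<inter> {0..1} = {}"
    using connectedD[OF connected_Icc[of 0 "1::real"] \<open>open P\<close> \<open>open Q\<close>] by blast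
  moreover have "1 \<in> {0..1::real}" by simp
  ultimately have "1 \<in> P" using PQ by blast
  then show ?thesis unfolding P_def by (auto simp: eventually_nhds)
qed

context smooth_kernel
begin

text \<open>This is weaker than analyticity, but it suffices for the identity theorem and is easily seen to
  pass to integrals of families.\<close>

definition line_analytic :: "('a \<Rightarrow> real) \<Rightarrow> bool" where
  "line_analytic f \<longleftrightarrow> (\<forall>(U, \<phi>)\<in>A. \<forall>p\<in>\<phi> ` U. \<forall>v. \<exists>r>0. \<exists>a. \<forall>t. \<bar>t\<bar> < r \<longrightarrow>
     (\<lambda>k. a k * t ^ k) sums f (inv_into U \<phi> (p + t *\<^sub>R v)))"

lemma line_analyticI:
  assumes "\<And>U \<phi> p v. (U, \<phi>) \<in> A \<Longrightarrow> p \<in> \<phi> ` U \<Longrightarrow> \<exists>r>0. \<exists>a. \<forall>t. \<bar>t\<bar> < r \<longrightarrow>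
     (\<lambda>k. a k * t ^ k) sums f (inv_into U \<phi> (p + t *\<^sub>R v))"
  shows "line_analytic f"
  using assms unfolding line_analytic_def by blast

text \<open>The interior of the level set is shown to be closed. Near a limit point, any point of a
  chart ball is joined by a segment to a point of the interior, and the one-dimensional identity
  theorem applies along the segment, which stays in the ball by convexity.\<close>

lemma line_analytic_identity:
  assumes conn: "connected (UNIV :: 'a set)" and f: "line_analytic f"
    and V: "open V" "V \<noteq> {}" "\<And>x. x \<in> V \<Longrightarrow> f x = c"
  shows "f x = c"
proof -
  define \<Omega> where "\<Omega> = interior {x. f x = c}"
  have "V \<subseteq> \<Omega>" unfolding \<Omega>_def using V by (intro interior_maximal) auto
  have "closure \<Omega> \<subseteq> \<Omega>"
  proof
    fix x assume x: "x \<in> closure \<Omega>"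
    obtain U \<phi> where U: "(U, \<phi>) \<in> A" "x \<in> U"
      using smooth_atlasD(2)[OF atlas] by metis
    let ?i = "inv_into U \<phi>"
    obtain r where r: "r > 0" "ball (\<phi> x) r \<subseteq> \<phi> ` U"
      using chartD(2)[OF U(1)] U(2) by (meson imageI open_contains_ball)
    define W where "W = {y \<in> U. \<phi> y \<in> ball (\<phi> x) r}"
    have "open W"
      unfolding W_def
      using continuous_open_preimage[OF chartD(3,1)[OF U(1)], of "ball (\<phi> x) r"]
      by (simp add: vimage_def Int_def)
    moreover have "x \<in> W" using U r by (simp add: W_def)
    ultimately obtain z where z: "z \<in> \<Omega>" "z \<in> W"
      using x by (auto simp: closure_iff_nhds_not_empty)
    have iz: "?i (\<phi> z) = z" using z chartD(5)[OF U(1)] by (simp add: W_def)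
    have "f w = c" if "w \<in> W" for w
    proof -
      define v where "v = \<phi> w - \<phi> z"
      define g where "g t = f (?i (\<phi> z + t *\<^sub>R v))" for t
      have line: "\<phi> z + t *\<^sub>R v \<in> ball (\<phi> x) r" if "t \<in> {0..1}" for t
      proof -
        have "(1 - t) *\<^sub>R \<phi> z + t *\<^sub>R \<phi> w \<in> ball (\<phi> x) r"
          using that z \<open>w \<in> W\<close> by (intro convexD[OF convex_ball]) (auto simp: W_def)
        then show ?thesis by (simp add: v_def algebra_simps)
      qed
      have "g 1 = c"
      proof (rule power_series_identity_Icc)
        fix t :: real assume "t \<in> {0..1}"
        then have "\<phi> z + t *\<^sub>R v \<in> \<phi> ` U" using line r by blast
        then obtain e a where "e > 0" "\<And>s. \<bar>s\<bar> < e \<Longrightarrow>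
            (\<lambda>k. a k * s ^ k) sums f (?i (\<phi> z + t *\<^sub>R v + s *\<^sub>R v))"
          using f U(1) unfolding line_analytic_def by blast
        then show "\<exists>r>0. \<exists>a. \<forall>s. \<bar>s\<bar> < r \<longrightarrow> (\<lambda>k. a k * s ^ k) sums g (t + s)"
          unfolding g_def scaleR_add_left add.assoc by blast
      next
        have "open {p \<in> \<phi> ` U. ?i p \<in> \<Omega>}"
          by (intro open_inv_into_chart is_chart U) (simp add: \<Omega>_def)
        moreover have "\<phi> z + 0 *\<^sub>R v \<in> {p \<in> \<phi> ` U. ?i p \<in> \<Omega>}"
          using z iz by (auto simp: W_def)
        moreover have "((\<lambda>t. \<phi> z + t *\<^sub>R v) \<longlongrightarrow> \<phi> z + 0 *\<^sub>R v) (nhds 0)"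
          by (intro tendsto_intros) (simp add: filterlim_ident)
        ultimately have "\<forall>\<^sub>F t in nhds 0. \<phi> z + t *\<^sub>R v \<in> {p \<in> \<phi> ` U. ?i p \<in> \<Omega>}"
          by (rule topological_tendstoD[rotated 1])
        then show "\<forall>\<^sub>F t in nhds 0. g t = c"
        proof eventually_elim
          case (elim t)
          then have "?i (\<phi> z + t *\<^sub>R v) \<in> {x. f x = c}"
            unfolding \<Omega>_def using interior_subset by blast
          then show ?case by (simp add: g_def)
        qed
      qed
      moreover have "?i (\<phi> w) = w" using \<open>w \<in> W\<close> chartD(5)[OF U(1)] by (simp add: W_def)
      ultimately show ?thesis by (simp add: g_def v_def)
    qed
    then show "x \<in> \<Omega>"
      unfolding \<Omega>_def using \<open>open W\<close> \<open>x \<in> W\<close> by (intro interiorI[of W]) auto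
  qed
  then have "closed \<Omega>" by (simp add: closure_subset_eq)
  moreover have "open \<Omega>" by (simp add: \<Omega>_def)
  ultimately have "\<Omega> = {} \<or> \<Omega> = UNIV"
    using conn connected_clopen[of "UNIV :: 'a set"] by (auto simp: closedin_closed_eq)
  then have "x \<in> \<Omega>" using \<open>V \<subseteq> \<Omega>\<close> V(2) by auto
  then show ?thesis unfolding \<Omega>_def using interior_subset by blast
qed

text \<open>Compactness makes the radius and the coefficient bounds uniform in the second argument, so
  that the series can be integrated termwise.\<close>

lemma uniform_line_power_series:
  assumes an: "analytic_function (prod_atlas A A) (\<lambda>(x, y). D x y)"
    and U: "(U, \<phi>) \<in> A" and p: "p \<in> \<phi> ` U"
  obtains r C where "r > 0" "C \<ge> 0"
    "\<forall>y. \<exists>c. (\<forall>k. \<bar>c k\<bar> \<le> C / r ^ k) \<and>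
        (\<forall>t. \<bar>t\<bar> < r \<longrightarrow> (\<lambda>k. c k * t ^ k) sums D (inv_into U \<phi> (p + t *\<^sub>R v)) y)"
proof -
  let ?i = "inv_into U \<phi>"
  define Q where "Q r C y \<longleftrightarrow> (\<exists>c. (\<forall>k. \<bar>c k\<bar> \<le> C / r ^ k) \<and>
        (\<forall>t. \<bar>t\<bar> < r \<longrightarrow> (\<lambda>k. c k * t ^ k) sums D (?i (p + t *\<^sub>R v)) y))" for r C :: real and y
  \<comment> \<open>The local estimates are phrased as a property of sets that is stable under
    finite unions, so that a finite subcover can be used; the next fact allows a smaller radius and
    a larger bound.\<close>
  define good where "good W \<longleftrightarrow> (\<exists>r C. r > 0 \<and> C \<ge> 0 \<and> (\<forall>y\<in>W. Q r C y))" for W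
  have mono: "Q r' C' y" if Q: "Q r C y" and r: "0 < r'" "r' \<le> r" and C: "0 \<le> C" "C \<le> C'" for r C r' C' y
  proof -
    obtain c where c: "\<And>k. \<bar>c k\<bar> \<le> C / r ^ k"
      "\<And>t. \<bar>t\<bar> < r \<Longrightarrow> (\<lambda>k. c k * t ^ k) sums D (?i (p + t *\<^sub>R v)) y"
      using Q unfolding Q_def by blast
    have "\<bar>c k\<bar> \<le> C' / r' ^ k" for k
      using c(1)[of k] r C by (elim order_trans) (intro frac_le power_mono, auto)
    moreover have "(\<lambda>k. c k * t ^ k) sums D (?i (p + t *\<^sub>R v)) y" if "\<bar>t\<bar> < r'" for t
      using c(2)[of t] that r by simp
    ultimately show ?thesis unfolding Q_def by blast
  qed
  have "\<exists>W r C. open W \<and> y0 \<in> W \<and> r > 0 \<and> C \<ge> 0 \<and> (\<forall>y\<in>W. Q r C y)" for y0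
  proof -
    obtain V \<psi> where V: "(V, \<psi>) \<in> A" "y0 \<in> V"
      using smooth_atlasD(2)[OF atlas] by metis
    have "(U \<times> V, map_prod \<phi> \<psi>) \<in> prod_atlas A A"
      using U V by (auto simp: prod_atlas_def)
    then have "real_analytic_on ((\<lambda>(x, y). D x y) \<circ> inv_into (U \<times> V) (map_prod \<phi> \<psi>)) (\<phi> ` U \<times> \<psi> ` V)"
      using an unfolding analytic_function_def by (fastforce simp: map_prod_surj_on)
    then obtain r C where rC: "r > 0" "C \<ge> 0"
      and ser: "\<forall>q\<in>ball (\<psi> y0) r. \<exists>c. (\<forall>k. \<bar>c k\<bar> \<le> C / r ^ k) \<and>
        (\<forall>t. \<bar>t\<bar> < r \<longrightarrow> p + t *\<^sub>R v \<in> \<phi> ` U \<and> q \<in> \<psi> ` V \<and> (\<lambda>k. c k * t ^ k) sums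
          ((\<lambda>(x, y). D x y) \<circ> inv_into (U \<times> V) (map_prod \<phi> \<psi>)) (p + t *\<^sub>R v, q))"
      using chartD(2)[OF U] p chartD(2)[OF V(1)] imageI[OF V(2)]
      by (rule real_analytic_line_power_series)
    define W where "W = {y \<in> V. \<psi> y \<in> ball (\<psi> y0) r}"
    have "open W"
      unfolding W_def
      using continuous_open_preimage[OF chartD(3,1)[OF V(1)], of "ball (\<psi> y0) r"]
      by (simp add: vimage_def Int_def)
    moreover have "y0 \<in> W" using V rC by (simp add: W_def)
    moreover have "Q r C y" if "y \<in> W" for y
    proof -
      have y: "y \<in> V" "\<psi> y \<in> ball (\<psi> y0) r" using that by (auto simp: W_def)
      obtain c where c: "\<And>k. \<bar>c k\<bar> \<le> C / r ^ k"
        "\<And>t. \<bar>t\<bar> < r \<Longrightarrow> p + t *\<^sub>R v \<in> \<phi> ` U \<and> \<psi> y \<in> \<psi> ` V \<and> (\<lambda>k. c k * t ^ k) sums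
          ((\<lambda>(x, y). D x y) \<circ> inv_into (U \<times> V) (map_prod \<phi> \<psi>)) (p + t *\<^sub>R v, \<psi> y)"
        using bspec[OF ser y(2)] by blast
      have "(\<lambda>k. c k * t ^ k) sums D (?i (p + t *\<^sub>R v)) y" if "\<bar>t\<bar> < r" for t
      proof -
        have "inv_into (U \<times> V) (map_prod \<phi> \<psi>) (p + t *\<^sub>R v, \<psi> y) = (?i (p + t *\<^sub>R v), y)"
          using inv_into_map_prod[OF chartD(5)[OF U] chartD(5)[OF V(1)], of "p + t *\<^sub>R v" "\<psi> y"]
            c(2)[OF that] y(1) chartD(5)[OF V(1)] by simp
        then show ?thesis using c(2)[OF that] by simp
      qed
      then show ?thesis unfolding Q_def using c(1) by blast
    qed
    ultimately show ?thesis using rC by blast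
  qed
  then have cover: "\<exists>W. open W \<and> y0 \<in> W \<and> good W" for y0
    unfolding good_def by meson
  have good_Un: "good (W \<union> W')" if W: "good W" and W': "good W'" for W W'
  proof -
    obtain r C where r: "r > 0" "C \<ge> 0" "\<And>y. y \<in> W \<Longrightarrow> Q r C y"
      using W unfolding good_def by meson
    obtain r' C' where r': "r' > 0" "C' \<ge> 0" "\<And>y. y \<in> W' \<Longrightarrow> Q r' C' y"
      using W' unfolding good_def by meson
    have "Q (min r r') (max C C') y" if "y \<in> W \<union> W'" for y
      using that
    proof
      assume "y \<in> W"
      from r(3)[OF this] show ?thesis by (rule mono) (use r r' in auto)
    next
      assume "y \<in> W'"
      from r'(3)[OF this] show ?thesis by (rule mono) (use r r' in auto)
    qed
    moreover have "min r r' > 0" "max C C' \<ge> 0" using r r' by auto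
    ultimately show ?thesis unfolding good_def by blast
  qed
  have "UNIV \<subseteq> \<Union>{W. open W \<and> good W}"
    using cover by blast
  then obtain \<W> where \<W>: "\<W> \<subseteq> {W. open W \<and> good W}" "finite \<W>" "UNIV \<subseteq> \<Union>\<W>"
    by (rule compactE[OF compact_UNIV]) auto
  have "good {}" unfolding good_def by (intro exI[of _ 1] exI[of _ 0]) simp
  from \<W>(2,1) have "good (\<Union>\<W>)"
    by induction (simp_all add: \<open>good {}\<close> good_Un)
  moreover have "\<Union>\<W> = UNIV" using \<W>(3) by blast
  ultimately obtain r C where "r > 0" "C \<ge> 0" "\<And>y. Q r C y"
    unfolding good_def by auto
  then show ?thesis unfolding Q_def by (intro that[of r C] allI)
qed

lemma line_analytic_slice:
  assumes an: "analytic_function (prod_atlas A A) (\<lambda>(x, y). D x y)"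
  shows "line_analytic (\<lambda>x. D x y)"
proof (rule line_analyticI)
  show "\<exists>r>0. \<exists>a. \<forall>t. \<bar>t\<bar> < r \<longrightarrow> (\<lambda>k. a k * t ^ k) sums D (inv_into U \<phi> (p + t *\<^sub>R v)) y"
    if U: "(U, \<phi>) \<in> A" and p: "p \<in> \<phi> ` U" for U \<phi> p v
    using uniform_line_power_series[OF an U p, of v] by metis
qed

end

section \<open>Analytic integrals and generic timelikeness\<close>

context causal
begin

text \<open>The coefficients are later picked by choice, so their measurability in \<open>y\<close>
  has to be recovered from the sums. The \<open>k\<close>-th one is the limit of the sum minus the
  earlier terms, divided by the \<open>k\<close>-th power of a step size tending to 0.\<close>

lemma power_series_coefficient_measurable:
  fixes c :: "'a \<Rightarrow> nat \<Rightarrow> real"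
  assumes r: "r > 0" and ser: "\<And>y t. \<bar>t\<bar> < r \<Longrightarrow> (\<lambda>k. c y k * t ^ k) sums G t y"
    and G: "\<And>t. \<bar>t\<bar> < r \<Longrightarrow> G t \<in> borel_measurable borel"
  shows "(\<lambda>y. c y k) \<in> borel_measurable borel"
proof (induction k rule: less_induct)
  case (less k)
  define s where "s n = r / 2 / real (Suc n)" for n
  have s: "0 < s n" "\<bar>s n\<bar> < r" for n
  proof -
    show "0 < s n" using r by (simp add: s_def)
    have "s n \<le> r / 2" using r by (simp add: s_def divide_le_eq)
    then show "\<bar>s n\<bar> < r" using r \<open>0 < s n\<close> by simp
  qed
  have s0: "filterlim s (at 0) sequentially"
  proof -
    have "s \<longlonglongrightarrow> 0"
      unfolding s_def by (rule LIMSEQ_Suc[OF lim_const_over_n])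
    then show ?thesis
      using s(1) by (auto simp: filterlim_at less_imp_neq[THEN not_sym] intro!: always_eventually)
  qed
  show ?case
  proof (rule borel_measurable_LIMSEQ_real)
    show "(\<lambda>n. (G (s n) y - (\<Sum>j<k. c y j * s n ^ j)) / s n ^ k) \<longlonglongrightarrow> c y k" for y
    proof (rule filterlim_compose[OF _ s0])
      have "((\<lambda>t. (G t y - (\<Sum>j<k. c y j * t ^ j)) / t ^ k) \<longlongrightarrow> c y (0 + k)) (at 0)"
      proof (rule powser_limit_0_strong[OF r])
        fix t :: real assume t: "t \<noteq> 0" "norm t < r"
        have "(\<lambda>j. c y (j + k) * t ^ (j + k)) sums (G t y - (\<Sum>j<k. c y j * t ^ j))"
          using ser[of t y] t by (intro sums_split_initial_segment) auto
        then have "(\<lambda>j. c y (j + k) * t ^ (j + k) / t ^ k) sums ((G t y - (\<Sum>j<k. c y j * t ^ j)) / t ^ k)"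
          by (rule sums_divide)
        then show "(\<lambda>j. c y (j + k) * t ^ j) sums ((G t y - (\<Sum>j<k. c y j * t ^ j)) / t ^ k)"
          using t by (simp add: power_add)
      qed
      then show "((\<lambda>t. (G t y - (\<Sum>j<k. c y j * t ^ j)) / t ^ k) \<longlongrightarrow> c y k) (at 0)" by simp
    qed
    show "(\<lambda>y. (G (s n) y - (\<Sum>j<k. c y j * s n ^ j)) / s n ^ k) \<in> borel_measurable borel" for n
      using less G[OF s(2)[of n]]
      by (intro borel_measurable_divide borel_measurable_diff borel_measurable_sum
          borel_measurable_times borel_measurable_const) auto
  qed
qed

text \<open>The coefficient bounds, uniform in \<open>y\<close>, dominate the terms by a geometric
  series of ratio \<open>\<bar>t\<bar> / r\<close>. Hence sum and integral may be exchanged, and the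
  new coefficients are the integrals of the old ones.\<close>

lemma line_analytic_integral:
  assumes an: "analytic_function (prod_atlas A A) (\<lambda>(x, y). D x y)" and w: "bounded_borel w"
  shows "line_analytic (\<lambda>x. \<integral>y. w y * D x y \<partial>\<rho>)"
proof (rule line_analyticI)
  fix U \<phi> p v
  assume U: "(U, \<phi>) \<in> A" and p: "p \<in> \<phi> ` U"
  show "\<exists>r>0. \<exists>a. \<forall>t. \<bar>t\<bar> < r \<longrightarrow> (\<lambda>k. a k * t ^ k) sums (\<integral>y. w y * D (inv_into U \<phi> (p + t *\<^sub>R v)) y \<partial>\<rho>)"
  proof -
    obtain r C where r: "r > 0" and C: "C \<ge> 0" and
      ser: "\<forall>y. \<exists>c. (\<forall>k. \<bar>c k\<bar> \<le> C / r ^ k) \<and>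
          (\<forall>t. \<bar>t\<bar> < r \<longrightarrow> (\<lambda>k. c k * t ^ k) sums D (inv_into U \<phi> (p + t *\<^sub>R v)) y)"
      by (rule uniform_line_power_series[OF an U p])
    from choice[OF ser] obtain c where c: "\<And>y k. \<bar>c y k\<bar> \<le> C / r ^ k"
      "\<And>y t. \<bar>t\<bar> < r \<Longrightarrow> (\<lambda>k. c y k * t ^ k) sums D (inv_into U \<phi> (p + t *\<^sub>R v)) y"
      by blast
    obtain Cw where Cw: "\<And>y. \<bar>w y\<bar> \<le> Cw" using w by (auto simp: bounded_borel_def)
    have "Cw \<ge> 0" using Cw[of undefined] by linarith
    have "(\<lambda>y. c y k) \<in> borel_measurable borel" for k
    proof (rule power_series_coefficient_measurable[OF r c(2)])
      show "D (inv_into U \<phi> (p + t *\<^sub>R v)) \<in> borel_measurable borel" for t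
        using bounded_borel_kernel(2)[OF contD] by (rule bounded_borel_measurable)
    qed
    then have bmc: "bounded_borel (\<lambda>y. c y k)" for k
      unfolding bounded_borel_def using c(1)[of _ k] by blast
    have ser: "(\<lambda>k. (\<integral>y. w y * c y k \<partial>\<rho>) * t ^ k) sums (\<integral>y. w y * D (inv_into U \<phi> (p + t *\<^sub>R v)) y \<partial>\<rho>)"
      if t: "\<bar>t\<bar> < r" for t
    proof -
      define f where "f k y = w y * c y k * t ^ k" for k y
      have bmf: "bounded_borel (f k)" for k
        unfolding f_def by (intro bounded_borel_mult w bmc bounded_borel_const)
      have le: "norm (f k y) \<le> Cw * C * (\<bar>t\<bar> / r) ^ k" for k y
      proof -
        have "norm (f k y) = \<bar>w y\<bar> * \<bar>c y k\<bar> * \<bar>t\<bar> ^ k"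
          by (simp add: f_def abs_mult power_abs)
        also have "\<dots> \<le> Cw * (C / r ^ k) * \<bar>t\<bar> ^ k"
          using Cw c(1) \<open>Cw \<ge> 0\<close> by (intro mult_right_mono mult_mono) auto
        finally show ?thesis by (simp add: power_divide)
      qed
      have geo: "summable (\<lambda>k. Cw * C * (\<bar>t\<bar> / r) ^ k)"
        using t r by (intro summable_mult summable_geometric) auto
      have "(\<lambda>k. \<integral>y. f k y \<partial>\<rho>) sums (\<integral>y. (\<Sum>k. f k y) \<partial>\<rho>)"
      proof (rule sums_integral)
        show "integrable \<rho> (f k)" for k by (intro bounded_borel_integrable bmf)
        show "AE y in \<rho>. summable (\<lambda>k. norm (f k y))"
          using le by (intro AE_I2 summable_comparison_test'[OF geo]) auto
        have "(\<integral>y. norm (f k y) \<partial>\<rho>) \<le> Cw * C * (\<bar>t\<bar> / r) ^ k" for k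
        proof -
          have "(\<integral>y. norm (f k y) \<partial>\<rho>) \<le> (\<integral>y. Cw * C * (\<bar>t\<bar> / r) ^ k \<partial>\<rho>)"
            by (intro integral_mono integrable_norm bounded_borel_integrable bmf bounded_borel_const le)
          then show ?thesis by (simp add: prob_space)
        qed
        then show "summable (\<lambda>k. \<integral>y. norm (f k y) \<partial>\<rho>)"
          by (intro summable_comparison_test'[OF geo, of 0]) (simp add: integral_nonneg_AE)
      qed
      moreover have "(\<Sum>k. f k y) = w y * D (inv_into U \<phi> (p + t *\<^sub>R v)) y" for y
        using sums_mult[OF c(2)[OF t, of y], of "w y"] unfolding f_def
        by (intro sums_unique[symmetric]) (simp add: mult.assoc)
      ultimately show ?thesis by (simp add: f_def)
    qed
    show ?thesis
    proof (rule exI[of _ r], rule conjI[OF r], rule exI, intro allI impI)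
      show "(\<lambda>k. (\<integral>y. w y * c y k \<partial>\<rho>) * t ^ k) sums (\<integral>y. w y * D (inv_into U \<phi> (p + t *\<^sub>R v)) y \<partial>\<rho>)"
        if "\<bar>t\<bar> < r" for t
        using that by (rule ser)
    qed
  qed
qed

text \<open>Vanishing on a nonempty open set would spread to the whole manifold by the identity
  theorem and contradict \<open>D y y = 1\<close>.\<close>

lemma slice_not_zero_on_open:
  assumes conn: "connected (UNIV :: 'a set)"
    and an: "analytic_function (prod_atlas A A) (\<lambda>(x, y). D x y)"
    and "open V" "V \<noteq> {}"
  shows "\<exists>x\<in>V. D x y \<noteq> 0"
proof (rule ccontr)
  assume "\<not> (\<exists>x\<in>V. D x y \<noteq> 0)"
  then have "D x y = 0" if "x \<in> V" for x using that by blast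
  with line_analytic_identity[OF conn line_analytic_slice[OF an, of y] assms(3,4), of 0 y]
  have "D y y = 0" by blast
  then show False by (simp add: diagD)
qed

text \<open>The interiors of the two sign regions cover \<open>V\<close>, and they are disjoint
  because the slice vanishes on no nonempty open set. So the sign, known locally in neighbourhoods
  depending on \<open>y\<close>, is fixed on all of \<open>V\<close>, which is the same for every
  \<open>y\<close>.\<close>

lemma sign_on_connected:
  assumes conn: "connected (UNIV :: 'a set)"
    and an: "analytic_function (prod_atlas A A) (\<lambda>(x, y). D x y)"
    and V: "connected V" "V \<subseteq> interior (measure_support \<rho>)" and y: "y \<in> measure_support \<rho>"
  shows "(\<forall>x\<in>V. D x y \<ge> 0) \<or> (\<forall>x\<in>V. D x y \<le> 0)"
proof -
  define P where "P = interior {x. D x y \<ge> 0}"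
  define N where "N = interior {x. D x y \<le> 0}"
  have op: "open P" "open N" by (auto simp: P_def N_def)
  have PN: "V \<subseteq> P \<union> N"
  proof
    fix x assume "x \<in> V"
    then obtain W where W: "open W" "x \<in> W" "(\<forall>v\<in>W. D v y \<ge> 0) \<or> (\<forall>v\<in>W. D v y \<le> 0)"
      using locally_no_sign_change[OF subsetD[OF V(2)] y] by metis
    from W(3) show "x \<in> P \<union> N"
    proof
      assume "\<forall>v\<in>W. D v y \<ge> 0"
      then have "x \<in> P" unfolding P_def by (intro interiorI[OF W(1,2)]) auto
      then show ?thesis ..
    next
      assume "\<forall>v\<in>W. D v y \<le> 0"
      then have "x \<in> N" unfolding N_def by (intro interiorI[OF W(1,2)]) auto
      then show ?thesis ..
    qed
  qed
  have P: "D x y \<ge> 0" if "x \<in> P" for x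
    using subsetD[OF interior_subset that[unfolded P_def]] by simp
  have N: "D x y \<le> 0" if "x \<in> N" for x
    using subsetD[OF interior_subset that[unfolded N_def]] by simp
  have "P \<inter> N = {}"
  proof (rule ccontr)
    assume "P \<inter> N \<noteq> {}"
    from slice_not_zero_on_open[OF conn an open_Int[OF op] this, of y]
    obtain x where "x \<in> P" "x \<in> N" "D x y \<noteq> 0" by blast
    then show False using P[of x] N[of x] by simp
  qed
  then have "P \<inter> V = {} \<or> N \<inter> V = {}"
    using connectedD[OF V(1) op _ PN] by blast
  then have "V \<subseteq> P \<or> V \<subseteq> N" using PN by blast
  then show ?thesis using P N by blast
qed

lemma generically_timelike_analytic:
  assumes conn: "connected (UNIV :: 'a set)"
    and an: "analytic_function (prod_atlas A A) (\<lambda>(x, y). D x y)"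
    and int: "interior (measure_support \<rho>) \<noteq> {}"
  shows "generically_timelike D \<rho>"
proof -
  let ?S = "measure_support \<rho>"
  obtain x0 where x0: "x0 \<in> interior ?S" using int by blast
  obtain U \<phi> where U: "(U, \<phi>) \<in> A" "x0 \<in> U"
    using smooth_atlasD(2)[OF atlas] by metis
  have "\<phi> x0 \<in> chart_interior U \<phi>"
    using U x0 chartD(5)[OF U(1)] by (simp add: chart_interior_def)
  then obtain r where r: "r > 0" "ball (\<phi> x0) r \<subseteq> chart_interior U \<phi>"
    using open_chart_interior[OF U(1)] by (meson open_contains_ball)
  then have rU: "ball (\<phi> x0) r \<subseteq> \<phi> ` U" by (auto simp: chart_interior_def)
  \<comment> \<open>The image of a chart ball is connected as well as open, so both the sign lemma
    and the identity theorem apply to it.\<close>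
  define V where "V = inv_into U \<phi> ` ball (\<phi> x0) r"
  have "connected V"
    unfolding V_def
    by (intro connected_continuous_image continuous_on_subset[OF chartD(4)[OF U(1)] rU]) auto
  have Vsub: "V \<subseteq> interior ?S" using r by (auto simp: V_def chart_interior_def)
  have V_eq: "V = U \<inter> \<phi> -` ball (\<phi> x0) r"
  proof
    show "V \<subseteq> U \<inter> \<phi> -` ball (\<phi> x0) r"
      using rU by (force simp: V_def inv_into_into f_inv_into_f)
    show "U \<inter> \<phi> -` ball (\<phi> x0) r \<subseteq> V"
      unfolding V_def using chartD(5)[OF U(1)] by (force intro: inv_into_f_f[symmetric])
  qed
  then have "open V"
    using continuous_open_preimage[OF chartD(3,1)[OF U(1)]] by simp
  have "x0 \<in> V"
    using V_eq U(2) r by simp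
  define P where "P = {y \<in> ?S. \<forall>x\<in>V. D x y \<ge> 0}"
  have "closed P"
  proof -
    have "P = ?S \<inter> (\<Inter>x\<in>V. D x -` {0..})" by (auto simp: P_def)
    moreover have "closed (D x -` {0..})" for x
      using continuous_kernel_slice(2)[OF contD] by (intro closed_vimage) auto
    ultimately show ?thesis
      using closed_measure_support[OF sets_eq] by (auto intro!: closed_Int closed_INT)
  qed
  define w :: "'a \<Rightarrow> real" where "w = indicator P"
  have w: "bounded_borel w" unfolding w_def using \<open>closed P\<close> by (intro bounded_borel_indicator) simp
  have w_le: "w y * D x y \<le> L x y" for x y
    using L_ge[of x y] by (simp add: w_def indicator_def)
  define h where "h x = (\<integral>y. w y * D x y \<partial>\<rho>)" for x
  have bounded_borel_wD: "bounded_borel (\<lambda>y. w y * D x y)" for x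
    by (intro bounded_borel_mult w bounded_borel_kernel contD)
  have "h x = action D \<rho>" if "x \<in> V" for x
  proof -
    have "h x = potential x"
      unfolding h_def potential_def
    proof (rule integral_cong_AE)
      show "AE y in \<rho>. w y * D x y = L x y"
        using AE_measure_support[OF sets_eq]
      proof eventually_elim
        case (elim y)
        show ?case
        proof (cases "y \<in> P")
          case True
          then show ?thesis using that by (simp add: w_def P_def lagrangian_def)
        next
          case False
          then have "D x y \<le> 0"
            using sign_on_connected[OF conn an \<open>connected V\<close> Vsub elim] elim that by (auto simp: P_def)
          then show ?thesis using False by (simp add: w_def lagrangian_def)
        qed
      qed
    qed (auto intro!: borel_measurable_integrable bounded_borel_integrable bounded_borel_wD bounded_borel_L)
    also have "\<dots> = action D \<rho>"
      using that Vsub interior_subset by (intro potential_constant) blast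
    finally show ?thesis .
  qed
  \<comment> \<open>The identity theorem extends the constant value from \<open>V\<close> to the
    whole manifold.\<close>
  then have h: "h x = action D \<rho>" for x
    using line_analytic_identity[OF conn line_analytic_integral[OF an w] \<open>open V\<close>] \<open>x0 \<in> V\<close>
    unfolding h_def by blast
  \<comment> \<open>On the support both integrals equal the action. Since one integrand dominates
    the other, they agree almost everywhere.\<close>
  have AE_eq: "AE y in \<rho>. L x y = w y * D x y" if "x \<in> ?S" for x
  proof -
    have "(\<integral>y. L x y - w y * D x y \<partial>\<rho>) = potential x - h x"
      unfolding potential_def h_def using bounded_borel_wD bounded_borel_L
      by (intro Bochner_Integration.integral_diff bounded_borel_integrable)
    also have "\<dots> = 0" using h potential_constant[OF that] by simp
    finally have "(\<integral>y. L x y - w y * D x y \<partial>\<rho>) = 0" .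
    then have "AE y in \<rho>. L x y - w y * D x y = 0"
      using w_le bounded_borel_wD bounded_borel_L
      by (subst integral_nonneg_eq_0_iff_AE[symmetric]) (auto intro!: bounded_borel_integrable bounded_borel_diff)
    then show ?thesis by simp
  qed
  have D_open: "open {y. D x y > 0}" "open {y. D x y < 0}" for x
    using open_vimage[OF _ continuous_kernel_slice(2)[OF contD], of "{0<..}" x]
      open_vimage[OF _ continuous_kernel_slice(2)[OF contD], of "{..<0}" x]
    by (simp_all add: vimage_def)
  have "?S \<subseteq> P"
  proof
    fix y assume y: "y \<in> ?S"
    \<comment> \<open>Outside \<open>P\<close> the weight \<open>w\<close> vanishes while
      \<open>L y z = D y z\<close> is positive for \<open>z\<close> near \<open>y\<close>. The
      almost sure equality forbids such \<open>z\<close> in an open set around a support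
      point.\<close>
    have "\<not> (y \<notin> P \<and> D y y > 0)"
    proof (rule AE_imp_on_measure_support[OF sets_eq _ _ y, where P = "\<lambda>z. \<not> (z \<notin> P \<and> D y z > 0)"])
      show "AE z in \<rho>. \<not> (z \<notin> P \<and> D y z > 0)"
        using AE_eq[OF y]
      proof eventually_elim
        case (elim z)
        then show ?case by (auto simp: w_def lagrangian_def)
      qed
      have "{z. \<not> \<not> (z \<notin> P \<and> D y z > 0)} = - P \<inter> {z. D y z > 0}" by auto
      then show "open {z. \<not> \<not> (z \<notin> P \<and> D y z > 0)}"
        using \<open>closed P\<close> D_open by (simp add: open_Int open_Compl)
    qed
    then show "y \<in> P" by (simp add: diagD)
  qed
  \<comment> \<open>As \<open>P\<close> contains the support, the weight disappears from all
    integrals, and \<open>h\<close> becomes the function that has to be constant.\<close>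
  have AE_w: "AE y in \<rho>. w y = 1"
    using AE_measure_support[OF sets_eq] by eventually_elim (use \<open>?S \<subseteq> P\<close> in \<open>auto simp: w_def\<close>)
  have "D x y \<ge> 0" if x: "x \<in> ?S" and y: "y \<in> ?S" for x y
  proof -
    have "\<not> D x y < 0"
    proof (rule AE_imp_on_measure_support[OF sets_eq _ _ y])
      show "AE y in \<rho>. \<not> D x y < 0"
        using AE_eq[OF x] AE_w
      proof eventually_elim
        case (elim y)
        then show ?case using L_nonneg[of x y] by simp
      qed
      show "open {y. \<not> \<not> D x y < 0}" using D_open by simp
    qed
    then show ?thesis by simp
  qed
  moreover have "(\<integral>y. D x y \<partial>\<rho>) = action D \<rho>" for x
  proof -
    have "(\<integral>y. D x y \<partial>\<rho>) = h x"
      unfolding h_def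
    proof (rule integral_cong_AE)
      show "AE y in \<rho>. D x y = w y * D x y"
        using AE_w by eventually_elim simp
    qed (auto intro!: borel_measurable_integrable bounded_borel_integrable bounded_borel_wD bounded_borel_kernel(2)[OF contD])
    then show ?thesis by (simp add: h)
  qed
  ultimately show ?thesis
    unfolding generically_timelike_def using minimizing by blast
qed

end

section \<open>Both statements for an arbitrary minimizer\<close>

theorem theorem3p16:
  fixes A :: "('a::{t2_space, second_countable_topology}, 'e::euclidean_space) chart set"
    and D :: "'a \<Rightarrow> 'a \<Rightarrow> real"
  assumes "smooth_atlas A"
    and "compact (UNIV :: 'a set)"
    and "smooth_function (prod_atlas A A) (\<lambda>(x, y). D x y)"
    and "\<And>x y. D x y = D y x"
    and "\<And>x. D x x = 1"
    and "\<And>x y. y \<in> K_set D x \<Longrightarrow>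
           \<exists>c m. smooth_curve A c \<and> c 0 = x \<and> c 1 = y \<and>
             ((\<lambda>t. D (c t) y) has_real_derivative m) (at 0) \<and> m \<noteq> 0"
  shows "(connected (UNIV :: 'a set) \<and> analytic_atlas A \<and>
            analytic_function (prod_atlas A A) (\<lambda>(x, y). D x y) \<longrightarrow>
          (\<forall>\<rho>. minimizing_measure D \<rho> \<longrightarrow>
             generically_timelike D \<rho> \<or> interior (measure_support \<rho>) = {})) \<and>
         ((\<exists>\<Delta>. differential_operator A \<Delta> \<and>
             (\<forall>a x. \<Delta> (\<lambda>_. a) x = 0) \<and>
             (\<forall>x. \<forall>y\<in>I_set D x. \<Delta> (\<lambda>z. D z y) x < 0)) \<longrightarrow>
          (\<forall>\<rho>. minimizing_measure D \<rho> \<longrightarrow> interior (measure_support \<rho>) = {}))"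
proof -
  have causal: "causal A D \<rho>" if "minimizing_measure D \<rho>" for \<rho>
  proof -
    have sk: "smooth_kernel A D"
      using assms(1-3) by (rule smooth_kernel.intro)
    moreover have "minimizer D \<rho>"
      using assms(2) smooth_kernel.continuous_kernel[OF sk] assms(4,5) that by (rule minimizer.intro)
    ultimately show ?thesis
      using assms(6) by (intro causal.intro causal_axioms.intro)
  qed
  show ?thesis
  proof (intro conjI impI allI)
    fix \<rho>
    assume "connected (UNIV :: 'a set) \<and> analytic_atlas A \<and>
            analytic_function (prod_atlas A A) (\<lambda>(x, y). D x y)"
      and \<rho>: "minimizing_measure D \<rho>"
    then show "generically_timelike D \<rho> \<or> interior (measure_support \<rho>) = {}"
      using causal.generically_timelike_analytic[OF causal[OF \<rho>]] by blast
  next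
    fix \<rho>
    assume "\<exists>\<Delta>. differential_operator A \<Delta> \<and> (\<forall>a x. \<Delta> (\<lambda>_. a) x = 0) \<and>
             (\<forall>x. \<forall>y\<in>I_set D x. \<Delta> (\<lambda>z. D z y) x < 0)"
      and \<rho>: "minimizing_measure D \<rho>"
    then obtain \<Delta> where "differential_operator A \<Delta>" "\<And>a x. \<Delta> (\<lambda>_. a) x = 0"
      "\<And>x y. y \<in> I_set D x \<Longrightarrow> \<Delta> (\<lambda>z. D z y) x < 0"
      by blast
    then show "interior (measure_support \<rho>) = {}"
      by (rule causal.interior_support_empty_differential_operator[OF causal[OF \<rho>]])
  qed
qed

end
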